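(* Let $n\ge1$ and let $\lambda,\mu,\nu$ be partitions with at most $n$ parts. Then $$(c_\mu*c^{\mathrm{her}}_\nu)(\pi_\lambda)=G^{\mathrm{her},\lambda}_{\mu,\nu}(\mathfrak{o}),$$ i.e. the coefficient of $c^{\mathrm{her}}_\lambda$ in $c_\mu*c^{\mathrm{her}}_\nu$ equals the number of submodules $M'$ of a Hermitian $\mathfrak{o}$-module $M$ of type $\lambda$ such that $M/M'$ is an $\mathfrak{o}$-module of type $\mu$, $M'^\perp$ is isotropic, and $M'/M'^\perp$ is a Hermitian $\mathfrak{o}$-module of type $\nu$.
   Context: $F$ is a non-archimedean local field of characteristic $0$ with an involution $*$ (order-2 field automorphism), fixed field $F_0$, $F/F_0$ unramified; $\mathfrak{o}$ the ring of integers of $F$, $\mathfrak{p}$ its maximal ideal, $\pi\in F_0\cap\mathfrak{p}$ a generator of $\mathfrak{p}$, $\#\mathfrak{o}/\mathfrak{p}=q^2$. A finite $\mathfrak{o}$-module has type $\mu$ if isomorphic to $\bigoplus_i\mathfrak{o}/\mathfrak{p}^{\mu_i}$. A Hermitian $\mathfrak{o}$-module is a finite $\mathfrak{o}$-module with a perfect pairing $\langle\cdot,\cdot\rangle$ to $F/\mathfrak{o}$, $\mathfrak{o}$-linear in the second variable, with $\langle x,y\rangle=\langle y,x\rangle^*$; it has type $\lambda$ if isomorphic to $\bigoplus_i\mathfrak{o}/\mathfrak{p}^{\lambda_i}$ with $\langle x,y\rangle=x^*\pi_\lambda^{-1}y$, $\pi_\lambda=\mathrm{diag}(\pi^{\lambda_1},\ldots,\pi^{\lambda_n})$,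 $x^*$ the conjugate transpose. For submodule $N$, $N^\perp=\{x\in M:\langle x,y\rangle=0\ \forall y\in N\}$; $N$ isotropic means $N\subset N^\perp$; if $M'^\perp\subset M'$ then $M'/M'^\perp$ inherits a perfect Hermitian pairing. Hecke objects: $G=\mathrm{GL}_n(F)$, $K=\mathrm{GL}_n(\mathfrak{o})$, Haar measure $dy$ with $\mathrm{vol}(K)=1$; $c_\mu$ = indicator of $K\pi_\mu K$; $c^{\mathrm{her}}_\nu$ = indicator of $\{k^*\pi_\nu k:k\in K\}$ inside invertible Hermitian $n\times n$ matrices over $F$. For $g$ compactly supported $K$-bi-invariant on $G$ and $f$ compactly supported on invertible Hermitian matrices and invariant under $x\mapsto k^*xk$, $(g*f)(x)=\int_Gg(y)f(y^{-1}xy^{-*})dy$, with $y^{-*}=(y^{-1})^*$. *)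

theory Defs
  imports
    "Jordan_Normal_Form.Matrix"
    "HOL-Algebra.QuotRing"
    "HOL-Analysis.Bochner_Integration"
begin

section \<open>Local fields with an unramified involution\<close>

text \<open>
  A valuation is a function \<open>v :: 'a \<Rightarrow> int\<close> that is only meaningful on nonzero elements; the value
  \<open>v 0\<close> is never used. For \<open>k \<ge> 0\<close> the set below is the ideal \<open>\<pp>\<^sup>k\<close>, and for \<open>k < 0\<close> the
  corresponding fractional ideal.
\<close>

definition val_ideal :: "('a::field \<Rightarrow> int) \<Rightarrow> int \<Rightarrow> 'a set" where
  "val_ideal v k = {x. x = 0 \<or> k \<le> v x}"

definition val_ring :: "('a::field \<Rightarrow> int) \<Rightarrow> 'a ring" where
  "val_ring v = \<lparr>carrier = val_ideal v 0, monoid.mult = (*), one = 1, zero = 0, add = (+)\<rparr>"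

text \<open>
  A non-archimedean local field of characteristic 0 with its normalized valuation: complete for a
  discrete valuation, with finite residue field.
\<close>

locale nonarch_local_field =
  fixes v :: "'a::field_char_0 \<Rightarrow> int"
  assumes val_mult: "\<And>x y. x \<noteq> 0 \<Longrightarrow> y \<noteq> 0 \<Longrightarrow> v (x * y) = v x + v y"
    and val_add: "\<And>x y. x \<noteq> 0 \<Longrightarrow> y \<noteq> 0 \<Longrightarrow> x + y \<noteq> 0 \<Longrightarrow> min (v x) (v y) \<le> v (x + y)"
    and val_normalized: "v ` (UNIV - {0}) = UNIV"
    and val_complete:
      "\<And>s :: nat \<Rightarrow> 'a. \<forall>k. \<exists>N. \<forall>i\<ge>N. \<forall>j\<ge>N. s i - s j \<in> val_ideal v k \<Longrightarrow>
         \<exists>x. \<forall>k. \<exists>N. \<forall>i\<ge>N. s i - x \<in> val_ideal v k"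
    and finite_residue_field: "finite (carrier (val_ring v Quot val_ideal v 1))"

text \<open>
  The extension \<open>F/F\<^sub>0\<close>, where \<open>F\<^sub>0\<close> is the fixed field, is unramified: \<open>F\<^sub>0\<close> and \<open>F\<close> have the same
  value group, i.e. the ramification index is 1. The residue extension is separable because the
  residue fields are finite. Compatibility of \<open>v\<close> with \<open>star\<close> is not assumed; it is automatic.
\<close>

locale unramified_involution = nonarch_local_field v
  for v :: "'a::field_char_0 \<Rightarrow> int" +
  fixes star :: "'a \<Rightarrow> 'a" and \<pi> :: 'a
  assumes star_add: "\<And>x y. star (x + y) = star x + star y"
    and star_mult: "\<And>x y. star (x * y) = star x * star y"
    and star_star: "\<And>x. star (star x) = x"
    and star_nontrivial: "star \<noteq> id"
    and unramified: "v ` ({x. star x = x} - {0}) = v ` (UNIV - {0})"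
    and pi_fixed: "star \<pi> = \<pi>"
    and pi_generates: "PIdl\<^bsub>val_ring v\<^esub> \<pi> = val_ideal v 1"

text \<open>A partition with at most \<open>n\<close> parts; parts are indexed from 0.\<close>

definition partition_le :: "nat \<Rightarrow> (nat \<Rightarrow> nat) \<Rightarrow> bool" where
  "partition_le n lam \<longleftrightarrow> antimono lam \<and> (\<forall>i\<ge>n. lam i = 0)"


section \<open>Modules over the ring of integers\<close>

text \<open>
  Modules use the record of \<open>HOL-Algebra\<close>, whose ring multiplication and unit are irrelevant for
  modules and left unspecified. Scalar multiplication on cosets follows \<^const>\<open>rcoset_mult\<close>:
  for a submodule \<open>N\<close> and a scalar \<open>r\<close> all the cosets in the union coincide.
\<close>

definition quot_module :: "('r, 'm, 'e) module_scheme \<Rightarrow> 'm set \<Rightarrow> ('r, 'm set) module" where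
  "quot_module M N =
    \<lparr>carrier = a_rcosets\<^bsub>M\<^esub> N, monoid.mult = undefined, one = undefined, zero = N, add = set_add M,
     smult = (\<lambda>r X. \<Union>x\<in>X. N +>\<^bsub>M\<^esub> (r \<odot>\<^bsub>M\<^esub> x))\<rparr>"

definition direct_sum :: "'i set \<Rightarrow> ('i \<Rightarrow> ('r, 'm) module) \<Rightarrow> ('r, 'i \<Rightarrow> 'm) module" where
  "direct_sum I M =
    \<lparr>carrier = (\<Pi>\<^sub>E i\<in>I. carrier (M i)), monoid.mult = undefined, one = undefined,
     zero = (\<lambda>i\<in>I. \<zero>\<^bsub>M i\<^esub>), add = (\<lambda>x y. \<lambda>i\<in>I. x i \<oplus>\<^bsub>M i\<^esub> y i),
     smult = (\<lambda>r x. \<lambda>i\<in>I. r \<odot>\<^bsub>M i\<^esub> x i)\<rparr>"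

definition mod_hom ::
    "('r, 'c) ring_scheme \<Rightarrow> ('r, 'm, 'd) module_scheme \<Rightarrow> ('r, 'n, 'e) module_scheme \<Rightarrow> ('m \<Rightarrow> 'n) set"
  where
  "mod_hom R M N = {f \<in> carrier M \<rightarrow> carrier N.
     (\<forall>x\<in>carrier M. \<forall>y\<in>carrier M. f (x \<oplus>\<^bsub>M\<^esub> y) = f x \<oplus>\<^bsub>N\<^esub> f y) \<and>
     (\<forall>r\<in>carrier R. \<forall>x\<in>carrier M. f (r \<odot>\<^bsub>M\<^esub> x) = r \<odot>\<^bsub>N\<^esub> f x)}"

definition mod_iso ::
    "('r, 'c) ring_scheme \<Rightarrow> ('r, 'm, 'd) module_scheme \<Rightarrow> ('r, 'n, 'e) module_scheme \<Rightarrow> ('m \<Rightarrow> 'n) set"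
  where
  "mod_iso R M N = {f \<in> mod_hom R M N. bij_betw f (carrier M) (carrier N)}"

definition int_module :: "('a::field \<Rightarrow> int) \<Rightarrow> ('a, 'a) module" where
  "int_module v = \<lparr>carrier = val_ideal v 0, monoid.mult = (*), one = 1, zero = 0, add = (+), smult = (*)\<rparr>"

definition field_module :: "('a::field, 'a) module" where
  "field_module = \<lparr>carrier = UNIV, monoid.mult = (*), one = 1, zero = 0, add = (+), smult = (*)\<rparr>"

definition F_mod_o :: "('a::field \<Rightarrow> int) \<Rightarrow> ('a, 'a set) module" where
  "F_mod_o v = quot_module field_module (val_ideal v 0)"

definition type_module ::
    "('a::field \<Rightarrow> int) \<Rightarrow> nat \<Rightarrow> (nat \<Rightarrow> nat) \<Rightarrow> ('a, nat \<Rightarrow> 'a set) module" where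
  "type_module v n mu =
     direct_sum {..<n} (\<lambda>i. quot_module (int_module v) (val_ideal v (int (mu i))))"

definition has_type ::
    "('a::field \<Rightarrow> int) \<Rightarrow> nat \<Rightarrow> (nat \<Rightarrow> nat) \<Rightarrow> ('a, 'm) module \<Rightarrow> bool" where
  "has_type v n mu M \<longleftrightarrow>
     Module.module (val_ring v) M \<and> finite (carrier M) \<and>
     mod_iso (val_ring v) M (type_module v n mu) \<noteq> {}"


section \<open>Hermitian modules\<close>

text \<open>
  Values of a pairing are elements of \<open>F/\<oo>\<close>, i.e. cosets, so the involution acts on them by taking
  images. Homomorphisms into \<open>F/\<oo>\<close> are taken extensional in order to form the set
  \<open>Hom(M, F/\<oo>)\<close>.
\<close>

definition hermitian_module ::
    "('a::field \<Rightarrow> int) \<Rightarrow> ('a \<Rightarrow> 'a) \<Rightarrow> ('a, 'm) module \<Rightarrow> ('m \<Rightarrow> 'm \<Rightarrow> 'a set) \<Rightarrow> bool" where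
  "hermitian_module v star M B \<longleftrightarrow>
     Module.module (val_ring v) M \<and> finite (carrier M) \<and>
     (\<forall>x\<in>carrier M. B x \<in> mod_hom (val_ring v) M (F_mod_o v)) \<and>
     (\<forall>x\<in>carrier M. \<forall>y\<in>carrier M. B x y = star ` B y x) \<and>
     bij_betw (\<lambda>x. restrict (B x) (carrier M)) (carrier M)
       (mod_hom (val_ring v) M (F_mod_o v) \<inter> extensional (carrier M))"

text \<open>
  The pairing \<open>x\<^sup>* \<pi>\<^sub>\<lambda>\<^sup>-\<^sup>1 y\<close> modulo \<open>\<oo>\<close>, computed on arbitrarily chosen representatives of the
  components of \<open>x\<close> and \<open>y\<close>.
\<close>

definition type_pairing ::
    "('a::field \<Rightarrow> int) \<Rightarrow> ('a \<Rightarrow> 'a) \<Rightarrow> 'a \<Rightarrow> nat \<Rightarrow> (nat \<Rightarrow> nat) \<Rightarrow>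
     (nat \<Rightarrow> 'a set) \<Rightarrow> (nat \<Rightarrow> 'a set) \<Rightarrow> 'a set" where
  "type_pairing v star \<pi> n lam x y =
     val_ideal v 0 +>\<^bsub>field_module\<^esub>
       (\<Sum>i<n. star (SOME a. a \<in> x i) * inverse (\<pi> ^ lam i) * (SOME b. b \<in> y i))"

definition has_hermitian_type ::
    "('a::field \<Rightarrow> int) \<Rightarrow> ('a \<Rightarrow> 'a) \<Rightarrow> 'a \<Rightarrow> nat \<Rightarrow> (nat \<Rightarrow> nat) \<Rightarrow>
     ('a, 'm) module \<Rightarrow> ('m \<Rightarrow> 'm \<Rightarrow> 'a set) \<Rightarrow> bool" where
  "has_hermitian_type v star \<pi> n lam M B \<longleftrightarrow>
     hermitian_module v star M B \<and>
     (\<exists>f\<in>mod_iso (val_ring v) M (type_module v n lam).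
        \<forall>x\<in>carrier M. \<forall>y\<in>carrier M. B x y = type_pairing v star \<pi> n lam (f x) (f y))"

definition perp ::
    "('a::field \<Rightarrow> int) \<Rightarrow> ('a, 'm) module \<Rightarrow> ('m \<Rightarrow> 'm \<Rightarrow> 'a set) \<Rightarrow> 'm set \<Rightarrow> 'm set" where
  "perp v M B N = {x \<in> carrier M. \<forall>y\<in>N. B x y = \<zero>\<^bsub>F_mod_o v\<^esub>}"

definition isotropic ::
    "('a::field \<Rightarrow> int) \<Rightarrow> ('a, 'm) module \<Rightarrow> ('m \<Rightarrow> 'm \<Rightarrow> 'a set) \<Rightarrow> 'm set \<Rightarrow> bool" where
  "isotropic v M B N \<longleftrightarrow> N \<subseteq> perp v M B N"

text \<open>
  The pairing on a quotient. When \<open>B\<close> descends to cosets, all members \<open>B x y\<close> of the union are the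
  same coset of \<open>\<oo>\<close>, so the union is that coset.
\<close>

definition quot_pairing :: "('m \<Rightarrow> 'm \<Rightarrow> 'a set) \<Rightarrow> 'm set \<Rightarrow> 'm set \<Rightarrow> 'a set" where
  "quot_pairing B X Y = (\<Union>x\<in>X. \<Union>y\<in>Y. B x y)"

definition hermitian_hall_submodules ::
    "('a::field \<Rightarrow> int) \<Rightarrow> ('a \<Rightarrow> 'a) \<Rightarrow> 'a \<Rightarrow> nat \<Rightarrow> ('a, 'm) module \<Rightarrow> ('m \<Rightarrow> 'm \<Rightarrow> 'a set) \<Rightarrow>
     (nat \<Rightarrow> nat) \<Rightarrow> (nat \<Rightarrow> nat) \<Rightarrow> 'm set set" where
  "hermitian_hall_submodules v star \<pi> n M B mu nu =
     {N. submodule N (val_ring v) M \<and>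
         has_type v n mu (quot_module M N) \<and>
         isotropic v M B (perp v M B N) \<and>
         has_hermitian_type v star \<pi> n nu
           (quot_module (M\<lparr>carrier := N\<rparr>) (perp v M B N)) (quot_pairing B)}"


section \<open>The Hecke algebra and its action on Hermitian matrices\<close>

definition GL :: "'a::field itself \<Rightarrow> nat \<Rightarrow> 'a mat monoid" where
  "GL ty n = units_of (ring_mat ty n ())"

definition GL_int :: "('a::field \<Rightarrow> int) \<Rightarrow> nat \<Rightarrow> 'a mat set" where
  "GL_int v n = {A \<in> carrier (GL TYPE('a) n).
     elements_mat A \<subseteq> val_ideal v 0 \<and> elements_mat (inv\<^bsub>GL TYPE('a) n\<^esub> A) \<subseteq> val_ideal v 0}"

definition adj :: "('a \<Rightarrow> 'a) \<Rightarrow> 'a mat \<Rightarrow> 'a mat" where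
  "adj star A = map_mat star (transpose_mat A)"

definition herm_GL :: "('a::field \<Rightarrow> 'a) \<Rightarrow> nat \<Rightarrow> 'a mat set" where
  "herm_GL star n = {A \<in> carrier (GL TYPE('a) n). adj star A = A}"

definition pi_mat :: "'a::field \<Rightarrow> nat \<Rightarrow> (nat \<Rightarrow> nat) \<Rightarrow> 'a mat" where
  "pi_mat \<pi> n lam = mat_diag n (\<lambda>i. \<pi> ^ lam i)"

definition hecke_c ::
    "('a::field \<Rightarrow> int) \<Rightarrow> 'a \<Rightarrow> nat \<Rightarrow> (nat \<Rightarrow> nat) \<Rightarrow> 'a mat \<Rightarrow> complex" where
  "hecke_c v \<pi> n mu = indicator {k * pi_mat \<pi> n mu * l | k l. k \<in> GL_int v n \<and> l \<in> GL_int v n}"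

definition her_c ::
    "('a::field \<Rightarrow> int) \<Rightarrow> ('a \<Rightarrow> 'a) \<Rightarrow> 'a \<Rightarrow> nat \<Rightarrow> (nat \<Rightarrow> nat) \<Rightarrow> 'a mat \<Rightarrow> complex" where
  "her_c v star \<pi> n nu = indicator {adj star k * pi_mat \<pi> n nu * k | k. k \<in> GL_int v n}"

text \<open>
  The topology of \<open>GL\<^sub>n(F)\<close> as a subspace of \<open>F\<^sup>n\<^sup>\<times>\<^sup>n\<close>; inversion is continuous for it because \<open>F\<close> is a
  topological field.
\<close>

definition GL_topology :: "('a::field \<Rightarrow> int) \<Rightarrow> nat \<Rightarrow> 'a mat topology" where
  "GL_topology v n = topology_generated_by
     {{h \<in> carrier (GL TYPE('a) n). elements_mat (h - g) \<subseteq> val_ideal v k} | g k.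
        g \<in> carrier (GL TYPE('a) n)}"

text \<open>
  A left Haar measure on the Borel sets of \<open>GL\<^sub>n(F)\<close> giving \<open>GL\<^sub>n(\<oo>)\<close> volume 1. Regularity is
  automatic because the group is locally compact and second countable.
\<close>

definition normalized_haar :: "('a::field \<Rightarrow> int) \<Rightarrow> nat \<Rightarrow> 'a mat measure \<Rightarrow> bool" where
  "normalized_haar v n dy \<longleftrightarrow>
     space dy = carrier (GL TYPE('a) n) \<and>
     sets dy = sigma_sets (carrier (GL TYPE('a) n)) {U. openin (GL_topology v n) U} \<and>
     (\<forall>g\<in>carrier (GL TYPE('a) n). \<forall>A\<in>sets dy. emeasure dy ((\<lambda>y. g * y) ` A) = emeasure dy A) \<and>
     (\<forall>C. compactin (GL_topology v n) C \<longrightarrow> emeasure dy C < \<infinity>) \<and>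
     emeasure dy (GL_int v n) = 1"

definition hecke_conv ::
    "('a::field \<Rightarrow> 'a) \<Rightarrow> nat \<Rightarrow> 'a mat measure \<Rightarrow> ('a mat \<Rightarrow> complex) \<Rightarrow> ('a mat \<Rightarrow> complex) \<Rightarrow>
     'a mat \<Rightarrow> complex" where
  "hecke_conv star n dy g f x =
     (\<integral>y. g y * f (inv\<^bsub>GL TYPE('a) n\<^esub> y * x * adj star (inv\<^bsub>GL TYPE('a) n\<^esub> y)) \<partial>dy)"

text \<open>
  \<open>a\<close> is the family of coefficients of the function \<open>f\<close> on invertible Hermitian matrices, written as
  a finite linear combination of the functions \<^const>\<open>her_c\<close> attached to partitions.
\<close>

definition her_expansion ::
    "('a::field \<Rightarrow> int) \<Rightarrow> ('a \<Rightarrow> 'a) \<Rightarrow> 'a \<Rightarrow> nat \<Rightarrow> ('a mat \<Rightarrow> complex) \<Rightarrow>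
     ((nat \<Rightarrow> nat) \<Rightarrow> complex) \<Rightarrow> bool" where
  "her_expansion v star \<pi> n f a \<longleftrightarrow>
     finite {kap. a kap \<noteq> 0} \<and> (\<forall>kap. a kap \<noteq> 0 \<longrightarrow> partition_le n kap) \<and>
     (\<forall>x\<in>herm_GL star n. f x = (\<Sum>kap | a kap \<noteq> 0. a kap * her_c v star \<pi> n kap x))"

end

theory Submission
  imports Defs "Jordan_Normal_Form.Determinant"
begin

text \<open>
  Write \<open>M = \<oo>\<^sup>n / \<pi>\<^sub>\<lambda> \<oo>\<^sup>n\<close>. Submodules of \<open>M\<close> correspond to lattices \<open>y \<oo>\<^sup>n\<close> between \<open>\<pi>\<^sub>\<lambda> \<oo>\<^sup>n\<close> and \<open>\<oo>\<^sup>n\<close>, hence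
  to cosets \<open>y K\<close>. For the image \<open>M'\<close> of \<open>y \<oo>\<^sup>n\<close> the complement \<open>M'\<^sup>\<bottom>\<close> is the image of \<open>\<pi>\<^sub>\<lambda> y\<^sup>-\<^sup>* \<oo>\<^sup>n\<close>, it is
  isotropic iff \<open>A = y\<^sup>-\<^sup>1 \<pi>\<^sub>\<lambda> y\<^sup>-\<^sup>*\<close> is integral, and then \<open>M'/M'\<^sup>\<bottom>\<close> is \<open>\<oo>\<^sup>n / A \<oo>\<^sup>n\<close> with the pairing \<open>x\<^sup>* A\<^sup>-\<^sup>1 z\<close>.
  By elementary divisors and by the diagonalizability of Hermitian matrices over an unramified extension,
  the conditions on \<open>M/M'\<close> and \<open>M'/M'\<^sup>\<bottom>\<close> say that \<open>y \<in> K \<pi>\<^sub>\<mu> K\<close> and that \<open>A\<close> is congruent to \<open>\<pi>\<^sub>\<nu>\<close> under \<open>K\<close>. These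
  are the conditions under which the integrand of the convolution is 1, and each coset \<open>y K\<close> has volume 1.
\<close>

unbundle no vec_syntax
hide_type (open) Finite_Cartesian_Product.vec
hide_const (open) Finite_Cartesian_Product.vec Finite_Cartesian_Product.mat


section \<open>Valuations, traces and norms\<close>

text \<open>That the extension is unramified is felt through two facts: some integer has trace 1,
  and every unit fixed by \<open>star\<close> is a norm. The first produces a diagonal pivot when
  all entries of least valuation lie off the diagonal, the second rescales each diagonal entry to a
  pure power of \<pi>. Residue characteristic 2 is the obstacle in both: 1/2 is not integral there,
  and squares behave differently. Compatibility of \<open>v\<close> with \<open>star\<close> is not
  given either; completeness forces it. \<open>M\<close> is an abstract module on an arbitrary
  carrier. It is therefore handled through a linear surjection from \<oo>^n whose kernel is a
  lattice (\<open>presents\<close>), and lattices are compared by matrices. Normal forms only yield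
  some partitions; that they are the prescribed \<open>mu\<close> and \<open>nu\<close> needs
  uniqueness of the type, which is obtained by counting \<pi>^k-torsion. The statement on
  coefficients needs more: the convolution must be constant on orbits and vanish off finitely many
  of them. Determinants supply the bound, since a partition that occurs has size 2|\<mu>| +
  |\<nu>|.\<close>

lemma mem_val_ideal: "x \<in> val_ideal v k \<longleftrightarrow> x = 0 \<or> k \<le> v x"
  by (simp add: val_ideal_def)

lemma zero_in_val_ideal [simp]: "0 \<in> val_ideal v k"
  by (simp add: mem_val_ideal)

section \<open>Ideals, completeness and residue classes\<close>

context nonarch_local_field
begin

lemma val_one [simp]: "v 1 = 0"
  using val_mult[of 1 1] by simp

lemma val_minus [simp]: "v (- x) = v x"
proof (cases "x = 0")
  case False
  have "v (- 1) = 0" using val_mult[of "-1" "-1"] by simp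
  then show ?thesis using val_mult[of "-1" x] False by simp
qed simp

lemma val_inverse: "x \<noteq> 0 \<Longrightarrow> v (inverse x) = - v x"
  using val_mult[of x "inverse x"] by simp

lemma val_divide: "x \<noteq> 0 \<Longrightarrow> y \<noteq> 0 \<Longrightarrow> v (x / y) = v x - v y"
  by (simp add: divide_inverse val_mult val_inverse)

lemma val_power: "x \<noteq> 0 \<Longrightarrow> v (x ^ k) = int k * v x"
  by (induction k) (simp_all add: val_mult algebra_simps)

lemma val_ideal_mono: "x \<in> val_ideal v k \<Longrightarrow> j \<le> k \<Longrightarrow> x \<in> val_ideal v j"
  by (auto simp: mem_val_ideal)

lemma val_ideal_add: "x \<in> val_ideal v k \<Longrightarrow> y \<in> val_ideal v k \<Longrightarrow> x + y \<in> val_ideal v k"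
  using val_add[of x y] by (cases "x = 0 \<or> y = 0 \<or> x + y = 0") (auto simp: mem_val_ideal)

lemma val_ideal_minus [simp]: "- x \<in> val_ideal v k \<longleftrightarrow> x \<in> val_ideal v k"
  by (simp add: mem_val_ideal)

lemma val_ideal_diff: "x \<in> val_ideal v k \<Longrightarrow> y \<in> val_ideal v k \<Longrightarrow> x - y \<in> val_ideal v k"
  using val_ideal_add[of x k "- y"] by simp

lemma val_ideal_diff_commute: "x - y \<in> val_ideal v k \<longleftrightarrow> y - x \<in> val_ideal v k"
  using val_ideal_minus[of "x - y" k] by simp

lemma val_ideal_mult: "x \<in> val_ideal v j \<Longrightarrow> y \<in> val_ideal v k \<Longrightarrow> x * y \<in> val_ideal v (j + k)"
  by (cases "x = 0 \<or> y = 0") (auto simp: mem_val_ideal val_mult)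

lemma val_ideal_mult_left: "x \<in> val_ideal v 0 \<Longrightarrow> y \<in> val_ideal v k \<Longrightarrow> x * y \<in> val_ideal v k"
  using val_ideal_mult[of x 0 y k] by simp

lemma val_ideal_mult_right: "x \<in> val_ideal v k \<Longrightarrow> y \<in> val_ideal v 0 \<Longrightarrow> x * y \<in> val_ideal v k"
  using val_ideal_mult[of x k y 0] by simp

lemma one_in_val_ring [simp]: "1 \<in> val_ideal v 0"
  by (simp add: mem_val_ideal)

lemma val_ideal_sum: "(\<And>i. i \<in> I \<Longrightarrow> f i \<in> val_ideal v k) \<Longrightarrow> sum f I \<in> val_ideal v k"
  by (induction I rule: infinite_finite_induct) (auto intro: val_ideal_add)

lemma val_ring_prod: "(\<And>i. i \<in> I \<Longrightarrow> f i \<in> val_ideal v 0) \<Longrightarrow> prod f I \<in> val_ideal v 0"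
  by (induction I rule: infinite_finite_induct) (auto intro: val_ideal_mult_left)

lemma val_ring_power: "x \<in> val_ideal v 0 \<Longrightarrow> x ^ k \<in> val_ideal v 0"
  by (induction k) (auto intro: val_ideal_mult_left)

lemma unit_iff: "x \<in> val_ideal v 0 \<and> x \<notin> val_ideal v 1 \<longleftrightarrow> x \<noteq> 0 \<and> v x = 0"
  by (auto simp: mem_val_ideal)

text \<open>If \<open>x + y\<close> had larger valuation than \<open>x\<close>, then
  \<open>x = (x + y) - y\<close> would lie in an ideal that excludes it. Used wherever a leading
  term must survive a perturbation: units, unit determinants, pivots.\<close>

lemma val_add_dominant:
  assumes "x \<noteq> 0" "y \<in> val_ideal v (v x + 1)"
  shows "x + y \<noteq> 0" "v (x + y) = v x"
proof -
  show nz: "x + y \<noteq> 0"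
  proof
    assume "x + y = 0"
    then have "y = - x" by (simp add: add_eq_0_iff)
    then show False using assms by (simp add: mem_val_ideal)
  qed
  have "x \<in> val_ideal v (v x + 1)" if "v x + 1 \<le> v (x + y)"
    using val_ideal_diff[of "x + y" "v x + 1" y] that assms by (simp add: mem_val_ideal)
  then have "\<not> v x + 1 \<le> v (x + y)"
    using assms(1) by (auto simp: mem_val_ideal)
  moreover have "x + y \<in> val_ideal v (v x)"
    using assms by (intro val_ideal_add) (auto simp: mem_val_ideal)
  ultimately show "v (x + y) = v x"
    using nz by (auto simp: mem_val_ideal)
qed

lemma zero_if_in_all_ideals:
  assumes "\<And>k. x \<in> val_ideal v (int k)"
  shows "x = 0"
  using assms[of "nat (v x) + 1"] by (auto simp: mem_val_ideal split: if_splits)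

text \<open>Completeness with an explicit rate: the differences telescope, so \<open>s i\<close>
  agrees with the limit modulo the \<open>i\<close>-th power of the maximal ideal. The successive
  approximations for the Artin-Schreier equation and for the norm equation both end here.\<close>

lemma limit_of_refinements:
  assumes step: "\<And>i. s (Suc i) - s i \<in> val_ideal v (int i)"
  shows "\<exists>x. \<forall>i. s i - x \<in> val_ideal v (int i)"
proof -
  have le: "s j - s i \<in> val_ideal v (int i)" if "i \<le> j" for i j
    using that
  proof (induction j rule: dec_induct)
    case (step j)
    have "(s (Suc j) - s j) + (s j - s i) \<in> val_ideal v (int i)"
      by (rule val_ideal_add[OF val_ideal_mono[OF assms[of j]] step.IH]) (use step in simp)
    then show ?case by simp
  qed simp
  have "\<exists>N. \<forall>i\<ge>N. \<forall>j\<ge>N. s i - s j \<in> val_ideal v k" for k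
  proof (intro exI allI impI)
    fix i j assume "nat k \<le> i" "nat k \<le> j"
    then have "(s i - s (nat k)) - (s j - s (nat k)) \<in> val_ideal v (int (nat k))"
      by (intro val_ideal_diff le)
    then show "s i - s j \<in> val_ideal v k"
      by (auto intro: val_ideal_mono)
  qed
  then obtain x where x: "\<And>k. \<exists>N. \<forall>i\<ge>N. s i - x \<in> val_ideal v k"
    using val_complete[of s] by blast
  have "s i - x \<in> val_ideal v (int i)" for i
  proof -
    obtain N where "\<forall>j\<ge>N. s j - x \<in> val_ideal v (int i)" using x by blast
    then have "(s (max i N) - x) - (s (max i N) - s i) \<in> val_ideal v (int i)"
      by (intro val_ideal_diff[of "s (max i N) - x"] le) auto
    then show ?thesis by simp
  qed
  then show ?thesis by blast
qed

text \<open>One notion of coset serves three purposes: \<open>k = 1\<close> gives residue classes,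
  \<open>k = 0\<close> gives elements of F/\<oo>, and \<open>k = mu i\<close> gives the components
  of a module of type \<open>mu\<close>.\<close>

definition val_coset :: "int \<Rightarrow> 'a \<Rightarrow> 'a set" where
  "val_coset k x = {y. y - x \<in> val_ideal v k}"

abbreviation residue :: "'a \<Rightarrow> 'a set" where
  "residue \<equiv> val_coset 1"

lemma val_coset_self [simp]: "x \<in> val_coset k x"
  by (simp add: val_coset_def)

lemma val_coset_eq_iff: "val_coset k x = val_coset k y \<longleftrightarrow> x - y \<in> val_ideal v k"
proof
  assume "val_coset k x = val_coset k y"
  moreover have "x \<in> val_coset k x" by simp
  ultimately show "x - y \<in> val_ideal v k" by (simp add: val_coset_def)
next
  assume h: "x - y \<in> val_ideal v k"
  have "z - x \<in> val_ideal v k \<longleftrightarrow> z - y \<in> val_ideal v k" for z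
    using val_ideal_add[OF _ h, of "z - x"] val_ideal_diff[OF _ h, of "z - y"] by auto
  then show "val_coset k x = val_coset k y" by (auto simp: val_coset_def)
qed

lemma finite_residues: "finite (residue ` val_ideal v 0)"
proof -
  have "val_ideal v 1 +>\<^bsub>val_ring v\<^esub> x = residue x" for x
    unfolding a_r_coset_def' val_coset_def val_ring_def
    by (auto simp: algebra_simps intro!: bexI[of _ "_ - x"])
  then have "carrier (val_ring v Quot val_ideal v 1) = residue ` val_ideal v 0"
    by (auto simp: FactRing_def A_RCOSETS_def' val_ring_def)
  then show ?thesis using finite_residue_field by simp
qed

text \<open>Solved by iterating \<open>y \<mapsto> y\<^sup>2 - a\<close>, a contraction of the maximal ideal.\<close>

lemma artin_schreier_root:
  assumes a: "a \<in> val_ideal v 1"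
  shows "\<exists>y. y * y - y = a"
proof -
  define s where "s = rec_nat 0 (\<lambda>_ y. y * y - a)"
  have s0: "s 0 = 0" and sS: "s (Suc i) = s i * s i - a" for i by (simp_all add: s_def)
  have mem: "s i \<in> val_ideal v 1" for i
  proof (induction i)
    case (Suc i)
    then have "s i * s i \<in> val_ideal v 1"
      by (intro val_ideal_mult_left) (auto intro: val_ideal_mono)
    then show ?case using a by (simp add: sS val_ideal_diff)
  qed (simp add: s0)
  have "s (Suc i) - s i \<in> val_ideal v (int i)" for i
  proof (induction i)
    case 0
    show ?case using val_ideal_mono[OF mem[of 1], of 0] by (simp add: s0)
  next
    case (Suc i)
    have "s (Suc (Suc i)) - s (Suc i) = (s (Suc i) - s i) * (s (Suc i) + s i)"
      by (simp add: sS algebra_simps)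
    moreover have "(s (Suc i) - s i) * (s (Suc i) + s i) \<in> val_ideal v (int i + 1)"
      by (intro val_ideal_mult Suc.IH val_ideal_add mem)
    ultimately show ?case by (simp add: add.commute)
  qed
  then obtain y where y: "\<And>i. s i - y \<in> val_ideal v (int i)"
    using limit_of_refinements[of s] by blast
  have yo: "y \<in> val_ideal v 0"
    using val_ideal_diff[OF val_ideal_mono[OF mem[of 0], of 0] y[of 0, simplified]] by simp
  have "y * y - a - y \<in> val_ideal v (int k)" for k
  proof -
    have "(s (Suc k) - y) - (s k - y) * (s k + y) \<in> val_ideal v (int k)"
      by (intro val_ideal_diff val_ideal_mult_right[of _ "int k"] val_ideal_add y yo
          val_ideal_mono[OF mem] val_ideal_mono[OF y[of "Suc k"]]) auto
    then show ?thesis by (simp add: sS algebra_simps)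
  qed
  then have "y * y - a - y = 0" by (rule zero_if_in_all_ideals)
  then show ?thesis by (intro exI[of _ y]) (simp add: algebra_simps)
qed

end

section \<open>The involution: invariance of the valuation, an element of trace 1, norms of
  units\<close>

context unramified_involution
begin

text \<open>Normalization supplies some \<open>t\<close> of valuation 1; as \<pi> generates the
  maximal ideal, \<open>t = r * \<pi>\<close> with \<open>r\<close> integral, which rules out
  \<open>v \<pi> > 1\<close>.\<close>

lemma pi_nonzero [simp]: "\<pi> \<noteq> 0" and val_pi [simp]: "v \<pi> = 1"
proof -
  have ideal: "{r * \<pi> |r. r \<in> val_ideal v 0} = val_ideal v 1"
    using pi_generates by (simp add: cgenideal_def val_ring_def)
  have "1 * \<pi> \<in> {r * \<pi> |r. r \<in> val_ideal v 0}" using one_in_val_ring by blast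
  then have pi_mem: "\<pi> \<in> val_ideal v 1" unfolding ideal by simp
  have "1 \<in> v ` (UNIV - {0})" unfolding val_normalized by simp
  then obtain t where "1 = v t" "t \<in> UNIV - {0}" by (rule imageE)
  then have t: "t \<noteq> 0" "v t = 1" by simp_all
  then have "t \<in> val_ideal v 1" by (simp add: mem_val_ideal)
  then obtain r where r: "r \<in> val_ideal v 0" "t = r * \<pi>"
    unfolding ideal[symmetric] by blast
  then show "\<pi> \<noteq> 0" using t by auto
  moreover have "1 = v r + v \<pi>" using r t val_mult[of r \<pi>] by auto
  ultimately show "v \<pi> = 1" using pi_mem r t by (auto simp: mem_val_ideal)
qed

lemma val_pi_powi [simp]: "v (\<pi> powi k) = k"
  by (cases "k \<ge> 0") (simp_all add: power_int_def val_power val_inverse)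

lemma star_zero [simp]: "star 0 = 0"
  using star_add[of 0 0] by simp

lemma star_eq_zero_iff [simp]: "star x = 0 \<longleftrightarrow> x = 0"
  using star_star[of x] star_zero by metis

lemma star_one [simp]: "star 1 = 1"
proof -
  have "star 1 * star 1 = star 1" by (metis mult_1 star_mult)
  moreover have "star 1 \<noteq> 0" by simp
  ultimately show ?thesis by (metis mult_cancel_left2)
qed

lemma star_minus: "star (- x) = - star x"
  using star_add[of x "- x"] by (simp add: add_eq_0_iff)

lemma star_diff: "star (x - y) = star x - star y"
  using star_add[of x "- y"] by (simp add: star_minus)

lemma star_inverse: "star (inverse x) = inverse (star x)"
proof (cases "x = 0")
  case False
  then have "star x * star (inverse x) = 1" by (simp flip: star_mult)
  then show ?thesis using False by (simp add: inverse_unique)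
qed simp

lemma star_divide: "star (x / y) = star x / star y"
  by (simp add: divide_inverse star_mult star_inverse)

lemma star_power: "star (x ^ k) = star x ^ k"
  by (induction k) (simp_all add: star_mult)

lemma star_pi_powi [simp]: "star (\<pi> powi k) = \<pi> powi k"
  by (simp add: power_int_def star_power star_inverse pi_fixed)

lemma star_sum: "star (sum f I) = (\<Sum>i\<in>I. star (f i))"
  by (induction I rule: infinite_finite_induct) (simp_all add: star_add)

text \<open>
  Compare \<open>v\<close> with \<open>w = v \<circ> star\<close>. If \<open>v x > 0\<close> and \<open>w x < 0\<close>, a power of \<open>\<pi>\<close> moves \<open>w x\<close> to \<open>-1\<close>
  while keeping \<open>v x > 0\<close>; but then \<open>x = y\<^sup>2 - y\<close> is solvable, and \<open>w (y\<^sup>2 - y)\<close> is nonnegative or even.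
\<close>

lemma val_star [simp]: "v (star x) = v x"
proof -
  have no_odd: "v (star a) \<noteq> -1" if "a \<noteq> 0" "v a > 0" for a
  proof
    assume w: "v (star a) = -1"
    have "a \<in> val_ideal v 1" using that by (simp add: mem_val_ideal)
    from artin_schreier_root[OF this] obtain y where y: "y * y - y = a" ..
    define z where "z = star y"
    have "star a = z * z - z" using star_diff star_mult y z_def by metis
    then have z: "star a = z * (z - 1)" by (simp add: right_diff_distrib)
    then have nz: "z \<noteq> 0" "z - 1 \<noteq> 0" using that(1) star_eq_zero_iff[of a] by auto
    show False
    proof (cases "v z < 0")
      case True
      have "- 1 \<in> val_ideal v (v z + 1)" using True by (simp add: mem_val_ideal)
      then have "v (z - 1) = v z" using val_add_dominant(2)[of z "-1"] nz by simp
      then have "v (star a) = 2 * v z" using z nz by (simp add: val_mult)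
      then show False using w by presburger
    next
      case False
      then have "z * (z - 1) \<in> val_ideal v 0"
        by (intro val_ideal_mult_left val_ideal_diff) (auto simp: mem_val_ideal)
      then show False using w z nz by (simp add: mem_val_ideal)
    qed
  qed
  have pos: "v (star a) \<ge> 0" if "a \<noteq> 0" "v a > 0" for a
  proof (rule ccontr)
    assume neg: "\<not> v (star a) \<ge> 0"
    define b where "b = a * \<pi> ^ nat (- v (star a) - 1)"
    have "b \<noteq> 0" "v b > 0" "v (star b) = -1"
      using that neg by (simp_all add: b_def val_mult val_power star_mult star_power pi_fixed)
    then show False using no_odd by blast
  qed
  \<comment> \<open>The factor \<pi> makes the valuation of \<open>a ^ 2 * \<pi>\<close> positive,
    so the previous case applies. It gives \<open>2 * v (star a) + 1 \<ge> 0\<close>, and by parity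
    \<open>v (star a)\<close> is nonnegative.\<close>
  have nonneg: "v (star a) \<ge> 0" if "a \<noteq> 0" "v a \<ge> 0" for a
  proof (rule ccontr)
    assume neg: "\<not> v (star a) \<ge> 0"
    have "v (star (a ^ 2 * \<pi>)) \<ge> 0"
      using that by (intro pos) (simp_all add: val_mult val_power)
    then have "2 * v (star a) + 1 \<ge> 0"
      using that by (simp add: star_mult star_power pi_fixed val_mult val_power)
    then show False using neg by presburger
  qed
  have unit: "v (star a) = 0" if "a \<noteq> 0" "v a = 0" for a
    using nonneg[of a] nonneg[of "inverse a"] that by (simp add: val_inverse star_inverse)
  show ?thesis
  proof (cases "x = 0")
    case False
    define a where "a = x * \<pi> powi (- v x)"
    have "v a = 0" "a \<noteq> 0" using False by (simp_all add: a_def val_mult)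
    then have "v (star a) = 0" by (simp add: unit)
    then show ?thesis using False by (simp add: a_def star_mult val_mult)
  qed simp
qed

lemma star_val_ideal [simp]: "star x \<in> val_ideal v k \<longleftrightarrow> x \<in> val_ideal v k"
  by (simp add: mem_val_ideal)

lemma pi_power_dvd: "x \<in> val_ideal v (int k) \<longleftrightarrow> (\<exists>y\<in>val_ideal v 0. x = \<pi> ^ k * y)"
proof
  assume "x \<in> val_ideal v (int k)"
  then have "x / \<pi> ^ k \<in> val_ideal v 0"
    by (cases "x = 0") (auto simp: mem_val_ideal val_divide val_power)
  then show "\<exists>y\<in>val_ideal v 0. x = \<pi> ^ k * y"
    by (intro bexI[of _ "x / \<pi> ^ k"]) auto
next
  assume "\<exists>y\<in>val_ideal v 0. x = \<pi> ^ k * y"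
  then obtain y where "y \<in> val_ideal v 0" "x = \<pi> ^ k * y" by blast
  moreover have "\<pi> ^ k \<in> val_ideal v (int k)" by (simp add: mem_val_ideal val_power)
  ultimately show "x \<in> val_ideal v (int k)" by (simp add: val_ideal_mult_right)
qed

text \<open>With 2 in the maximal ideal, squaring is the Frobenius map of the residue field: it is
  injective, and finiteness makes it surjective. The map is defined on residue classes through the
  representatives \<open>rep\<close>.\<close>

lemma residue_square_surj:
  assumes two: "(2::'a) \<in> val_ideal v 1" and x: "x \<in> val_ideal v 0"
  shows "\<exists>y\<in>val_ideal v 0. y * y - x \<in> val_ideal v 1"
proof -
  let ?R = "residue ` val_ideal v 0"
  define rep where "rep X = (SOME c. c \<in> val_ideal v 0 \<and> residue c = X)" for X
  have rep: "rep X \<in> val_ideal v 0 \<and> residue (rep X) = X" if "X \<in> ?R" for X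
    unfolding rep_def by (rule someI_ex) (use that in auto)
  define sq where "sq X = residue (rep X * rep X)" for X
  have inj: "inj_on sq ?R"
  proof (rule inj_onI)
    fix X Y assume X: "X \<in> ?R" and Y: "Y \<in> ?R" and eq: "sq X = sq Y"
    define c d where "c = rep X" and "d = rep Y"
    have cd: "c \<in> val_ideal v 0" "d \<in> val_ideal v 0" "residue c = X" "residue d = Y"
      using rep[OF X] rep[OF Y] by (simp_all add: c_def d_def)
    have "c * c - d * d \<in> val_ideal v 1"
      using eq by (simp add: sq_def val_coset_eq_iff c_def d_def)
    \<comment> \<open>The identity behind this is (c - d)^2 = (c^2 - d^2) - 2 d (c - d); both terms
      on the right vanish in the residue field.\<close>
    moreover have "2 * (d * (c - d)) \<in> val_ideal v 1"
      by (intro val_ideal_mult_right[OF two] val_ideal_mult_left val_ideal_diff cd)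
    ultimately have "(c * c - d * d) - 2 * (d * (c - d)) \<in> val_ideal v 1"
      by (rule val_ideal_diff)
    then have "(c - d) * (c - d) \<in> val_ideal v 1" by (simp add: algebra_simps)
    then have "c - d \<in> val_ideal v 1"
      by (cases "c - d = 0") (auto simp: mem_val_ideal val_mult)
    then show "X = Y" using cd val_coset_eq_iff by blast
  qed
  have "sq ` ?R \<subseteq> ?R"
  proof (rule image_subsetI)
    fix X assume "X \<in> ?R"
    then have "rep X \<in> val_ideal v 0" using rep by blast
    then show "sq X \<in> ?R" unfolding sq_def by (intro imageI val_ideal_mult_left)
  qed
  then have "sq ` ?R = ?R"
    by (rule endo_inj_surj[OF finite_residues _ inj])
  then have "residue x \<in> sq ` ?R" using x by simp
  then obtain X where "residue x = sq X" and X: "X \<in> ?R" by (rule imageE)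
  then have "sq X = residue x" by simp
  then show ?thesis
    using rep[OF X] by (intro bexI[of _ "rep X"]) (simp_all add: sq_def val_coset_eq_iff)
qed

text \<open>Suppose that all traces of integers lie in the maximal ideal. Then so does 2, the trace
  of 1, and \<open>y * star y\<close> is congruent to \<open>y * y\<close>, so every residue class
  contains a norm, which is fixed by \<open>star\<close>. As \<pi> is fixed too, repetition expands
  each integer in powers of \<pi> with fixed coefficients. Hence \<open>star\<close> is trivial on
  the integers and, by inversion, on the field.\<close>

lemma trace_one: "\<exists>c\<in>val_ideal v 0. c + star c = 1"
proof -
  have "\<exists>c\<in>val_ideal v 0. c + star c \<notin> val_ideal v 1"
  proof (rule ccontr)
    assume "\<not> ?thesis"
    then have tr: "c + star c \<in> val_ideal v 1" if "c \<in> val_ideal v 0" for c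
      using that by blast
    have two: "(2::'a) \<in> val_ideal v 1" using tr[of 1] by simp
    have approx: "\<exists>z\<in>val_ideal v 0. \<exists>d. star d = d \<and> x = d + \<pi> ^ k * z"
      if "x \<in> val_ideal v 0" for x k
      using that
    proof (induction k)
      case (Suc k)
      then obtain z d where z: "z \<in> val_ideal v 0" "star d = d" "x = d + \<pi> ^ k * z" by blast
      obtain y where y: "y \<in> val_ideal v 0" "y * y - z \<in> val_ideal v 1"
        using residue_square_surj[OF two z(1)] by blast
      have "y * (y + star y) - 2 * (y * y) \<in> val_ideal v 1"
        by (intro val_ideal_diff val_ideal_mult_left[OF y(1)] tr val_ideal_mult_right[OF two] y)
      then have "y * star y - y * y \<in> val_ideal v 1" by (simp add: algebra_simps)
      from val_ideal_add[OF this y(2)] have "z - y * star y \<in> val_ideal v 1"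
        by (simp add: val_ideal_diff_commute[of z])
      then obtain w where w: "w \<in> val_ideal v 0" "z - y * star y = \<pi> * w"
        using pi_power_dvd[of _ 1] by auto
      have zw: "z = y * star y + \<pi> * w" using w(2) by (simp add: algebra_simps)
      have "star (d + \<pi> ^ k * (y * star y)) = d + \<pi> ^ k * (y * star y)"
        by (simp add: star_add star_mult star_power star_star pi_fixed z mult_ac)
      moreover have "x = (d + \<pi> ^ k * (y * star y)) + \<pi> ^ Suc k * w"
        by (simp add: z(3) zw algebra_simps)
      ultimately show ?case using w(1) by blast
    qed (auto intro!: bexI exI[of _ 0])
    have fixed: "star x = x" if x: "x \<in> val_ideal v 0" for x
    proof -
      have "x - star x \<in> val_ideal v (int k)" for k
      proof -
        obtain z d where z: "z \<in> val_ideal v 0" "star d = d" "x = d + \<pi> ^ k * z"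
          using approx[OF x] by blast
        then have "x - star x = \<pi> ^ k * (z - star z)"
          by (simp add: star_add star_mult star_power pi_fixed algebra_simps)
        then show ?thesis
          using z(1) pi_power_dvd val_ideal_diff star_val_ideal by metis
      qed
      then show ?thesis using zero_if_in_all_ideals[of "x - star x"] by simp
    qed
    have "star x = x" for x
    proof (cases "x \<in> val_ideal v 0")
      case False
      then have "inverse x \<in> val_ideal v 0" by (auto simp: mem_val_ideal val_inverse)
      then show ?thesis using fixed[of "inverse x"] by (simp add: star_inverse)
    qed (rule fixed)
    then show False using star_nontrivial by auto
  qed
  then obtain c where c: "c \<in> val_ideal v 0" "c + star c \<notin> val_ideal v 1" by blast
  \<comment> \<open>So far only a trace that is a unit has been found. It is fixed by
    \<open>star\<close>, so dividing by it normalizes the trace to 1.\<close>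
  define t where "t = c + star c"
  have t: "t \<noteq> 0" "v t = 0" "star t = t"
    using c unit_iff[of t] val_ideal_add[of c 0 "star c"]
    by (auto simp: t_def star_add star_star add.commute)
  have "c / t + star (c / t) = 1"
    using t by (simp add: star_divide t_def flip: add_divide_distrib)
  moreover have "c / t \<in> val_ideal v 0"
    using t c by (cases "c = 0") (auto simp: mem_val_ideal val_divide)
  ultimately show ?thesis by blast
qed

text \<open>The fiber over the class of \<open>f 0\<close> contains only the class of 0, because
  there both alternatives in \<open>fiber\<close> say the same. Every other fiber has at most two
  classes, so \<open>S\<close> has at most \<open>1 + 2 * (m - 1)\<close> classes if
  \<open>f\<close> takes \<open>m\<close> values. The strict inequality forces two such value sets
  to meet.\<close>

lemma card_residues_two_to_one:
  fixes f :: "'a \<Rightarrow> 'a" and S :: "'a set"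
  assumes S: "S \<subseteq> val_ideal v 0" "0 \<in> S" "f ` S \<subseteq> val_ideal v 0"
    and fiber: "\<And>a b. a \<in> S \<Longrightarrow> b \<in> S \<Longrightarrow> f a - f b \<in> val_ideal v 1 \<Longrightarrow>
      a - b \<in> val_ideal v 1 \<or> a + b \<in> val_ideal v 1"
  shows "card (residue ` S) < 2 * card (residue ` f ` S)"
proof -
  let ?F = "residue ` f ` S"
  define fib where "fib Y = residue ` {a \<in> S. residue (f a) = Y}" for Y
  have finF: "finite ?F"
    by (rule finite_subset[OF _ finite_residues]) (use S in auto)
  have two: "finite (fib Y) \<and> card (fib Y) \<le> 2" if "Y \<in> ?F" for Y
  proof -
    from that obtain a where a: "a \<in> S" "Y = residue (f a)" by auto
    have "fib Y \<subseteq> {residue a, residue (- a)}"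
    proof
      fix Z assume "Z \<in> fib Y"
      then obtain b where b: "b \<in> S" "residue (f b) = Y" "Z = residue b" by (auto simp: fib_def)
      then show "Z \<in> {residue a, residue (- a)}"
        using fiber[OF b(1) a(1)] a by (auto simp: val_coset_eq_iff)
    qed
    note sub = this
    have "card {residue a, residue (- a)} \<le> 2" by (simp add: card_insert_if)
    then show ?thesis
      using order_trans[OF card_mono[OF _ sub]] finite_subset[OF sub] by simp
  qed
  have one: "card (fib (residue (f 0))) \<le> 1"
  proof -
    have "fib (residue (f 0)) \<subseteq> {residue 0}"
    proof
      fix Z assume "Z \<in> fib (residue (f 0))"
      then obtain b where b: "b \<in> S" "residue (f b) = residue (f 0)" "Z = residue b"
        by (auto simp: fib_def)
      then show "Z \<in> {residue 0}"
        using fiber[OF b(1) S(2)] by (auto simp: val_coset_eq_iff)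
    qed
    from card_mono[OF _ this] show ?thesis by simp
  qed
  have Y0: "residue (f 0) \<in> ?F" using S(2) by auto
  have "residue ` S \<subseteq> (\<Union>Y\<in>?F. fib Y)" by (auto simp: fib_def)
  then have "card (residue ` S) \<le> card (\<Union>Y\<in>?F. fib Y)"
    using two by (intro card_mono finite_UN_I finF) auto
  also have "\<dots> \<le> (\<Sum>Y\<in>?F. card (fib Y))" by (rule card_UN_le[OF finF])
  also have "\<dots> = card (fib (residue (f 0))) + (\<Sum>Y\<in>?F - {residue (f 0)}. card (fib Y))"
    by (rule sum.remove[OF finF Y0])
  also have "\<dots> \<le> 1 + (\<Sum>Y\<in>?F - {residue (f 0)}. 2)"
    using one two by (intro add_mono sum_mono) auto
  also have "\<dots> = 1 + 2 * (card ?F - 1)"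
    using finF Y0 by (simp add: card_Diff_singleton)
  also have "\<dots> < 2 * card ?F"
  proof -
    have "card ?F \<noteq> 0" using finF Y0 by auto
    then show ?thesis by simp
  qed
  finally show ?thesis .
qed

text \<open>Differences \<open>x - star x\<close> are skew, and scaling by powers of the fixed
  element \<pi> turns one of them into a unit. Its square is the constant of the norm form in odd
  residue characteristic.\<close>

lemma skew_unit: "\<exists>d. d \<noteq> 0 \<and> v d = 0 \<and> star d = - d"
proof -
  obtain x where "star x \<noteq> x" using star_nontrivial by (metis eq_id_iff)
  define d where "d = x - star x"
  have d: "d \<noteq> 0" "star d = - d"
    using \<open>star x \<noteq> x\<close> by (simp_all add: d_def star_diff star_star)
  show ?thesis
    using d by (intro exI[of _ "d * \<pi> powi (- v d)"]) (simp add: star_mult val_mult)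
qed

text \<open>
  For an even residue characteristic take a square root modulo \<open>\<pp>\<close>; otherwise the norm form
  \<open>a\<^sup>2 - d\<^sup>2 b\<^sup>2\<close> of a skew unit \<open>d\<close> represents \<open>u\<close> by the pigeonhole principle.
\<close>

lemma norm_approx:
  assumes u: "u \<noteq> 0" "v u = 0" "star u = u"
  shows "\<exists>w\<in>val_ideal v 0. w * star w - u \<in> val_ideal v 1"
proof (cases "(2::'a) \<in> val_ideal v 1")
  case two: True
  obtain w where w: "w \<in> val_ideal v 0" "w * w - u \<in> val_ideal v 1"
    using residue_square_surj[OF two, of u] unit_iff[of u] u by blast
  \<comment> \<open>Both \<open>w\<close> and \<open>star w\<close> are square roots of
    \<open>u\<close> modulo the maximal ideal, hence congruent in residue characteristic 2. The norm
    of \<open>w\<close> is then congruent to \<open>w * w\<close>.\<close>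
  have "star (w * w - u) \<in> val_ideal v 1" using w by simp
  then have "star w * star w - u \<in> val_ideal v 1" by (simp only: star_diff star_mult u)
  from val_ideal_diff[OF w(2) this]
  have "(w * w - u) - (star w * star w - u) \<in> val_ideal v 1" .
  moreover have "2 * (star w * (w - star w)) \<in> val_ideal v 1"
    by (intro val_ideal_mult_right[OF two] val_ideal_mult_left val_ideal_diff) (use w in auto)
  ultimately have "((w * w - u) - (star w * star w - u)) - 2 * (star w * (w - star w)) \<in> val_ideal v 1"
    by (rule val_ideal_diff)
  then have "(w - star w) * (w - star w) \<in> val_ideal v 1" by (simp add: algebra_simps)
  then have "w - star w \<in> val_ideal v 1"
    by (cases "w - star w = 0") (auto simp: mem_val_ideal val_mult)
  from val_ideal_diff[OF w(2) val_ideal_mult_left[OF w(1) this]]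
  have "(w * w - u) - w * (w - star w) \<in> val_ideal v 1" .
  then show ?thesis using w(1) by (intro bexI[of _ w]) (simp_all add: algebra_simps)
next
  case False
  then have two: "(2::'a) \<noteq> 0" "v 2 = 0"
    using unit_iff[of 2] val_ideal_add[of 1 0 1] by simp_all
  obtain d where d: "d \<noteq> 0" "v d = 0" "star d = - d" using skew_unit by blast
  define S where "S = {a \<in> val_ideal v 0. star a = a}"
  have unit_cancel: "c * x \<in> val_ideal v 1 \<longleftrightarrow> x \<in> val_ideal v 1" if "c \<noteq> 0" "v c = 0" for c x
    using that by (cases "x = 0") (auto simp: mem_val_ideal val_mult)
  have prime: "x * y \<in> val_ideal v 1 \<Longrightarrow> x \<in> val_ideal v 1 \<or> y \<in> val_ideal v 1"
    if "x \<in> val_ideal v 0" "y \<in> val_ideal v 0" for x y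
    using that by (cases "x = 0 \<or> y = 0") (auto simp: mem_val_ideal val_mult)
  let ?f = "\<lambda>a. a * a" and ?g = "\<lambda>b. u + (d * d) * (b * b)"
  have uo: "u \<in> val_ideal v 0" and do: "d \<in> val_ideal v 0" using u d by (simp_all add: mem_val_ideal)
  have f: "card (residue ` S) < 2 * card (residue ` ?f ` S)"
  proof (rule card_residues_two_to_one)
    fix a b assume "a \<in> S" "b \<in> S" "a * a - b * b \<in> val_ideal v 1"
    moreover have "a * a - b * b = (a - b) * (a + b)" by (simp add: algebra_simps)
    ultimately show "a - b \<in> val_ideal v 1 \<or> a + b \<in> val_ideal v 1"
      by (intro prime) (auto simp: S_def val_ideal_add val_ideal_diff)
  qed (auto simp: S_def intro: val_ideal_mult_left)
  have g: "card (residue ` S) < 2 * card (residue ` ?g ` S)"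
  proof (rule card_residues_two_to_one)
    fix a b assume "a \<in> S" "b \<in> S" "?g a - ?g b \<in> val_ideal v 1"
    moreover have "?g a - ?g b = (d * d) * ((a - b) * (a + b))" by (simp add: algebra_simps)
    ultimately have "(a - b) * (a + b) \<in> val_ideal v 1"
      using unit_cancel[of "d * d"] d by (simp add: val_mult)
    with \<open>a \<in> S\<close> \<open>b \<in> S\<close> show "a - b \<in> val_ideal v 1 \<or> a + b \<in> val_ideal v 1"
      by (intro prime) (auto simp: S_def val_ideal_add val_ideal_diff)
  next
    show "?g ` S \<subseteq> val_ideal v 0"
      by (auto simp: S_def intro!: val_ideal_add uo val_ideal_mult_left do)
  qed (auto simp: S_def)
  have sub: "residue ` ?f ` S \<subseteq> residue ` S" "residue ` ?g ` S \<subseteq> residue ` S"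
    unfolding image_image
    by (auto simp: S_def star_add star_mult u d intro!: imageI val_ideal_add uo val_ideal_mult_left do)
  have fin: "finite (residue ` S)"
    by (rule finite_subset[OF _ finite_residues]) (auto simp: S_def)
  have "residue ` ?f ` S \<inter> residue ` ?g ` S \<noteq> {}"
  proof
    assume dis: "residue ` ?f ` S \<inter> residue ` ?g ` S = {}"
    have "card (residue ` ?f ` S) + card (residue ` ?g ` S) =
        card (residue ` ?f ` S \<union> residue ` ?g ` S)"
      using dis by (intro card_Un_disjoint[symmetric] finite_subset[OF sub(1) fin] finite_subset[OF sub(2) fin])
    also have "\<dots> \<le> card (residue ` S)" using sub by (intro card_mono fin) auto
    finally show False using f g by linarith
  qed
  then obtain a b where ab: "a \<in> S" "b \<in> S" "residue (?f a) = residue (?g b)" by auto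
  have "a * a - (u + d * d * (b * b)) \<in> val_ideal v 1" using ab(3) by (simp add: val_coset_eq_iff)
  moreover have "(a + b * d) * star (a + b * d) - u = a * a - (u + d * d * (b * b))"
    using ab d by (simp add: S_def star_add star_mult algebra_simps)
  moreover have "a + b * d \<in> val_ideal v 0"
    using ab by (intro val_ideal_add val_ideal_mult_left do) (auto simp: S_def)
  ultimately show ?thesis by (metis (no_types))
qed

text \<open>Newton iteration for the norm equation. Passing from \<open>w\<close> to
  \<open>w + s\<close> changes the norm by a trace that is linear in \<open>s\<close> and by the
  norm of \<open>s\<close>. An element \<open>c\<close> of trace 1 solves the linear part exactly,
  and the quadratic remainder is of higher order.\<close>

lemma norm_surj:
  assumes u: "u \<noteq> 0" "v u = 0" "star u = u"
  shows "\<exists>w. w \<noteq> 0 \<and> v w = 0 \<and> w * star w = u"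
proof -
  obtain c where c: "c \<in> val_ideal v 0" "c + star c = 1" using trace_one by blast
  have unit: "w \<noteq> 0 \<and> v w = 0" if "w \<in> val_ideal v 0" "w * star w - u \<in> val_ideal v 1" for w
  proof -
    have "u + (w * star w - u) \<noteq> 0" "v (u + (w * star w - u)) = 0"
      using val_add_dominant[of u "w * star w - u"] u that by auto
    then have "w \<noteq> 0" "v (w * star w) = 0" by auto
    then show ?thesis by (simp add: val_mult)
  qed
  \<comment> \<open>The exponent is \<open>i + 1\<close> because the start is correct only modulo
    the maximal ideal. The remainder of one step has exponent \<open>2 * (i + 1)\<close>, which
    covers the required \<open>i + 2\<close>.\<close>
  define good where "good i w \<longleftrightarrow> w \<in> val_ideal v 0 \<and> w * star w - u \<in> val_ideal v (int i + 1)" for i w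
  have "\<exists>s. \<forall>i. good i (s i) \<and> s (Suc i) - s i \<in> val_ideal v (int i)"
  proof (rule dependent_nat_choice)
    show "\<exists>w. good 0 w" using norm_approx[OF u] by (auto simp: good_def)
  next
    fix w i assume "good i w"
    then have w: "w \<in> val_ideal v 0" "w * star w - u \<in> val_ideal v (int (i + 1))"
      by (simp_all add: good_def add.commute)
    have wu: "w \<noteq> 0" "v w = 0" using unit[of w] w val_ideal_mono[OF w(2), of 1] by auto
    define t where "t = u - w * star w"
    have t: "t \<in> val_ideal v (int (i + 1))" "star t = t"
      using w(2) val_ideal_diff_commute by (auto simp: t_def star_diff star_mult star_star u mult.commute)
    \<comment> \<open>Chosen so that \<open>s * star w = t * c\<close> and
      \<open>w * star s = t * star c\<close>, the error \<open>t\<close> being fixed; the two add up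
      to \<open>t\<close>.\<close>
    define s where "s = t * c / star w"
    have s: "s \<in> val_ideal v (int (i + 1))"
      unfolding s_def divide_inverse using t c wu
      by (intro val_ideal_mult_right[OF val_ideal_mult_right]) (auto simp: mem_val_ideal val_inverse)
    have "w * star s + s * star w = t * (c + star c)"
      using wu t by (simp add: s_def star_divide star_mult star_star divide_simps) (simp add: algebra_simps)
    then have tr: "w * star s + s * star w = t" using c by simp
    have "(w + s) * star (w + s) - u = (w * star s + s * star w) - t + s * star s"
      by (simp add: t_def star_add algebra_simps)
    then have "(w + s) * star (w + s) - u = s * star s" using tr by simp
    moreover have "s * star s \<in> val_ideal v (int (i + 1) + int (i + 1))"
      using s by (intro val_ideal_mult) auto
    ultimately have "(w + s) * star (w + s) - u \<in> val_ideal v (int (Suc i) + 1)"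
      using val_ideal_mono[of _ "int (i + 1) + int (i + 1)" "int (Suc i) + 1"] by simp
    moreover have "w + s \<in> val_ideal v 0"
      using w s by (intro val_ideal_add) (auto intro: val_ideal_mono)
    moreover have "(w + s) - w \<in> val_ideal v (int i)" using s by (auto intro: val_ideal_mono)
    ultimately show "\<exists>y. good (Suc i) y \<and> y - w \<in> val_ideal v (int i)"
      unfolding good_def by blast
  qed
  then obtain s where s: "\<And>i. good i (s i)" "\<And>i. s (Suc i) - s i \<in> val_ideal v (int i)"
    by blast
  obtain w where w: "\<And>i. s i - w \<in> val_ideal v (int i)" using limit_of_refinements[OF s(2)] by blast
  have so: "s i \<in> val_ideal v 0" for i using s(1)[of i] by (simp add: good_def)
  have wo: "w \<in> val_ideal v 0"
    using val_ideal_diff[OF so[of 0], of "s 0 - w"] w[of 0] by simp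
  have "w * star w - u \<in> val_ideal v (int k)" for k
  proof -
    have "star (s k - w) \<in> val_ideal v (int k)" using w by simp
    then have "(s k - w) * star (s k) + w * star (s k - w) \<in> val_ideal v (int k)"
      using so[of k] by (intro val_ideal_add val_ideal_mult_left[OF wo] val_ideal_mult_right[OF w]) simp_all
    moreover have "s k * star (s k) - u \<in> val_ideal v (int k)"
      using s(1)[of k] val_ideal_mono[of _ "int k + 1" "int k"] by (simp add: good_def)
    ultimately have "(s k * star (s k) - u) - ((s k - w) * star (s k) + w * star (s k - w)) \<in> val_ideal v (int k)"
      by (intro val_ideal_diff[of "s k * star (s k) - u"])
    then show ?thesis by (simp add: star_diff algebra_simps)
  qed
  then have eq: "w * star w - u = 0" by (rule zero_if_in_all_ideals)
  then show ?thesis using unit[OF wo] by (intro exI[of _ w]) simp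
qed

end

section \<open>Matrices over the ring of integers\<close>

lemma GL_carrier: "A \<in> carrier (GL TYPE('a::field) n) \<longleftrightarrow>
    A \<in> carrier_mat n n \<and> (\<exists>B\<in>carrier_mat n n. A * B = 1\<^sub>m n \<and> B * A = 1\<^sub>m n)"
  by (auto simp: GL_def units_of_carrier Units_def ring_mat_simps)

lemma GL_mult [simp]: "monoid.mult (GL TYPE('a::field) n) = (*)"
  by (simp add: GL_def units_of_mult ring_mat_simps)

lemma GL_one [simp]: "one (GL TYPE('a::field) n) = 1\<^sub>m n"
  by (simp add: GL_def units_of_one ring_mat_simps)

lemma GL_group: "group (GL TYPE('a::field) n)"
proof -
  interpret R: ring "ring_mat TYPE('a) n ()" by (rule ring_mat)
  show ?thesis unfolding GL_def by (rule R.units_group)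
qed

lemma GL_carrier_mat: "A \<in> carrier (GL TYPE('a::field) n) \<Longrightarrow> A \<in> carrier_mat n n"
  by (simp add: GL_carrier)

lemma GL_inv:
  assumes "A \<in> carrier (GL TYPE('a::field) n)"
  shows "inv\<^bsub>GL TYPE('a) n\<^esub> A \<in> carrier (GL TYPE('a) n)"
    "inv\<^bsub>GL TYPE('a) n\<^esub> A \<in> carrier_mat n n"
    "A * inv\<^bsub>GL TYPE('a) n\<^esub> A = 1\<^sub>m n" "inv\<^bsub>GL TYPE('a) n\<^esub> A * A = 1\<^sub>m n"
  using group.inv_closed[OF GL_group assms] group.r_inv[OF GL_group assms]
    group.l_inv[OF GL_group assms] GL_carrier_mat by auto

lemma GL_inv_unique:
  assumes "A \<in> carrier_mat n n" "B \<in> carrier_mat n n" "A * B = 1\<^sub>m n" "B * A = (1\<^sub>m n :: 'a::field mat)"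
  shows "A \<in> carrier (GL TYPE('a) n)" "inv\<^bsub>GL TYPE('a) n\<^esub> A = B"
proof -
  show A: "A \<in> carrier (GL TYPE('a) n)" using assms by (auto simp: GL_carrier)
  have B: "B \<in> carrier (GL TYPE('a) n)" using assms by (auto simp: GL_carrier)
  show "inv\<^bsub>GL TYPE('a) n\<^esub> A = B"
    by (rule group.inv_equality[OF GL_group _ A B]) (simp add: assms)
qed

lemma GL_mult_closed:
  "A \<in> carrier (GL TYPE('a::field) n) \<Longrightarrow> B \<in> carrier (GL TYPE('a) n) \<Longrightarrow>
    A * B \<in> carrier (GL TYPE('a) n)"
  using group.is_monoid[OF GL_group] monoid.m_closed GL_mult by metis

lemma GL_inv_mult:
  "A \<in> carrier (GL TYPE('a::field) n) \<Longrightarrow> B \<in> carrier (GL TYPE('a) n) \<Longrightarrow>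
    inv\<^bsub>GL TYPE('a) n\<^esub> (A * B) = inv\<^bsub>GL TYPE('a) n\<^esub> B * inv\<^bsub>GL TYPE('a) n\<^esub> A"
  using group.inv_mult_group[OF GL_group] GL_mult by metis

lemma GL_inv_inv:
  "A \<in> carrier (GL TYPE('a::field) n) \<Longrightarrow> inv\<^bsub>GL TYPE('a) n\<^esub> (inv\<^bsub>GL TYPE('a) n\<^esub> A) = A"
  using group.inv_inv[OF GL_group] by metis

lemma GL_iff_det: "A \<in> carrier (GL TYPE('a::field) n) \<longleftrightarrow> A \<in> carrier_mat n n \<and> det A \<noteq> 0"
  using unit_imp_det_non_zero[of A n "()"] det_non_zero_imp_unit[of A n "()"] GL_carrier_mat[of A n]
  by (auto simp: GL_def units_of_carrier)

lemma adj_carrier [simp]: "A \<in> carrier_mat r c \<Longrightarrow> adj star A \<in> carrier_mat c r"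
  by (simp add: adj_def)

lemma adj_index [simp]:
  "A \<in> carrier_mat r c \<Longrightarrow> i < c \<Longrightarrow> j < r \<Longrightarrow> adj star A $$ (i, j) = star (A $$ (j, i))"
  by (simp add: adj_def)

lemma adj_dim [simp]: "dim_row (adj star A) = dim_col A" "dim_col (adj star A) = dim_row A"
  by (simp_all add: adj_def)

text \<open>Negative \<open>k\<close> is allowed and measures denominators, as needed for arbitrary
  elements of \<open>GL\<close>.\<close>

definition ideal_mat :: "('a::field \<Rightarrow> int) \<Rightarrow> nat \<Rightarrow> nat \<Rightarrow> int \<Rightarrow> 'a mat set" where
  "ideal_mat v r c k = {A \<in> carrier_mat r c. \<forall>i<r. \<forall>j<c. A $$ (i, j) \<in> val_ideal v k}"

lemma ideal_matD:
  assumes "A \<in> ideal_mat v r c k"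
  shows "A \<in> carrier_mat r c" "i < r \<Longrightarrow> j < c \<Longrightarrow> A $$ (i, j) \<in> val_ideal v k"
  using assms by (auto simp: ideal_mat_def)

lemma elements_subset_iff:
  "A \<in> carrier_mat r c \<Longrightarrow> elements_mat A \<subseteq> val_ideal v k \<longleftrightarrow> A \<in> ideal_mat v r c k"
  by (fastforce simp: ideal_mat_def elements_mat_def)

lemma mat_mult_index:
  "A \<in> carrier_mat r m \<Longrightarrow> B \<in> carrier_mat m c \<Longrightarrow> i < r \<Longrightarrow> j < c \<Longrightarrow>
    (A * B) $$ (i, j) = (\<Sum>k<m. A $$ (i, k) * B $$ (k, j))"
  by (simp add: scalar_prod_def lessThan_atLeast0)

lemma mat_vec_index:
  "A \<in> carrier_mat r m \<Longrightarrow> x \<in> carrier_vec m \<Longrightarrow> i < r \<Longrightarrow>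
    (A *\<^sub>v x) $ i = (\<Sum>k<m. A $$ (i, k) * x $ k)"
  by (simp add: scalar_prod_def lessThan_atLeast0)

section \<open>Integral matrices and the group \<open>GL_int\<close>\<close>

context nonarch_local_field
begin

lemma ideal_mat_mono: "A \<in> ideal_mat v r c k \<Longrightarrow> j \<le> k \<Longrightarrow> A \<in> ideal_mat v r c j"
  by (auto simp: ideal_mat_def intro: val_ideal_mono)

lemma ideal_mat_mult:
  assumes "A \<in> ideal_mat v r m j" "B \<in> ideal_mat v m c k"
  shows "A * B \<in> ideal_mat v r c (j + k)"
proof -
  have A: "A \<in> carrier_mat r m" and B: "B \<in> carrier_mat m c" using assms by (auto dest: ideal_matD)
  have "(A * B) $$ (i, l) \<in> val_ideal v (j + k)" if "i < r" "l < c" for i l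
    unfolding mat_mult_index[OF A B that]
    by (intro val_ideal_sum val_ideal_mult) (use assms that in \<open>auto dest: ideal_matD\<close>)
  then show ?thesis using A B by (auto simp: ideal_mat_def)
qed

lemma ideal_mat_mult_int: "A \<in> ideal_mat v r m k \<Longrightarrow> B \<in> ideal_mat v m c 0 \<Longrightarrow> A * B \<in> ideal_mat v r c k"
  using ideal_mat_mult[of A r m k B c 0] by simp

lemma ideal_mat_int_mult: "A \<in> ideal_mat v r m 0 \<Longrightarrow> B \<in> ideal_mat v m c k \<Longrightarrow> A * B \<in> ideal_mat v r c k"
  using ideal_mat_mult[of A r m 0 B c k] by simp

lemma ideal_mat_add: "A \<in> ideal_mat v r c k \<Longrightarrow> B \<in> ideal_mat v r c k \<Longrightarrow> A + B \<in> ideal_mat v r c k"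
  by (auto simp: ideal_mat_def intro!: val_ideal_add)

lemma ideal_mat_one: "1\<^sub>m n \<in> ideal_mat v n n 0"
  by (auto simp: ideal_mat_def)

lemma ideal_mat_zero: "0\<^sub>m r c \<in> ideal_mat v r c k"
  by (auto simp: ideal_mat_def)

lemma ideal_mat_four_block:
  assumes "A \<in> ideal_mat v n n k" "B \<in> ideal_mat v n m k" "C \<in> ideal_mat v m n k" "D \<in> ideal_mat v m m k"
  shows "four_block_mat A B C D \<in> ideal_mat v (n + m) (n + m) k"
  using assms by (auto simp: ideal_mat_def)

lemma det_in_val_ring:
  assumes "A \<in> ideal_mat v n n 0"
  shows "det A \<in> val_ideal v 0"
proof -
  have A: "A \<in> carrier_mat n n" using assms by (rule ideal_matD)
  have sg: "signof p \<in> val_ideal v 0" for p :: "nat \<Rightarrow> nat"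
  proof -
    have "signof p \<in> {1, - 1 :: 'a}" by (rule signof_pm_one)
    then show ?thesis by auto
  qed
  show ?thesis unfolding det_def'[OF A]
    by (intro val_ideal_sum val_ideal_mult_left sg val_ring_prod)
       (use assms in \<open>auto intro!: ideal_matD(2) dest: permutes_in_image\<close>)
qed

lemma prod_congruent:
  assumes "\<And>i. i \<in> I \<Longrightarrow> f i \<in> val_ideal v 0" "\<And>i. i \<in> I \<Longrightarrow> g i \<in> val_ideal v 0"
    "\<And>i. i \<in> I \<Longrightarrow> f i - g i \<in> val_ideal v 1"
  shows "prod f I - prod g I \<in> val_ideal v 1"
  using assms
proof (induction I rule: infinite_finite_induct)
  case (insert i I)
  have "f i * (prod f I - prod g I) + (f i - g i) * prod g I \<in> val_ideal v 1"
    by (intro val_ideal_add val_ideal_mult_left[of "f i"] val_ideal_mult_right[of "f i - g i"]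
        val_ring_prod insert) (use insert in auto)
  then show ?case using insert by (simp add: algebra_simps)
qed auto

text \<open>The Leibniz formula is a polynomial in the entries with coefficients 1 and -1, so it
  respects congruences modulo the maximal ideal.\<close>

lemma det_congruent:
  assumes A: "A \<in> ideal_mat v n n 0" and B: "B \<in> ideal_mat v n n 0"
    and AB: "\<And>i j. i < n \<Longrightarrow> j < n \<Longrightarrow> A $$ (i, j) - B $$ (i, j) \<in> val_ideal v 1"
  shows "det A - det B \<in> val_ideal v 1"
proof -
  have sg: "signof p \<in> val_ideal v 0" for p :: "nat \<Rightarrow> nat"
  proof -
    have "signof p \<in> {1, - 1 :: 'a}" by (rule signof_pm_one)
    then show ?thesis by auto
  qed
  show ?thesis
    unfolding det_def'[OF ideal_matD(1)[OF A]] det_def'[OF ideal_matD(1)[OF B]]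
      sum_subtractf[symmetric] right_diff_distrib[symmetric]
    by (intro val_ideal_sum val_ideal_mult_left sg prod_congruent)
       (auto intro!: ideal_matD(2)[OF A] ideal_matD(2)[OF B] AB dest: permutes_in_image)
qed

lemma GL_int_iff:
  "A \<in> GL_int v n \<longleftrightarrow>
    A \<in> ideal_mat v n n 0 \<and> (\<exists>B\<in>ideal_mat v n n 0. A * B = 1\<^sub>m n \<and> B * A = 1\<^sub>m n)"
proof
  assume A: "A \<in> GL_int v n"
  then have "A \<in> carrier (GL TYPE('a) n)" by (simp add: GL_int_def)
  note inv = GL_inv[OF this] and c = GL_carrier_mat[OF this]
  have "A \<in> ideal_mat v n n 0" "inv\<^bsub>GL TYPE('a) n\<^esub> A \<in> ideal_mat v n n 0"
    using A elements_subset_iff[OF c] elements_subset_iff[OF inv(2)] by (simp_all add: GL_int_def)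
  with inv(3,4) show "A \<in> ideal_mat v n n 0 \<and> (\<exists>B\<in>ideal_mat v n n 0. A * B = 1\<^sub>m n \<and> B * A = 1\<^sub>m n)"
    by blast
next
  assume "A \<in> ideal_mat v n n 0 \<and> (\<exists>B\<in>ideal_mat v n n 0. A * B = 1\<^sub>m n \<and> B * A = 1\<^sub>m n)"
  then obtain B where B: "A \<in> ideal_mat v n n 0" "B \<in> ideal_mat v n n 0" "A * B = 1\<^sub>m n" "B * A = 1\<^sub>m n"
    by blast
  then have c: "A \<in> carrier_mat n n" "B \<in> carrier_mat n n" by (auto dest: ideal_matD)
  note inv = GL_inv_unique[OF c B(3,4)]
  show "A \<in> GL_int v n"
    unfolding GL_int_def using inv B c by (simp add: elements_subset_iff)
qed

lemma GL_int_GL: "A \<in> GL_int v n \<Longrightarrow> A \<in> carrier (GL TYPE('a) n)"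
  by (simp add: GL_int_def)

lemma GL_int_ideal_mat: "A \<in> GL_int v n \<Longrightarrow> A \<in> ideal_mat v n n 0"
  by (simp add: GL_int_iff)

lemma GL_int_carrier: "A \<in> GL_int v n \<Longrightarrow> A \<in> carrier_mat n n"
  using ideal_matD(1) by (auto simp: GL_int_iff)

lemma GL_int_one: "1\<^sub>m n \<in> GL_int v n"
  using ideal_mat_one[of n] by (auto simp: GL_int_iff intro!: bexI[of _ "1\<^sub>m n"])

lemma GL_int_inv: "A \<in> GL_int v n \<Longrightarrow> inv\<^bsub>GL TYPE('a) n\<^esub> A \<in> GL_int v n"
  using GL_inv(1)[of A n] GL_inv_inv[of A n] by (simp add: GL_int_def)

lemma GL_int_mult:
  assumes "A \<in> GL_int v n" "B \<in> GL_int v n"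
  shows "A * B \<in> GL_int v n"
proof -
  let ?i = "\<lambda>X. inv\<^bsub>GL TYPE('a) n\<^esub> X"
  note G = assms[THEN GL_int_GL]
  have "A * B \<in> ideal_mat v n n 0" "?i B * ?i A \<in> ideal_mat v n n 0"
    by (rule ideal_mat_mult_int GL_int_ideal_mat GL_int_inv assms)+
  then show ?thesis
    unfolding GL_int_def using GL_mult_closed[OF G] GL_inv_mult[OF G] elements_subset_iff ideal_matD(1)
    by (metis (no_types, lifting) mem_Collect_eq)
qed

text \<open>Cramer's rule: the inverse is the adjugate divided by the determinant. Here
  \<open>adj_mat\<close> is the adjugate, whereas \<open>adj\<close> is the conjugate
  transpose.\<close>

lemma GL_int_if_det_unit:
  assumes A: "A \<in> ideal_mat v n n 0" and d: "det A \<noteq> 0" "v (det A) = 0"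
  shows "A \<in> GL_int v n"
proof -
  have c: "A \<in> carrier_mat n n" using A by (rule ideal_matD)
  define B where "B = inverse (det A) \<cdot>\<^sub>m adj_mat A"
  have adjc: "adj_mat A \<in> carrier_mat n n" "A * adj_mat A = det A \<cdot>\<^sub>m 1\<^sub>m n"
    "adj_mat A * A = det A \<cdot>\<^sub>m 1\<^sub>m n"
    using adj_mat[OF c] by auto
  have "A * B = inverse (det A) \<cdot>\<^sub>m (A * adj_mat A)"
    unfolding B_def by (rule mult_smult_distrib[OF c adjc(1)])
  then have AB: "A * B = 1\<^sub>m n" using d by (auto simp: adjc(2) intro!: eq_matI)
  have "B * A = inverse (det A) \<cdot>\<^sub>m (adj_mat A * A)"
    unfolding B_def by (rule mult_smult_assoc_mat[OF adjc(1) c])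
  then have BA: "B * A = 1\<^sub>m n" using d by (auto simp: adjc(3) intro!: eq_matI)
  have "B $$ (i, j) \<in> val_ideal v 0" if ij: "i < n" "j < n" for i j
  proof -
    have "mat_delete A j i \<in> ideal_mat v (n - 1) (n - 1) 0"
      using A c by (auto simp: ideal_mat_def mat_delete_def)
    then have "det (mat_delete A j i) \<in> val_ideal v 0" by (rule det_in_val_ring)
    then have "adj_mat A $$ (i, j) \<in> val_ideal v 0"
      using ij c by (auto simp: adj_mat_def cofactor_def intro!: val_ideal_mult_left val_ring_power)
    moreover have "inverse (det A) \<in> val_ideal v 0" using d by (simp add: mem_val_ideal val_inverse)
    ultimately show ?thesis
      using ij adjc(1) by (simp add: B_def val_ideal_mult_left)
  qed
  then have "B \<in> ideal_mat v n n 0" using adjc(1) by (auto simp: ideal_mat_def B_def)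
  then show ?thesis using A AB BA by (auto simp: GL_int_iff)
qed

lemma det_GL_int:
  assumes "A \<in> GL_int v n"
  shows "det A \<noteq> 0" "v (det A) = 0"
proof -
  obtain B where B: "A \<in> ideal_mat v n n 0" "B \<in> ideal_mat v n n 0" "A * B = 1\<^sub>m n"
    using assms by (auto simp: GL_int_iff)
  then have "det A * det B = 1"
    using det_mult[of A n B] by (auto dest: ideal_matD(1))
  moreover from this have nz: "det A \<noteq> 0" "det B \<noteq> 0" by auto
  ultimately have "v (det A) + v (det B) = 0" using val_mult by (metis val_one)
  moreover have "v (det A) \<ge> 0" "v (det B) \<ge> 0"
    using det_in_val_ring B nz by (auto simp: mem_val_ideal)
  ultimately show "det A \<noteq> 0" "v (det A) = 0" using nz by auto
qed

text \<open>A perturbation by the maximal ideal leaves the determinant a unit. The openness of all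
  cosets of \<open>GL_int\<close> rests on this.\<close>

lemma GL_int_open:
  assumes A: "A \<in> GL_int v n" and E: "E \<in> ideal_mat v n n 1"
  shows "A + E \<in> GL_int v n"
proof (rule GL_int_if_det_unit)
  have Ao: "A \<in> ideal_mat v n n 0" using A by (rule GL_int_ideal_mat)
  show AE: "A + E \<in> ideal_mat v n n 0"
    by (intro ideal_mat_add Ao ideal_mat_mono[OF E]) auto
  have "det (A + E) - det A \<in> val_ideal v 1"
    by (rule det_congruent[OF AE Ao]) (use E Ao in \<open>auto simp: ideal_mat_def\<close>)
  then show "det (A + E) \<noteq> 0" "v (det (A + E)) = 0"
    using val_add_dominant[of "det A" "det (A + E) - det A"] det_GL_int[OF A] by simp_all
qed

end

section \<open>Elementary divisors and diagonalization of Hermitian matrices\<close>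

definition block_diag :: "'a::zero mat \<Rightarrow> 'a \<Rightarrow> 'a mat" where
  "block_diag D d = four_block_mat D (0\<^sub>m (dim_row D) 1) (0\<^sub>m 1 (dim_col D)) (mat 1 1 (\<lambda>_. d))"

lemma block_diag_carrier [simp]: "D \<in> carrier_mat n n \<Longrightarrow> block_diag D d \<in> carrier_mat (Suc n) (Suc n)"
  unfolding block_diag_def using four_block_carrier_mat[of D n n "mat 1 1 (\<lambda>_. d)" 1 1] by simp

lemma block_diag_index:
  "D \<in> carrier_mat n n \<Longrightarrow> i < Suc n \<Longrightarrow> j < Suc n \<Longrightarrow> block_diag D d $$ (i, j) =
    (if i < n \<and> j < n then D $$ (i, j) else if i = n \<and> j = n then d else 0)"
  by (auto simp: block_diag_def)

lemma block_diag_mult: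
  fixes D E :: "'a::comm_ring_1 mat"
  assumes "D \<in> carrier_mat n n" "E \<in> carrier_mat n n"
  shows "block_diag D d * block_diag E e = block_diag (D * E) (d * e)"
  using assms unfolding block_diag_def
  by (subst mult_four_block_mat[where ?nr1.0 = n and ?n1.0 = n and ?n2.0 = 1 and ?nr2.0 = 1
        and ?nc1.0 = n and ?nc2.0 = 1]) (auto intro!: eq_matI simp: scalar_prod_def)

lemma det_block_diag:
  fixes D :: "'a::field mat"
  assumes "D \<in> carrier_mat n n"
  shows "det (block_diag D d) = det D * d"
  using det_four_block_mat_lower_left_zero[of D n "0\<^sub>m n 1" 1 "0\<^sub>m 1 n" "mat 1 1 (\<lambda>_. d)"] assms
  by (simp add: block_diag_def det_single)

lemma block_diag_pi_mat:
  "block_diag (pi_mat p n lam) (p ^ m) = pi_mat p (Suc n) (lam(n := m))"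
  by (rule eq_matI) (auto simp: block_diag_def pi_mat_def mat_diag_def)

lemma pi_mat_carrier [simp]: "pi_mat p n lam \<in> carrier_mat n n"
  by (simp add: pi_mat_def)

lemma pi_mat_dim [simp]: "dim_row (pi_mat p n lam) = n" "dim_col (pi_mat p n lam) = n"
  using pi_mat_carrier by blast+

lemma pi_mat_index:
  "i < n \<Longrightarrow> j < n \<Longrightarrow> pi_mat p n lam $$ (i, j) = (if i = j then p ^ lam i else 0)"
  by (simp add: pi_mat_def mat_diag_def)

section \<open>Normal forms under equivalence and under congruence\<close>

context unramified_involution
begin

lemma adj_adj [simp]: "adj star (adj star A) = A"
  by (rule eq_matI) (auto simp: adj_def star_star)

lemma adj_one [simp]: "adj star (1\<^sub>m n) = 1\<^sub>m n"
  by (rule eq_matI) (auto simp: adj_def)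

lemma adj_mult:
  assumes A: "A \<in> carrier_mat r m" and B: "B \<in> carrier_mat m c"
  shows "adj star (A * B) = adj star B * adj star A"
proof (rule eq_matI)
  fix i j assume "i < dim_row (adj star B * adj star A)" "j < dim_col (adj star B * adj star A)"
  then have ij: "i < c" "j < r" using A B by auto
  have "adj star (A * B) $$ (i, j) = star (\<Sum>k<m. A $$ (j, k) * B $$ (k, i))"
    using mult_carrier_mat[OF A B] ij by (simp only: adj_index mat_mult_index[OF A B])
  also have "\<dots> = (\<Sum>k<m. adj star B $$ (i, k) * adj star A $$ (k, j))"
    using A B ij by (simp add: star_sum star_mult mult.commute adj_index[OF A] adj_index[OF B])
  also have "\<dots> = (adj star B * adj star A) $$ (i, j)"
    using A B ij by (intro mat_mult_index[symmetric, of _ c m _ r]) auto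
  finally show "adj star (A * B) $$ (i, j) = (adj star B * adj star A) $$ (i, j)" .
qed (use A B in auto)

lemma adj_pi_mat [simp]: "adj star (pi_mat \<pi> n lam) = pi_mat \<pi> n lam"
  by (rule eq_matI)
     (auto simp: adj_index[OF pi_mat_carrier] pi_mat_index star_power pi_fixed)

lemma adj_block_diag: "D \<in> carrier_mat n n \<Longrightarrow> adj star (block_diag D d) = block_diag (adj star D) (star d)"
  by (rule eq_matI) (auto simp: adj_def block_diag_def)

lemma adj_ideal_mat: "A \<in> ideal_mat v r c k \<Longrightarrow> adj star A \<in> ideal_mat v c r k"
  by (auto simp: ideal_mat_def)

lemma adj_GL_int:
  assumes "A \<in> GL_int v n"
  shows "adj star A \<in> GL_int v n"
proof -
  obtain B where B: "A \<in> ideal_mat v n n 0" "B \<in> ideal_mat v n n 0" "A * B = 1\<^sub>m n" "B * A = 1\<^sub>m n"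
    using assms by (auto simp: GL_int_iff)
  then have c: "A \<in> carrier_mat n n" "B \<in> carrier_mat n n" by (auto dest: ideal_matD)
  have "adj star A * adj star B = 1\<^sub>m n" "adj star B * adj star A = 1\<^sub>m n"
    by (simp_all only: adj_mult[OF c(2,1), symmetric] adj_mult[OF c, symmetric] B adj_one)
  then show ?thesis using B adj_ideal_mat unfolding GL_int_iff by blast
qed

lemma adj_GL:
  assumes "A \<in> carrier (GL TYPE('a) n)"
  shows "adj star A \<in> carrier (GL TYPE('a) n)"
    "inv\<^bsub>GL TYPE('a) n\<^esub> (adj star A) = adj star (inv\<^bsub>GL TYPE('a) n\<^esub> A)"
proof -
  note c = GL_carrier_mat[OF assms] GL_inv(2)[OF assms]
  have "adj star A * adj star (inv\<^bsub>GL TYPE('a) n\<^esub> A) = 1\<^sub>m n"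
    "adj star (inv\<^bsub>GL TYPE('a) n\<^esub> A) * adj star A = 1\<^sub>m n"
    by (simp_all only: adj_mult[OF c(2,1), symmetric] adj_mult[OF c, symmetric] GL_inv[OF assms] adj_one)
  from GL_inv_unique[OF _ _ this] c
  show "adj star A \<in> carrier (GL TYPE('a) n)"
    "inv\<^bsub>GL TYPE('a) n\<^esub> (adj star A) = adj star (inv\<^bsub>GL TYPE('a) n\<^esub> A)" by simp_all
qed

lemma pi_mat_GL:
  "pi_mat \<pi> n lam \<in> carrier (GL TYPE('a) n)"
  "inv\<^bsub>GL TYPE('a) n\<^esub> (pi_mat \<pi> n lam) = mat_diag n (\<lambda>i. inverse (\<pi> ^ lam i))"
proof -
  have "pi_mat \<pi> n lam * mat_diag n (\<lambda>i. inverse (\<pi> ^ lam i)) = 1\<^sub>m n"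
    "mat_diag n (\<lambda>i. inverse (\<pi> ^ lam i)) * pi_mat \<pi> n lam = 1\<^sub>m n"
    by (simp_all add: pi_mat_def)
  from GL_inv_unique[OF _ _ this] show "pi_mat \<pi> n lam \<in> carrier (GL TYPE('a) n)"
    "inv\<^bsub>GL TYPE('a) n\<^esub> (pi_mat \<pi> n lam) = mat_diag n (\<lambda>i. inverse (\<pi> ^ lam i))" by simp_all
qed

lemma pi_power_in_val_ideal: "\<pi> ^ k \<in> val_ideal v (int k)"
  by (simp add: mem_val_ideal val_power)

lemma pi_mat_ideal_mat: "pi_mat \<pi> n lam \<in> ideal_mat v n n 0"
  using val_ideal_mono[OF pi_power_in_val_ideal] by (auto simp: ideal_mat_def pi_mat_index)

lemma block_diag_GL_int:
  assumes "k \<in> GL_int v n" "w \<noteq> 0" "v w = 0"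
  shows "block_diag k w \<in> GL_int v (Suc n)"
proof (rule GL_int_if_det_unit)
  note k = GL_int_ideal_mat[OF assms(1)]
  show "block_diag k w \<in> ideal_mat v (Suc n) (Suc n) 0"
    using k block_diag_index[OF ideal_matD(1)[OF k]] ideal_matD[OF k] assms
    by (auto simp: ideal_mat_def mem_val_ideal[of w])
  show "det (block_diag k w) \<noteq> 0" "v (det (block_diag k w)) = 0"
    using det_block_diag[OF GL_int_carrier[OF assms(1)]] det_GL_int[OF assms(1)] assms
    by (simp_all add: val_mult)
qed

lemma swap_GL_int:
  assumes "k < n" "l < n"
  shows "swaprows_mat n k l \<in> GL_int v n" "adj star (swaprows_mat n k l) = swaprows_mat n k l"
proof -
  have "swaprows_mat n k l \<in> ideal_mat v n n 0" by (auto simp: ideal_mat_def)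
  then show "swaprows_mat n k l \<in> GL_int v n"
    unfolding GL_int_iff using swaprows_mat_inv[OF assms] by blast
  show "adj star (swaprows_mat n k l) = swaprows_mat n k l"
    by (rule eq_matI) (auto simp: adj_def)
qed

lemma swap_swap_index:
  fixes A :: "'a mat"
  assumes A: "A \<in> carrier_mat n n" and ij: "i < n" "j < n" "k < n"
  shows "(swaprows_mat n i k * A * swaprows_mat n j k) $$ (k, k) = A $$ (i, j)"
proof -
  let ?S = "swaprows_mat n i k :: 'a mat" and ?T = "swaprows_mat n j k :: 'a mat"
  have SA: "?S * A \<in> carrier_mat n n" using A by (intro mult_carrier_mat[of _ n n]) auto
  have row: "(?S * A) $$ (k, l) = A $$ (i, l)" if "l < n" for l
  proof -
    have "(?S * A) $$ (k, l) = (\<Sum>m<n. ?S $$ (k, m) * A $$ (m, l))"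
      using A ij that by (intro mat_mult_index[of _ n n _ n]) auto
    also have "\<dots> = (\<Sum>m<n. if m = i then A $$ (m, l) else 0)"
      using ij by (intro sum.cong) auto
    finally show ?thesis using ij by simp
  qed
  have "(?S * A * ?T) $$ (k, k) = (\<Sum>m<n. (?S * A) $$ (k, m) * ?T $$ (m, k))"
    using SA ij by (intro mat_mult_index[of _ n n _ n]) auto
  also have "\<dots> = (\<Sum>m<n. if m = j then A $$ (i, m) else 0)"
    using ij row by (intro sum.cong) auto
  finally show ?thesis using ij by simp
qed

text \<open>One step of Gaussian elimination. The corner has the least valuation allowed, so it
  divides its row and column; the unitriangular factors \<open>E\<close> and \<open>F\<close> are
  therefore integral, and \<open>D\<close> is the Schur complement. For Hermitian \<open>A\<close>
  the row and column multipliers are conjugate to each other, so the step is a congruence.\<close>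

lemma clear_last_row_and_column:
  assumes A: "A \<in> ideal_mat v (Suc n) (Suc n) m" and d: "A $$ (n, n) \<noteq> 0" "v (A $$ (n, n)) = m"
  obtains E F D where "E \<in> GL_int v (Suc n)" "F \<in> GL_int v (Suc n)" "D \<in> ideal_mat v n n m"
    "E * A * F = block_diag D (A $$ (n, n))" "adj star A = A \<Longrightarrow> F = adj star E"
proof -
  note One_nat_def [simp del]
  define d where "d = A $$ (n, n)"
  have Ac: "A \<in> carrier_mat (Suc n) (Suc n)" using A by (rule ideal_matD)
  define A1 where "A1 = mat n n (\<lambda>(i, j). A $$ (i, j))"
  define b where "b = mat n 1 (\<lambda>(i, j). A $$ (i, n))"
  define c where "c = mat 1 n (\<lambda>(i, j). A $$ (n, j))"
  define dm where "dm = mat 1 1 (\<lambda>_. d)"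
  have blk: "A = four_block_mat A1 b c dm"
  proof (rule eq_matI)
    fix i j assume "i < dim_row (four_block_mat A1 b c dm)" "j < dim_col (four_block_mat A1 b c dm)"
    then have "i < n \<or> i = n" "j < n \<or> j = n" by (auto simp: A1_def dm_def)
    then show "A $$ (i, j) = four_block_mat A1 b c dm $$ (i, j)"
      by (elim disjE) (simp_all add: A1_def b_def c_def dm_def d_def)
  qed (use Ac in \<open>auto simp: A1_def dm_def\<close>)
  define b' where "b' = mat n 1 (\<lambda>(i, j). - A $$ (i, n) / d)"
  define c' where "c' = mat 1 n (\<lambda>(i, j). - A $$ (n, j) / d)"
  define E where "E = four_block_mat (1\<^sub>m n) b' (0\<^sub>m 1 n) (1\<^sub>m 1)"
  define F where "F = four_block_mat (1\<^sub>m n) (0\<^sub>m n 1) c' (1\<^sub>m 1)"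
  define D where "D = A1 + b' * c"
  have car [simp]: "A1 \<in> carrier_mat n n" "b \<in> carrier_mat n 1" "c \<in> carrier_mat 1 n" "dm \<in> carrier_mat 1 1"
    "b' \<in> carrier_mat n 1" "c' \<in> carrier_mat 1 n"
    by (simp_all add: A1_def b_def c_def dm_def b'_def c'_def)
  have Dc [simp]: "D \<in> carrier_mat n n"
    unfolding D_def by (intro add_carrier_mat mult_carrier_mat[of _ n 1] car)
  note dims [simp] = car[THEN carrier_matD(1)] car[THEN carrier_matD(2)] carrier_matD[OF Dc]
  have quot: "- x / d \<in> val_ideal v 0" if "x \<in> val_ideal v m" for x
    using that d by (cases "x = 0") (auto simp: mem_val_ideal val_divide d_def)
  have entries: "A $$ (i, j) \<in> val_ideal v m" if "i < Suc n" "j < Suc n" for i j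
    using A that by (rule ideal_matD)
  have b': "b' \<in> ideal_mat v n 1 0" and c': "c' \<in> ideal_mat v 1 n 0"
    using quot entries by (auto simp: ideal_mat_def b'_def c'_def)
  have c: "c \<in> ideal_mat v 1 n m" and A1: "A1 \<in> ideal_mat v n n m"
    using entries by (auto simp: ideal_mat_def c_def A1_def)
  have EF: "E \<in> ideal_mat v (Suc n) (Suc n) 0" "F \<in> ideal_mat v (Suc n) (Suc n) 0"
    unfolding E_def F_def Suc_eq_plus1 by (intro ideal_mat_four_block ideal_mat_one ideal_mat_zero b' c')+
  have "det E = 1" "det F = 1"
    unfolding E_def F_def
    using det_four_block_mat_lower_left_zero[of "1\<^sub>m n" n b' 1 "0\<^sub>m 1 n" "1\<^sub>m 1"]
      det_four_block_mat_upper_right_zero[of "1\<^sub>m n" n "0\<^sub>m n 1" 1 c' "1\<^sub>m 1"] by simp_all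
  then have K: "E \<in> GL_int v (Suc n)" "F \<in> GL_int v (Suc n)"
    using EF by (auto intro!: GL_int_if_det_unit)
  have Dm: "D \<in> ideal_mat v n n m"
    unfolding D_def by (intro ideal_mat_add A1 ideal_mat_int_mult[OF b' c])
  have dnz: "d \<noteq> 0" using d by (simp add: d_def)
  have bd: "b + b' * dm = 0\<^sub>m n 1"
    using dnz by (intro eq_matI) (auto simp: b_def b'_def dm_def scalar_prod_def)
  have cd: "c + dm * c' = 0\<^sub>m 1 n"
    using dnz by (intro eq_matI) (auto simp: c_def c'_def dm_def scalar_prod_def)
  have "E * A = four_block_mat D (b + b' * dm) c dm"
    unfolding blk E_def D_def
    by (subst mult_four_block_mat[where ?nr1.0 = n and ?n1.0 = n and ?n2.0 = 1 and ?nr2.0 = 1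
        and ?nc1.0 = n and ?nc2.0 = 1]) auto
  then have EA: "E * A = four_block_mat D (0\<^sub>m n 1) c dm" by (simp add: bd)
  have "E * A * F = four_block_mat D (0\<^sub>m n 1) (c + dm * c') dm"
    unfolding EA F_def
    by (subst mult_four_block_mat[where ?nr1.0 = n and ?n1.0 = n and ?n2.0 = 1 and ?nr2.0 = 1
        and ?nc1.0 = n and ?nc2.0 = 1]) auto
  then have EAF: "E * A * F = block_diag D d"
    by (simp only: cd) (simp add: block_diag_def dm_def)
  have "F = adj star E" if h: "adj star A = A"
  proof -
    have sym: "star (A $$ (i, j)) = A $$ (j, i)" if "i < Suc n" "j < Suc n" for i j
      using adj_index[OF Ac, of j i star] that h by simp
    show ?thesis
      by (rule eq_matI)
         (auto simp: E_def F_def adj_def b'_def c'_def d_def star_divide star_minus sym)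
  qed
  then show thesis using that K Dm EAF by (simp add: d_def)
qed

text \<open>The natural number \<open>m\<close> bounds all valuations from below by 0, so a least
  one can be found among the naturals.\<close>

lemma min_valuation_entry:
  assumes A: "A \<in> ideal_mat v n n (int m)" and nz: "A \<noteq> 0\<^sub>m n n"
  obtains i j m' where "i < n" "j < n" "m \<le> m'" "A \<in> ideal_mat v n n (int m')"
    "A $$ (i, j) \<noteq> 0" "v (A $$ (i, j)) = int m'"
proof -
  have Ac: "A \<in> carrier_mat n n" using A by (rule ideal_matD)
  define P where "P = (\<lambda>p. fst p < n \<and> snd p < n \<and> A $$ p \<noteq> 0)"
  obtain i j where "i < n" "j < n" "A $$ (i, j) \<noteq> 0"
    using nz Ac by (auto simp: mat_eq_iff)
  then have "P (i, j)" by (simp add: P_def)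
  from ex_has_least_nat[of P, OF this, of "\<lambda>p. nat (v (A $$ p))"]
  obtain p where p: "P p" "\<And>q. P q \<Longrightarrow> nat (v (A $$ p)) \<le> nat (v (A $$ q))" by auto
  have ge: "int m \<le> v (A $$ q)" if "P q" for q
    using that ideal_matD(2)[OF A, of "fst q" "snd q"] by (auto simp: P_def mem_val_ideal)
  have "A $$ (i, j) \<in> val_ideal v (v (A $$ p))" if "i < n" "j < n" for i j
  proof (cases "A $$ (i, j) = 0")
    case False
    then have "P (i, j)" using that by (simp add: P_def)
    moreover from ge[OF this] have "0 \<le> v (A $$ (i, j))" by linarith
    ultimately have "v (A $$ p) \<le> v (A $$ (i, j))" using p(2) nat_le_eq_zle by blast
    then show ?thesis by (simp add: mem_val_ideal)
  qed simp
  then have "A \<in> ideal_mat v n n (v (A $$ p))"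
    using Ac by (simp add: ideal_mat_def)
  then show thesis
    using that[of "fst p" "snd p" "nat (v (A $$ p))"] p(1) ge[OF p(1)] by (simp add: P_def)
qed

text \<open>A congruence moves rows and columns together, so an off-diagonal entry cannot simply be
  swapped into the corner. Adding \<open>c\<close> times row \<open>j\<close> to row
  \<open>i\<close>, and likewise for columns with the conjugate, puts the trace of
  \<open>c * A $$ (j, i)\<close> on the diagonal. This trace can be made equal to
  \<open>\<pi> ^ m\<close>, while the old diagonal entries contribute higher valuation only.\<close>

lemma diagonal_pivot:
  assumes A: "A \<in> ideal_mat v n n (int m)" and herm: "adj star A = A"
    and ij: "i < n" "j < n" "A $$ (i, j) \<noteq> 0" "v (A $$ (i, j)) = int m"
  obtains Q l where "Q \<in> GL_int v n" "l < n" "(Q * A * adj star Q) $$ (l, l) \<noteq> 0"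
    "v ((Q * A * adj star Q) $$ (l, l)) = int m"
proof (cases "\<exists>l<n. A $$ (l, l) \<noteq> 0 \<and> v (A $$ (l, l)) = int m")
  case True
  then obtain l where "l < n" "A $$ (l, l) \<noteq> 0" "v (A $$ (l, l)) = int m" by blast
  then show thesis using that[OF GL_int_one] ideal_matD(1)[OF A] by simp
next
  case False
  have Ac: "A \<in> carrier_mat n n" using A by (rule ideal_matD)
  have diag: "A $$ (l, l) \<in> val_ideal v (int m + 1)" if "l < n" for l
  proof -
    have "A $$ (l, l) \<in> val_ideal v (int m)" using ideal_matD(2)[OF A that that] .
    then show ?thesis using False that by (force simp: mem_val_ideal)
  qed
  have neq: "i \<noteq> j" using False ij by auto
  have sym: "star (A $$ (i, j)) = A $$ (j, i)" using adj_index[OF Ac, of j i star] ij herm by simp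
  obtain t where t: "t \<in> val_ideal v 0" "t + star t = 1" using trace_one by blast
  \<comment> \<open>Thus \<open>c * A $$ (j, i) = t * \<pi> ^ m\<close>, which has trace
    \<open>\<pi> ^ m\<close>; \<open>c\<close> is integral because the entry has valuation exactly
    \<open>m\<close>.\<close>
  define c where "c = t * \<pi> ^ m / A $$ (j, i)"
  have ji: "A $$ (j, i) \<noteq> 0" "v (A $$ (j, i)) = int m" using ij sym[symmetric] by simp_all
  have co: "c \<in> val_ideal v 0"
    using t ji by (cases "t = 0") (auto simp: c_def mem_val_ideal val_divide val_mult val_power)
  define Q where "Q = addrow_mat n c i j"
  have Qc: "Q \<in> carrier_mat n n" by (simp add: Q_def)
  have Q: "Q \<in> GL_int v n"
  proof (rule GL_int_if_det_unit)
    show "Q \<in> ideal_mat v n n 0"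
      using co by (auto simp: Q_def ideal_mat_def intro: val_ideal_add)
    show "det Q \<noteq> 0" "v (det Q) = 0"
      using det_addrow_mat[OF neq, of n c] by (simp_all add: Q_def)
  qed
  have Qi: "Q $$ (i, k) = (if k = i then 1 else 0) + (if k = j then c else 0)" if "k < n" for k
    using that ij neq by (auto simp: Q_def)
  have row: "(Q * A) $$ (i, k) = A $$ (i, k) + c * A $$ (j, k)" if "k < n" for k
  proof -
    have "(Q * A) $$ (i, k) = (\<Sum>l<n. Q $$ (i, l) * A $$ (l, k))"
      using ij that by (intro mat_mult_index[OF Qc Ac])
    also have "\<dots> = (\<Sum>l<n. (if l = i then A $$ (l, k) else 0) + (if l = j then c * A $$ (l, k) else 0))"
      by (intro sum.cong) (auto simp: Qi algebra_simps)
    finally show ?thesis using ij by (simp add: sum.distrib)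
  qed
  have "(Q * A * adj star Q) $$ (i, i) = (\<Sum>l<n. (Q * A) $$ (i, l) * star (Q $$ (i, l)))"
    using ij Qc Ac by (subst mat_mult_index[of _ n n _ n]) (auto simp: adj_index[OF Qc])
  also have "\<dots> = (\<Sum>l<n. (if l = i then A $$ (i, l) + c * A $$ (j, l) else 0)
      + (if l = j then star c * (A $$ (i, l) + c * A $$ (j, l)) else 0))"
    by (intro sum.cong) (auto simp: Qi row star_add algebra_simps)
  also have "\<dots> = A $$ (i, i) + c * A $$ (j, i) + star c * (A $$ (i, j) + c * A $$ (j, j))"
    using ij by (simp add: sum.distrib)
  also have "\<dots> = (c * A $$ (j, i) + star (c * A $$ (j, i))) + (A $$ (i, i) + (star c * c) * A $$ (j, j))"
    unfolding star_mult sym[symmetric] star_star by (simp add: algebra_simps)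
  also have "c * A $$ (j, i) + star (c * A $$ (j, i)) = (t + star t) * \<pi> ^ m"
    using ji by (simp add: c_def star_mult star_power pi_fixed algebra_simps)
  finally have entry: "(Q * A * adj star Q) $$ (i, i) = \<pi> ^ m + (A $$ (i, i) + (star c * c) * A $$ (j, j))"
    using t by simp
  have "A $$ (i, i) + (star c * c) * A $$ (j, j) \<in> val_ideal v (v (\<pi> ^ m) + 1)"
    using diag ij co by (simp add: val_power val_ideal_add val_ideal_mult_left)
  then show thesis
    using that[OF Q ij(1)] val_add_dominant[of "\<pi> ^ m"] by (simp add: entry val_power)
qed

lemma antimono_snoc:
  fixes kap :: "nat \<Rightarrow> nat"
  assumes "\<And>i. i < n \<Longrightarrow> m \<le> kap i" "\<And>i j. i \<le> j \<Longrightarrow> j < n \<Longrightarrow> kap j \<le> kap i" "l \<le> m"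
  shows "\<And>i. i < Suc n \<Longrightarrow> l \<le> (kap(n := m)) i"
    "\<And>i j. i \<le> j \<Longrightarrow> j < Suc n \<Longrightarrow> (kap(n := m)) j \<le> (kap(n := m)) i"
  using assms by (auto simp: less_Suc_eq intro: order_trans)

text \<open>
  Both diagonalizations move an entry of minimal valuation to the last corner, clear its row and
  column, and recurse on the remaining block; this produces the exponents in decreasing order.
\<close>

lemma smith_form_aux:
  assumes "A \<in> ideal_mat v n n (int m)" "det A \<noteq> 0"
  shows "\<exists>k\<in>GL_int v n. \<exists>l\<in>GL_int v n. \<exists>kap. (\<forall>i<n. m \<le> kap i) \<and>
    (\<forall>i j. i \<le> j \<longrightarrow> j < n \<longrightarrow> kap j \<le> kap i) \<and> k * A * l = pi_mat \<pi> n kap"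
  using assms
proof (induction n arbitrary: A m)
  case 0
  then have "1\<^sub>m 0 * A * 1\<^sub>m 0 = pi_mat \<pi> 0 (\<lambda>_. 0)"
    by (intro eq_matI) (auto dest: ideal_matD(1))
  then show ?case using GL_int_one[of 0] by (intro bexI[of _ "1\<^sub>m 0"] exI[of _ "\<lambda>_. 0"]) auto
next
  case (Suc n)
  let ?N = "Suc n"
  have Ac: "A \<in> carrier_mat ?N ?N" using Suc.prems(1) by (rule ideal_matD)
  have "A \<noteq> 0\<^sub>m ?N ?N" using Suc.prems(2) det_zero[of ?N] by auto
  then obtain i j m' where e: "i < ?N" "j < ?N" "m \<le> m'" "A \<in> ideal_mat v ?N ?N (int m')"
    "A $$ (i, j) \<noteq> 0" "v (A $$ (i, j)) = int m'"
    using min_valuation_entry[OF Suc.prems(1)] by metis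
  define S T where "S = (swaprows_mat ?N i n :: 'a mat)" and "T = (swaprows_mat ?N j n :: 'a mat)"
  have ST: "S \<in> GL_int v ?N" "T \<in> GL_int v ?N"
    using e swap_GL_int by (simp_all add: S_def T_def)
  define A' where "A' = S * A * T"
  have A': "A' \<in> ideal_mat v ?N ?N (int m')"
    unfolding A'_def
    by (rule ideal_mat_mult_int[OF ideal_mat_int_mult[OF GL_int_ideal_mat[OF ST(1)] e(4)] GL_int_ideal_mat[OF ST(2)]])
  have corner: "A' $$ (n, n) = A $$ (i, j)"
    unfolding A'_def S_def T_def using Ac e by (intro swap_swap_index) auto
  obtain E F D where EFD: "E \<in> GL_int v ?N" "F \<in> GL_int v ?N" "D \<in> ideal_mat v n n (int m')"
    "E * A' * F = block_diag D (A $$ (i, j))"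
    using clear_last_row_and_column[OF A'] e corner by metis
  note c = GL_int_carrier[OF ST(1)] GL_int_carrier[OF ST(2)] GL_int_carrier[OF EFD(1)] GL_int_carrier[OF EFD(2)]
    ideal_matD(1)[OF A'] ideal_matD(1)[OF EFD(3)]
  have "det (E * A' * F) = det E * (det S * det A * det T) * det F"
    unfolding A'_def by (simp only: det_mult[of _ ?N] mult_carrier_mat[of _ ?N ?N _ ?N] c Ac)
  then have "det D \<noteq> 0"
    using det_GL_int(1) ST EFD Suc.prems(2) det_block_diag[OF c(6)] by auto
  from Suc.IH[OF EFD(3) this] obtain k l kap where kl: "k \<in> GL_int v n" "l \<in> GL_int v n"
    "\<And>i. i < n \<Longrightarrow> m' \<le> kap i" "\<And>i j. i \<le> j \<Longrightarrow> j < n \<Longrightarrow> kap j \<le> kap i" "k * D * l = pi_mat \<pi> n kap"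
    by blast
  \<comment> \<open>The corner entry and \<open>\<pi> ^ m'\<close> differ by the unit
    \<open>w\<close>, which is absorbed by scaling the last column.\<close>
  define w where "w = \<pi> ^ m' / A $$ (i, j)"
  have w: "w \<noteq> 0" "v w = 0" "A $$ (i, j) * w = \<pi> ^ m'"
    using e by (simp_all add: w_def val_divide val_power)
  define k' where "k' = block_diag k 1 * (E * S)"
  define l' where "l' = (T * F) * block_diag l w"
  note kc = GL_int_carrier[OF kl(1)] GL_int_carrier[OF kl(2)]
  have bc: "block_diag k 1 \<in> carrier_mat ?N ?N" "block_diag l w \<in> carrier_mat ?N ?N"
    using kc by simp_all
  have kD: "k * D \<in> carrier_mat n n" using kc c by (intro mult_carrier_mat) auto
  have "k' * A * l' = block_diag k 1 * (E * A' * F) * block_diag l w"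
    unfolding k'_def l'_def A'_def using c Ac bc by (simp add: assoc_mult_mat[of _ ?N ?N _ ?N _ ?N])
  also have "\<dots> = block_diag (k * D * l) (A $$ (i, j) * w)"
    unfolding EFD(4) using kc c(6) kD by (simp add: block_diag_mult[of _ n])
  also have "\<dots> = pi_mat \<pi> ?N (kap(n := m'))"
    unfolding kl(5) w(3) by (rule block_diag_pi_mat)
  finally have eq: "k' * A * l' = pi_mat \<pi> ?N (kap(n := m'))" .
  have K: "k' \<in> GL_int v ?N" "l' \<in> GL_int v ?N"
    unfolding k'_def l'_def using kl(1,2) EFD ST w by (intro GL_int_mult block_diag_GL_int; simp)+
  show ?case
    by (rule bexI[OF _ K(1)], rule bexI[OF _ K(2)], intro exI[of _ "kap(n := m')"] conjI allI impI)
       (rule antimono_snoc[OF kl(3,4) e(3)] eq; assumption)+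
qed

lemma hermitian_form_aux:
  assumes "A \<in> ideal_mat v n n (int m)" "det A \<noteq> 0" "adj star A = A"
  shows "\<exists>k\<in>GL_int v n. \<exists>kap. (\<forall>i<n. m \<le> kap i) \<and>
    (\<forall>i j. i \<le> j \<longrightarrow> j < n \<longrightarrow> kap j \<le> kap i) \<and> k * A * adj star k = pi_mat \<pi> n kap"
  using assms
proof (induction n arbitrary: A m)
  case 0
  then have "1\<^sub>m 0 * A * adj star (1\<^sub>m 0) = pi_mat \<pi> 0 (\<lambda>_. 0)"
    by (intro eq_matI) (auto dest: ideal_matD(1))
  then show ?case using GL_int_one[of 0] by (intro bexI[of _ "1\<^sub>m 0"] exI[of _ "\<lambda>_. 0"]) auto
next
  case (Suc n)
  let ?N = "Suc n"
  have Ac: "A \<in> carrier_mat ?N ?N" using Suc.prems(1) by (rule ideal_matD)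
  have "A \<noteq> 0\<^sub>m ?N ?N" using Suc.prems(2) det_zero[of ?N] by auto
  then obtain i j m' where e: "i < ?N" "j < ?N" "m \<le> m'" "A \<in> ideal_mat v ?N ?N (int m')"
    "A $$ (i, j) \<noteq> 0" "v (A $$ (i, j)) = int m'"
    using min_valuation_entry[OF Suc.prems(1)] by metis
  obtain Q l where Q: "Q \<in> GL_int v ?N" "l < ?N" "(Q * A * adj star Q) $$ (l, l) \<noteq> 0"
    "v ((Q * A * adj star Q) $$ (l, l)) = int m'"
    using diagonal_pivot[OF e(4) Suc.prems(3) e(1,2,5,6)] by metis
  define S where "S = (swaprows_mat ?N l n :: 'a mat)"
  have S: "S \<in> GL_int v ?N" "adj star S = S"
    using Q swap_GL_int by (simp_all add: S_def)
  define A' where "A' = S * (Q * A * adj star Q) * S"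
  note c1 = GL_int_carrier[OF S(1)] GL_int_carrier[OF Q(1)] adj_carrier[OF GL_int_carrier[OF Q(1)], of star] Ac
  have QAQ: "Q * A * adj star Q \<in> ideal_mat v ?N ?N (int m')"
    by (rule ideal_mat_mult_int[OF ideal_mat_int_mult[OF GL_int_ideal_mat[OF Q(1)] e(4)]
          GL_int_ideal_mat[OF adj_GL_int[OF Q(1)]]])
  have A': "A' \<in> ideal_mat v ?N ?N (int m')"
    unfolding A'_def
    by (rule ideal_mat_mult_int[OF ideal_mat_int_mult[OF GL_int_ideal_mat[OF S(1)] QAQ] GL_int_ideal_mat[OF S(1)]])
  define d where "d = (Q * A * adj star Q) $$ (l, l)"
  have corner: "A' $$ (n, n) = d"
    unfolding A'_def S_def d_def using ideal_matD(1)[OF QAQ] Q by (intro swap_swap_index) auto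
  have congr_herm: "adj star (X * B * adj star X) = X * B * adj star X"
    if "adj star B = B" "B \<in> carrier_mat N N" "X \<in> carrier_mat N N" for X B N
    using that adj_mult[of "X * B" N N "adj star X" N] adj_mult[of X N N B N]
    by (simp add: assoc_mult_mat[of _ N N _ N _ N])
  have herm: "adj star A' = A'"
    unfolding A'_def using congr_herm[OF congr_herm[OF Suc.prems(3) Ac c1(2)] ideal_matD(1)[OF QAQ] c1(1)]
    by (simp add: S)
  obtain E D where ED: "E \<in> GL_int v ?N" "D \<in> ideal_mat v n n (int m')"
    "E * A' * adj star E = block_diag D d"
    using clear_last_row_and_column[OF A'] Q(3,4) corner herm unfolding d_def by metis
  note c = c1 GL_int_carrier[OF ED(1)] adj_carrier[OF GL_int_carrier[OF ED(1)], of star]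
    ideal_matD(1)[OF A'] ideal_matD(1)[OF ED(2)]
  \<comment> \<open>Comparing blocks of this Hermitian matrix shows that \<open>D\<close> is
    Hermitian, as the recursion demands, and that \<open>d\<close> is fixed by
    \<open>star\<close>.\<close>
  have "adj star (block_diag D d) = block_diag D d"
    unfolding ED(3)[symmetric] by (rule congr_herm[OF herm c(7) c(5)])
  then have eq: "block_diag (adj star D) (star d) = block_diag D d"
    by (simp add: adj_block_diag[OF c(8)])
  have hD: "adj star D = D"
  proof (rule eq_matI)
    fix i j assume "i < dim_row D" "j < dim_col D"
    then show "adj star D $$ (i, j) = D $$ (i, j)"
      using arg_cong[OF eq, of "\<lambda>X. X $$ (i, j)"] c(8) by (simp add: block_diag_index[of _ n])
  qed (use c in auto)
  have hd: "star d = d"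
    using arg_cong[OF eq, of "\<lambda>X. X $$ (n, n)"] c(8) by (simp add: block_diag_index[of _ n])
  define Qs Es where "Qs = adj star Q" and "Es = adj star E"
  note cs = c[folded Qs_def Es_def]
  have "det (E * A' * Es) = det E * (det S * (det Q * det A * det Qs) * det S) * det Es"
    unfolding A'_def Qs_def[symmetric]
    by (simp only: det_mult[of _ ?N] mult_carrier_mat[of _ ?N ?N _ ?N] cs)
  then have "det D \<noteq> 0"
    using det_GL_int(1)[OF S(1)] det_GL_int(1)[OF Q(1)] det_GL_int(1)[OF ED(1)]
      det_GL_int(1)[OF adj_GL_int[OF Q(1)]] det_GL_int(1)[OF adj_GL_int[OF ED(1)]]
      ED(3) Suc.prems(2) det_block_diag[OF c(8)] by (auto simp: Qs_def Es_def)
  from Suc.IH[OF ED(2) this hD] obtain k kap where k: "k \<in> GL_int v n"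
    "\<And>i. i < n \<Longrightarrow> m' \<le> kap i" "\<And>i j. i \<le> j \<Longrightarrow> j < n \<Longrightarrow> kap j \<le> kap i"
    "k * D * adj star k = pi_mat \<pi> n kap"
    by blast
  have dnz: "d \<noteq> 0" "v d = int m'" using Q by (simp_all add: d_def)
  have "\<pi> ^ m' / d \<noteq> 0" "v (\<pi> ^ m' / d) = 0" "star (\<pi> ^ m' / d) = \<pi> ^ m' / d"
    using dnz hd by (simp_all add: val_divide val_power star_divide star_power pi_fixed)
  \<comment> \<open>Congruence multiplies the corner \<open>d\<close> only by norms, so a pure power
    of \<pi> can be reached because the fixed unit \<open>\<pi> ^ m' / d\<close> is a norm.\<close>
  from norm_surj[OF this] obtain w where w: "w \<noteq> 0" "v w = 0" "w * star w = \<pi> ^ m' / d" by blast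
  have wd: "w * d * star w = \<pi> ^ m'" using w(3) dnz by (simp add: field_simps)
  define k' where "k' = block_diag k w * (E * (S * Q))"
  note kc = GL_int_carrier[OF k(1)] adj_carrier[OF GL_int_carrier[OF k(1)], of star]
  have bc: "block_diag k w \<in> carrier_mat ?N ?N" "block_diag (adj star k) (star w) \<in> carrier_mat ?N ?N"
    using kc by simp_all
  have SQ: "S * Q \<in> carrier_mat ?N ?N" "E * (S * Q) \<in> carrier_mat ?N ?N"
    using c by (auto intro!: mult_carrier_mat)
  have kD: "k * D \<in> carrier_mat n n" using kc c by (intro mult_carrier_mat) auto
  have adjk': "adj star k' = adj star Q * S * adj star E * block_diag (adj star k) (star w)"
    unfolding k'_def adj_mult[OF bc(1) SQ(2)] adj_mult[OF c(5) SQ(1)] adj_mult[OF c(1,2)] S(2)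
      adj_block_diag[OF kc(1)] ..
  have "k' * A * adj star k' = block_diag k w * (E * A' * adj star E) * block_diag (adj star k) (star w)"
    unfolding adjk' unfolding k'_def A'_def Qs_def[symmetric] Es_def[symmetric]
    using cs bc SQ by (simp add: assoc_mult_mat[of _ ?N ?N _ ?N _ ?N] del: block_diag_carrier)
  also have "\<dots> = block_diag (k * D * adj star k) (w * d * star w)"
    unfolding ED(3) using kc c(8) kD by (simp add: block_diag_mult[of _ n])
  also have "\<dots> = pi_mat \<pi> ?N (kap(n := m'))"
    unfolding k(4) wd by (rule block_diag_pi_mat)
  finally have eq: "k' * A * adj star k' = pi_mat \<pi> ?N (kap(n := m'))" .
  have K: "k' \<in> GL_int v ?N"
    unfolding k'_def using k(1) ED S Q w by (intro GL_int_mult block_diag_GL_int; simp)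
  show ?case
    by (rule bexI[OF _ K], intro exI[of _ "kap(n := m')"] conjI allI impI)
       (rule antimono_snoc[OF k(2,3) e(3)] eq; assumption)+
qed

text \<open>The diagonalizations control the first \<open>n\<close> exponents, while a partition is
  a function on all indices. The tail is set to 0; \<open>pi_mat\<close> does not see it.\<close>

lemma partition_truncate:
  assumes "\<And>i j. i \<le> j \<Longrightarrow> j < n \<Longrightarrow> kap j \<le> (kap i :: nat)"
  shows "partition_le n (\<lambda>i. if i < n then kap i else 0)"
  using assms by (auto simp: partition_le_def monotone_def)

lemma pi_mat_cong: "(\<And>i. i < n \<Longrightarrow> kap i = lam i) \<Longrightarrow> pi_mat p n kap = pi_mat p n lam"
  by (rule eq_matI) (auto simp: pi_mat_index)

lemma smith_form:
  assumes "A \<in> ideal_mat v n n 0" "A \<in> carrier (GL TYPE('a) n)"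
  obtains k l kap where "k \<in> GL_int v n" "l \<in> GL_int v n" "partition_le n kap" "A = k * pi_mat \<pi> n kap * l"
proof -
  have Ac: "A \<in> carrier_mat n n" using assms GL_carrier_mat by blast
  have "A \<in> ideal_mat v n n (int 0)" "det A \<noteq> 0" using assms GL_iff_det by auto
  from smith_form_aux[OF this] obtain k l kap where kl: "k \<in> GL_int v n" "l \<in> GL_int v n"
    "\<And>i j. i \<le> j \<Longrightarrow> j < n \<Longrightarrow> kap j \<le> kap i" "k * A * l = pi_mat \<pi> n kap" by blast
  let ?kap = "\<lambda>i. if i < n then kap i else 0"
  let ?i = "\<lambda>X. inv\<^bsub>GL TYPE('a) n\<^esub> X"
  note ki = GL_inv[OF GL_int_GL[OF kl(1)]] and li = GL_inv[OF GL_int_GL[OF kl(2)]]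
  note c = GL_int_carrier[OF kl(1)] GL_int_carrier[OF kl(2)] ki(2) li(2) Ac
  have "pi_mat \<pi> n ?kap = k * A * l" unfolding kl(4) by (rule pi_mat_cong) simp
  then have "?i k * pi_mat \<pi> n ?kap * ?i l = (?i k * k) * A * (l * ?i l)"
    using c by (simp add: assoc_mult_mat[of _ n n _ n _ n])
  also have "\<dots> = A" unfolding ki(4) li(3) using Ac by simp
  finally show thesis
    using that[OF GL_int_inv[OF kl(1)] GL_int_inv[OF kl(2)] partition_truncate[OF kl(3)]] by simp
qed

lemma hermitian_form:
  assumes "A \<in> ideal_mat v n n 0" "A \<in> carrier (GL TYPE('a) n)" "adj star A = A"
  obtains h kap where "h \<in> GL_int v n" "partition_le n kap" "A = adj star h * pi_mat \<pi> n kap * h"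
proof -
  have Ac: "A \<in> carrier_mat n n" using assms GL_carrier_mat by blast
  have "A \<in> ideal_mat v n n (int 0)" "det A \<noteq> 0" using assms GL_iff_det by auto
  from hermitian_form_aux[OF this assms(3)] obtain k kap where k: "k \<in> GL_int v n"
    "\<And>i j. i \<le> j \<Longrightarrow> j < n \<Longrightarrow> kap j \<le> kap i" "k * A * adj star k = pi_mat \<pi> n kap" by blast
  let ?kap = "\<lambda>i. if i < n then kap i else 0"
  \<comment> \<open>Solving the normal form for \<open>A\<close> puts the inverse of
    \<open>k\<close> on the left and its adjoint on the right; \<open>h\<close> is this right
    factor.\<close>
  define h where "h = adj star (inv\<^bsub>GL TYPE('a) n\<^esub> k)"
  have h: "h \<in> GL_int v n" unfolding h_def by (intro adj_GL_int GL_int_inv k)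
  note ki = GL_inv[OF GL_int_GL[OF k(1)]]
  have c: "k \<in> carrier_mat n n" "adj star k \<in> carrier_mat n n" "h \<in> carrier_mat n n"
    "adj star h \<in> carrier_mat n n" "adj star h = inv\<^bsub>GL TYPE('a) n\<^esub> k"
    using GL_int_carrier[OF k(1)] GL_int_carrier[OF h] ki(2) by (simp_all add: h_def)
  have kh: "adj star k * h = 1\<^sub>m n"
    unfolding h_def using adj_mult[OF ki(2) c(1)] ki(4) by simp
  define ks where "ks = adj star k"
  have "pi_mat \<pi> n ?kap = k * A * ks" unfolding ks_def k(3) by (rule pi_mat_cong) simp
  then have "adj star h * pi_mat \<pi> n ?kap * h = (adj star h * k) * A * (ks * h)"
    unfolding c(5) using c(1,3) c(2)[folded ks_def] ki(2) Ac by (simp add: assoc_mult_mat[of _ n n _ n _ n])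
  also have "\<dots> = A" unfolding c(5) ki(4) ks_def kh using Ac by simp
  finally show thesis
    using that[OF h partition_truncate[OF k(2)]] by simp
qed

end

section \<open>Lattices\<close>


definition int_vecs :: "('a::field \<Rightarrow> int) \<Rightarrow> nat \<Rightarrow> 'a vec set" where
  "int_vecs v n = {x \<in> carrier_vec n. \<forall>i<n. x $ i \<in> val_ideal v 0}"

lemma int_vecsD:
  assumes "x \<in> int_vecs v n"
  shows "x \<in> carrier_vec n" "i < n \<Longrightarrow> x $ i \<in> val_ideal v 0"
  using assms by (auto simp: int_vecs_def)

definition mat_lattice :: "('a::field \<Rightarrow> int) \<Rightarrow> nat \<Rightarrow> 'a mat \<Rightarrow> 'a vec set" where
  "mat_lattice v n A = (\<lambda>x. A *\<^sub>v x) ` int_vecs v n"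

definition herm_sum :: "('a::field \<Rightarrow> 'a) \<Rightarrow> nat \<Rightarrow> 'a vec \<Rightarrow> 'a vec \<Rightarrow> 'a" where
  "herm_sum star n x y = (\<Sum>i<n. star (x $ i) * y $ i)"

section \<open>Lattices described by basis matrices\<close>

context nonarch_local_field
begin

lemma int_vecs_zero [simp]: "0\<^sub>v n \<in> int_vecs v n"
  by (auto simp: int_vecs_def)

lemma int_vecs_add: "x \<in> int_vecs v n \<Longrightarrow> y \<in> int_vecs v n \<Longrightarrow> x + y \<in> int_vecs v n"
  by (auto simp: int_vecs_def intro!: val_ideal_add)

lemma int_vecs_smult: "r \<in> val_ideal v 0 \<Longrightarrow> x \<in> int_vecs v n \<Longrightarrow> r \<cdot>\<^sub>v x \<in> int_vecs v n"
  by (auto simp: int_vecs_def intro!: val_ideal_mult_left)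

lemma unit_vec_int [simp]: "unit_vec n i \<in> int_vecs v n"
  by (auto simp: int_vecs_def unit_vec_def)

lemma ideal_mat_mult_int_vecs:
  assumes A: "A \<in> ideal_mat v r c 0" and x: "x \<in> int_vecs v c"
  shows "A *\<^sub>v x \<in> int_vecs v r"
proof -
  note Ac = ideal_matD(1)[OF A] and xc = int_vecsD(1)[OF x]
  have "(A *\<^sub>v x) $ i \<in> val_ideal v 0" if "i < r" for i
    unfolding mat_vec_index[OF Ac xc that]
    using that by (intro val_ideal_sum val_ideal_mult_left ideal_matD(2)[OF A] int_vecsD(2)[OF x]) auto
  then show ?thesis using mult_mat_vec_carrier[OF Ac xc] by (simp add: int_vecs_def)
qed

lemma mult_unit_vec:
  fixes A :: "'a mat"
  assumes "A \<in> carrier_mat r c" "j < c"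
  shows "A *\<^sub>v unit_vec c j = col A j"
proof (rule eq_vecI)
  fix i assume "i < dim_vec (col A j)"
  then have i: "i < r" using assms by simp
  have "(A *\<^sub>v unit_vec c j) $ i = (\<Sum>k<c. if k = j then A $$ (i, k) else 0)"
    unfolding mat_vec_index[OF assms(1) unit_vec_carrier i] using assms by (intro sum.cong) (auto simp: unit_vec_def)
  then show "(A *\<^sub>v unit_vec c j) $ i = col A j $ i" using assms i by (simp add: if_distrib cong: if_cong)
qed (use assms in auto)

lemma ideal_matI_int_vecs:
  assumes A: "A \<in> carrier_mat r c" and "\<And>x. x \<in> int_vecs v c \<Longrightarrow> A *\<^sub>v x \<in> int_vecs v r"
  shows "A \<in> ideal_mat v r c 0"
proof -
  have "A $$ (i, j) \<in> val_ideal v 0" if "i < r" "j < c" for i j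
    using int_vecsD(2)[OF assms(2)[OF unit_vec_int] that(1), of j] mult_unit_vec[OF A that(2)] A that
    by simp
  then show ?thesis using A by (simp add: ideal_mat_def)
qed

lemma lattice_mult_GL_int:
  assumes A: "A \<in> carrier_mat n n" and k: "k \<in> GL_int v n"
  shows "mat_lattice v n (A * k) = mat_lattice v n A"
proof -
  note kc = GL_int_carrier[OF k] and inv = GL_inv[OF GL_int_GL[OF k]]
  have surj: "(\<lambda>x. k *\<^sub>v x) ` int_vecs v n = int_vecs v n"
  proof (intro equalityI image_subsetI subsetI)
    fix x assume x: "x \<in> int_vecs v n"
    then show "k *\<^sub>v x \<in> int_vecs v n" by (rule ideal_mat_mult_int_vecs[OF GL_int_ideal_mat[OF k]])
    have "inv\<^bsub>GL TYPE('a) n\<^esub> k *\<^sub>v x \<in> int_vecs v n"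
      by (rule ideal_mat_mult_int_vecs[OF GL_int_ideal_mat[OF GL_int_inv[OF k]] x])
    moreover have "x = k *\<^sub>v (inv\<^bsub>GL TYPE('a) n\<^esub> k *\<^sub>v x)"
      using assoc_mult_mat_vec[OF kc inv(2) int_vecsD(1)[OF x]] inv(3) int_vecsD(1)[OF x] by simp
    ultimately show "x \<in> (\<lambda>x. k *\<^sub>v x) ` int_vecs v n" by blast
  qed
  have "mat_lattice v n (A * k) = (\<lambda>x. A *\<^sub>v x) ` (\<lambda>x. k *\<^sub>v x) ` int_vecs v n"
    unfolding mat_lattice_def image_image
    by (intro image_cong refl assoc_mult_mat_vec[OF A kc] int_vecsD(1))
  then show ?thesis unfolding surj mat_lattice_def .
qed

lemma GL_mult_vec_cancel:
  assumes "A \<in> carrier (GL TYPE('a) n)" "x \<in> carrier_vec n"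
  shows "A *\<^sub>v (inv\<^bsub>GL TYPE('a) n\<^esub> A *\<^sub>v x) = x" "inv\<^bsub>GL TYPE('a) n\<^esub> A *\<^sub>v (A *\<^sub>v x) = x"
  using assoc_mult_mat_vec[OF GL_carrier_mat[OF assms(1)] GL_inv(2)[OF assms(1)] assms(2)]
    assoc_mult_mat_vec[OF GL_inv(2)[OF assms(1)] GL_carrier_mat[OF assms(1)] assms(2)]
    GL_inv(3,4)[OF assms(1)] assms(2) by simp_all

lemma mem_lattice_iff:
  assumes A: "A \<in> carrier (GL TYPE('a) n)" and x: "x \<in> carrier_vec n"
  shows "x \<in> mat_lattice v n A \<longleftrightarrow> inv\<^bsub>GL TYPE('a) n\<^esub> A *\<^sub>v x \<in> int_vecs v n"
proof
  assume "x \<in> mat_lattice v n A"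
  then obtain z where "z \<in> int_vecs v n" "x = A *\<^sub>v z" by (auto simp: mat_lattice_def)
  then show "inv\<^bsub>GL TYPE('a) n\<^esub> A *\<^sub>v x \<in> int_vecs v n"
    using GL_mult_vec_cancel(2)[OF A int_vecsD(1), of z] by simp
next
  assume "inv\<^bsub>GL TYPE('a) n\<^esub> A *\<^sub>v x \<in> int_vecs v n"
  then show "x \<in> mat_lattice v n A"
    unfolding mat_lattice_def using GL_mult_vec_cancel(1)[OF A x] by (intro image_eqI) auto
qed

lemma lattice_int: "A \<in> ideal_mat v n n 0 \<Longrightarrow> mat_lattice v n A \<subseteq> int_vecs v n"
  by (auto simp: mat_lattice_def ideal_mat_mult_int_vecs)

lemma lattice_subset_iff:
  assumes A: "A \<in> carrier (GL TYPE('a) n)" and B: "B \<in> carrier_mat n n"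
  shows "mat_lattice v n B \<subseteq> mat_lattice v n A \<longleftrightarrow> inv\<^bsub>GL TYPE('a) n\<^esub> A * B \<in> ideal_mat v n n 0"
proof
  note ic = GL_inv(2)[OF A]
  assume sub: "mat_lattice v n B \<subseteq> mat_lattice v n A"
  show "inv\<^bsub>GL TYPE('a) n\<^esub> A * B \<in> ideal_mat v n n 0"
  proof (rule ideal_matI_int_vecs)
    fix x assume x: "x \<in> int_vecs v n"
    then have "B *\<^sub>v x \<in> mat_lattice v n A" using sub by (auto simp: mat_lattice_def)
    then show "inv\<^bsub>GL TYPE('a) n\<^esub> A * B *\<^sub>v x \<in> int_vecs v n"
      using mem_lattice_iff[OF A, of "B *\<^sub>v x"] mult_mat_vec_carrier[OF B int_vecsD(1)[OF x]]
        assoc_mult_mat_vec[OF ic B int_vecsD(1)[OF x]] by simp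
  qed (use ic B in auto)
next
  note ic = GL_inv(2)[OF A]
  assume i: "inv\<^bsub>GL TYPE('a) n\<^esub> A * B \<in> ideal_mat v n n 0"
  show "mat_lattice v n B \<subseteq> mat_lattice v n A"
  proof
    fix z assume "z \<in> mat_lattice v n B"
    then obtain x where x: "x \<in> int_vecs v n" "z = B *\<^sub>v x" by (auto simp: mat_lattice_def)
    then show "z \<in> mat_lattice v n A"
      using mem_lattice_iff[OF A, of z] mult_mat_vec_carrier[OF B int_vecsD(1)[OF x(1)]]
        assoc_mult_mat_vec[OF ic B int_vecsD(1)[OF x(1)]] ideal_mat_mult_int_vecs[OF i x(1)] by simp
  qed
qed

text \<open>Mutual inclusion makes \<open>inv A * B\<close> and its inverse integral. Lattices with
  a basis thus correspond to cosets of \<open>GL_int\<close>, which is what turns volumes into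
  counts.\<close>

lemma lattice_eq_iff:
  assumes A: "A \<in> carrier (GL TYPE('a) n)" and B: "B \<in> carrier (GL TYPE('a) n)"
  shows "mat_lattice v n A = mat_lattice v n B \<longleftrightarrow> inv\<^bsub>GL TYPE('a) n\<^esub> A * B \<in> GL_int v n"
proof -
  let ?i = "\<lambda>X. inv\<^bsub>GL TYPE('a) n\<^esub> X"
  have G: "?i A * B \<in> carrier (GL TYPE('a) n)" "?i B * A \<in> carrier (GL TYPE('a) n)"
    using GL_mult_closed[OF GL_inv(1)[OF A] B] GL_mult_closed[OF GL_inv(1)[OF B] A] by simp_all
  have i: "?i (?i A * B) = ?i B * A"
    using GL_inv_mult[OF GL_inv(1)[OF A] B] GL_inv_inv[OF A] by simp
  have "mat_lattice v n A = mat_lattice v n B \<longleftrightarrow>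
      ?i A * B \<in> ideal_mat v n n 0 \<and> ?i B * A \<in> ideal_mat v n n 0"
    using lattice_subset_iff[OF A GL_carrier_mat[OF B]] lattice_subset_iff[OF B GL_carrier_mat[OF A]] by blast
  also have "\<dots> \<longleftrightarrow> ?i A * B \<in> GL_int v n"
    using G elements_subset_iff[OF GL_carrier_mat[OF G(1)]] elements_subset_iff[OF GL_carrier_mat[OF G(2)]]
    by (simp add: GL_int_def i)
  finally show ?thesis .
qed

end

section \<open>Existence of lattice bases, and duality\<close>

context unramified_involution
begin

text \<open>
  A triangular basis: among the vectors of \<open>L\<close> whose coordinates after the \<open>j\<close>-th vanish, the \<open>j\<close>-th
  basis vector is one with \<open>j\<close>-th coordinate of minimal valuation.
\<close>

lemma lattice_basis:
  assumes L: "L \<subseteq> int_vecs v n" and add: "\<And>x y. x \<in> L \<Longrightarrow> y \<in> L \<Longrightarrow> x + y \<in> L"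
    and smult: "\<And>r x. r \<in> val_ideal v 0 \<Longrightarrow> x \<in> L \<Longrightarrow> r \<cdot>\<^sub>v x \<in> L"
    and full: "\<And>x. x \<in> int_vecs v n \<Longrightarrow> \<pi> ^ N \<cdot>\<^sub>v x \<in> L"
  obtains y where "y \<in> carrier (GL TYPE('a) n)" "mat_lattice v n y = L"
proof -
  have Lc: "x \<in> carrier_vec n" if "x \<in> L" for x using L that int_vecsD(1) by blast
  define V where "V j = {x \<in> L. x $ j \<noteq> 0 \<and> (\<forall>i<n. j < i \<longrightarrow> x $ i = 0)}" for j
  define w where "w j = (SOME x. x \<in> V j \<and> (\<forall>z. z \<in> V j \<longrightarrow> nat (v (x $ j)) \<le> nat (v (z $ j))))" for j
  have w: "w j \<in> V j \<and> (\<forall>z. z \<in> V j \<longrightarrow> nat (v (w j $ j)) \<le> nat (v (z $ j)))" if j: "j < n" for j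
    unfolding w_def
  proof (rule someI_ex, rule ex_has_least_nat)
    \<comment> \<open>Fullness of \<open>L\<close> provides a candidate for every \<open>j\<close>,
      hence \<open>n\<close> basis vectors.\<close>
    show "\<pi> ^ N \<cdot>\<^sub>v unit_vec n j \<in> V j"
      using full[OF unit_vec_int] j by (simp add: V_def)
  qed
  have wL: "w j \<in> L" and wd: "w j $ j \<noteq> 0" and wz: "\<And>i. i < n \<Longrightarrow> j < i \<Longrightarrow> w j $ i = 0"
    if "j < n" for j
    using w[OF that] by (simp_all add: V_def)
  have divis: "\<exists>a\<in>val_ideal v 0. x $ j = a * w j $ j"
    if j: "j < n" and x: "x \<in> L" "\<And>i. i < n \<Longrightarrow> j < i \<Longrightarrow> x $ i = 0" for x j
  proof (cases "x $ j = 0")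
    case True
    then show ?thesis by (intro bexI[of _ 0]) auto
  next
    case False
    then have "x \<in> V j" using x by (simp add: V_def)
    then have "nat (v (w j $ j)) \<le> nat (v (x $ j))" using w[OF j] by blast
    moreover have "x $ j \<in> val_ideal v 0" using L x j int_vecsD(2) by blast
    ultimately have "v (w j $ j) \<le> v (x $ j)" using False by (simp add: mem_val_ideal nat_le_eq_zle)
    then have "x $ j / w j $ j \<in> val_ideal v 0"
      using False wd[OF j] by (simp add: mem_val_ideal val_divide)
    then show ?thesis using wd[OF j] by (intro bexI[of _ "x $ j / w j $ j"]) auto
  qed
  define y where "y = mat n n (\<lambda>(i, j). w j $ i)"
  have yc: "y \<in> carrier_mat n n" by (simp add: y_def)
  have yi: "y $$ (i, j) = w j $ i" if "i < n" "j < n" for i j using that by (simp add: y_def)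
  have "upper_triangular y" using wz by (auto simp: y_def)
  then have "det y \<noteq> 0"
    using upper_triangular_imp_det_eq_0_iff[OF yc] wd by (auto simp: diag_mat_def y_def)
  then have G: "y \<in> carrier (GL TYPE('a) n)" using yc GL_iff_det by blast
  have ycol: "y *\<^sub>v unit_vec n j = w j" if "j < n" for j
    unfolding mult_unit_vec[OF yc that]
    using that Lc[OF wL[OF that]] by (intro eq_vecI) (auto simp: y_def)
  have "mat_lattice v n y \<subseteq> L"
  proof
    fix z assume "z \<in> mat_lattice v n y"
    then obtain x where x: "x \<in> int_vecs v n" "z = y *\<^sub>v x" by (auto simp: mat_lattice_def)
    define S where "S k = vec n (\<lambda>i. \<Sum>j<k. w j $ i * x $ j)" for k
    have "S k \<in> L" if "k \<le> n" for k
      using that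
    proof (induction k)
      case 0
      have "S 0 = 0 \<cdot>\<^sub>v (\<pi> ^ N \<cdot>\<^sub>v 0\<^sub>v n)" by (auto simp: S_def)
      then show ?case using smult[OF _ full[OF int_vecs_zero], of 0] by simp
    next
      case (Suc k)
      have "S (Suc k) = S k + x $ k \<cdot>\<^sub>v w k"
        using Suc.prems Lc[OF wL[of k]] by (intro eq_vecI) (auto simp: S_def mult.commute)
      moreover have "S k \<in> L" "x $ k \<cdot>\<^sub>v w k \<in> L"
        using Suc smult[OF int_vecsD(2)[OF x(1)] wL] by simp_all
      ultimately show ?case using add by simp
    qed
    moreover have "z = S n"
      using x yc mult_mat_vec_carrier[OF yc int_vecsD(1)[OF x(1)]]
      by (intro eq_vecI) (auto simp: S_def mat_vec_index[OF yc int_vecsD(1)[OF x(1)]] yi simp del: index_mult_mat_vec)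
    ultimately show "z \<in> L" by simp
  qed
  \<comment> \<open>Coordinates are eliminated from the last one down: a multiple of
    \<open>w k\<close> cancels coordinate \<open>k\<close> and leaves the later ones alone, since
    \<open>w k\<close> vanishes there.\<close>
  moreover have "x \<in> mat_lattice v n y" if "k \<le> n" "x \<in> L" "\<And>i. i < n \<Longrightarrow> k \<le> i \<Longrightarrow> x $ i = 0" for k x
    using that
  proof (induction k arbitrary: x)
    case 0
    then have "x = y *\<^sub>v 0\<^sub>v n" using yc Lc by (intro eq_vecI) auto
    then show ?case by (auto simp: mat_lattice_def)
  next
    case (Suc k)
    then have k: "k < n" by simp
    obtain a where a: "a \<in> val_ideal v 0" "x $ k = a * w k $ k"
      using divis[OF k Suc.prems(2)] Suc.prems(3) by auto
    define x' where "x' = x + (- a) \<cdot>\<^sub>v w k"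
    note xc = Lc[OF Suc.prems(2)] and wc = Lc[OF wL[OF k]]
    have "x' \<in> L" unfolding x'_def using a by (intro add Suc.prems smult wL k) auto
    moreover have "x' $ i = 0" if i: "i < n" "k \<le> i" for i
    proof (cases "i = k")
      case True
      then show ?thesis using i xc wc a(2) by (simp add: x'_def)
    next
      case False
      then show ?thesis using i xc wc wz[OF k, of i] Suc.prems(3)[of i] by (simp add: x'_def)
    qed
    ultimately have "x' \<in> mat_lattice v n y" using Suc.IH k by simp
    then obtain c where c: "c \<in> int_vecs v n" "x' = y *\<^sub>v c" by (auto simp: mat_lattice_def)
    have "x = x' + a \<cdot>\<^sub>v w k" using xc wc by (intro eq_vecI) (auto simp: x'_def)
    also have "\<dots> = y *\<^sub>v c + y *\<^sub>v (a \<cdot>\<^sub>v unit_vec n k)"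
      using c(2) ycol[OF k] mult_mat_vec[OF yc, of "unit_vec n k" a] by simp
    also have "\<dots> = y *\<^sub>v (c + a \<cdot>\<^sub>v unit_vec n k)"
      using mult_add_distrib_mat_vec[OF yc, of c "a \<cdot>\<^sub>v unit_vec n k"] int_vecsD(1)[OF c(1)] by simp
    finally have "x = y *\<^sub>v (c + a \<cdot>\<^sub>v unit_vec n k)" .
    moreover have "c + a \<cdot>\<^sub>v unit_vec n k \<in> int_vecs v n"
      using a c by (intro int_vecs_add int_vecs_smult) auto
    ultimately show ?case by (auto simp: mat_lattice_def)
  qed
  from this[of n] have "L \<subseteq> mat_lattice v n y" by auto
  ultimately show thesis using that[OF G] by blast
qed

lemma herm_sum_adj:
  assumes A: "A \<in> carrier_mat n n" and x: "x \<in> carrier_vec n" and y: "y \<in> carrier_vec n"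
  shows "herm_sum star n (A *\<^sub>v x) y = herm_sum star n x (adj star A *\<^sub>v y)"
proof -
  have "herm_sum star n (A *\<^sub>v x) y = (\<Sum>i<n. \<Sum>k<n. star (A $$ (i, k)) * star (x $ k) * y $ i)"
    unfolding herm_sum_def
    by (intro sum.cong refl) (simp add: mat_vec_index[OF A x] star_sum star_mult sum_distrib_right
        del: index_mult_mat_vec)
  also have "\<dots> = (\<Sum>k<n. \<Sum>i<n. star (A $$ (i, k)) * star (x $ k) * y $ i)"
    by (rule sum.swap)
  also have "\<dots> = herm_sum star n x (adj star A *\<^sub>v y)"
    unfolding herm_sum_def
    by (intro sum.cong refl) (simp add: mat_vec_index[OF adj_carrier[OF A] y] adj_index[OF A] sum_distrib_left mult_ac
        del: index_mult_mat_vec)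
  finally show ?thesis .
qed

lemma star_herm_sum: "star (herm_sum star n x y) = herm_sum star n y x"
  by (simp add: herm_sum_def star_sum star_mult star_star mult.commute)

lemma herm_sum_add_left:
  "x \<in> carrier_vec n \<Longrightarrow> x' \<in> carrier_vec n \<Longrightarrow> herm_sum star n (x + x') y = herm_sum star n x y + herm_sum star n x' y"
  by (simp add: herm_sum_def star_add algebra_simps sum.distrib)

lemma herm_sum_add_right:
  "y \<in> carrier_vec n \<Longrightarrow> y' \<in> carrier_vec n \<Longrightarrow> herm_sum star n x (y + y') = herm_sum star n x y + herm_sum star n x y'"
  by (simp add: herm_sum_def algebra_simps sum.distrib)

lemma herm_sum_smult_right:
  "y \<in> carrier_vec n \<Longrightarrow> herm_sum star n x (r \<cdot>\<^sub>v y) = r * herm_sum star n x y"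
  by (simp add: herm_sum_def sum_distrib_left mult_ac)

lemma herm_sum_int: "x \<in> int_vecs v n \<Longrightarrow> y \<in> int_vecs v n \<Longrightarrow> herm_sum star n x y \<in> val_ideal v 0"
  unfolding herm_sum_def by (intro val_ideal_sum val_ideal_mult_left) (auto simp: int_vecs_def)

lemma herm_sum_unit: "i < n \<Longrightarrow> herm_sum star n (unit_vec n i) y = y $ i"
proof -
  assume i: "i < n"
  have "herm_sum star n (unit_vec n i) y = (\<Sum>k<n. if k = i then y $ k else 0)"
    unfolding herm_sum_def using i by (intro sum.cong) auto
  then show ?thesis using i by simp
qed

text \<open>\<oo>^n is its own dual under the standard sesquilinear form, as unit vectors show. This
  converts statements about pairings modulo \<oo> into membership in lattices.\<close>

lemma int_vecs_dual:
  assumes z: "z \<in> carrier_vec n"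
  shows "z \<in> int_vecs v n \<longleftrightarrow> (\<forall>x\<in>int_vecs v n. herm_sum star n x z \<in> val_ideal v 0)"
proof
  assume h: "\<forall>x\<in>int_vecs v n. herm_sum star n x z \<in> val_ideal v 0"
  have "z $ i \<in> val_ideal v 0" if "i < n" for i
    using bspec[OF h unit_vec_int, of i] herm_sum_unit[OF that] by simp
  then show "z \<in> int_vecs v n" using z by (simp add: int_vecs_def)
qed (use herm_sum_int in blast)

end

section \<open>Presentations of finite modules\<close>

lemma a_rcosets_image: "a_rcosets\<^bsub>M\<^esub> N = (\<lambda>x. N +>\<^bsub>M\<^esub> x) ` carrier M"
  by (auto simp: A_RCOSETS_def')

lemma quot_module_simps [simp]:
  "carrier (quot_module M N) = (\<lambda>x. N +>\<^bsub>M\<^esub> x) ` carrier M"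
  "zero (quot_module M N) = N"
  "add (quot_module M N) = set_add M"
  by (simp_all add: quot_module_def a_rcosets_image)

lemma quot_module_smult: "r \<odot>\<^bsub>quot_module M N\<^esub> X = (\<Union>x\<in>X. N +>\<^bsub>M\<^esub> (r \<odot>\<^bsub>M\<^esub> x))"
  by (simp add: quot_module_def)

text \<open>The quotient records leave their ring operations unspecified and only their module
  operations matter. The axioms are carried over from \<open>M\<close> along a surjection that
  respects the latter.\<close>

lemma module_of_surjection:
  assumes "Module.module R M" and surj: "h ` carrier M = carrier Q"
    and add: "\<And>x y. x \<in> carrier M \<Longrightarrow> y \<in> carrier M \<Longrightarrow> h (x \<oplus>\<^bsub>M\<^esub> y) = h x \<oplus>\<^bsub>Q\<^esub> h y"
    and smult: "\<And>r x. r \<in> carrier R \<Longrightarrow> x \<in> carrier M \<Longrightarrow> h (r \<odot>\<^bsub>M\<^esub> x) = r \<odot>\<^bsub>Q\<^esub> h x"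
    and zero: "h \<zero>\<^bsub>M\<^esub> = \<zero>\<^bsub>Q\<^esub>"
  shows "Module.module R Q"
proof -
  interpret M: Module.module R M by fact
  have ex: "\<exists>x\<in>carrier M. X = h x" if "X \<in> carrier Q" for X
    using that surj by blast
  have cl: "h x \<in> carrier Q" if "x \<in> carrier M" for x using that surj by blast
  show ?thesis
  proof (rule moduleI)
    show "cring R" by (rule M.R.is_cring)
    show "abelian_group Q"
    proof (rule abelian_groupI)
      fix X Y assume "X \<in> carrier Q" "Y \<in> carrier Q"
      then obtain x y where xy: "x \<in> carrier M" "y \<in> carrier M" "X = h x" "Y = h y" using ex by metis
      show "X \<oplus>\<^bsub>Q\<^esub> Y \<in> carrier Q" using xy cl by (simp flip: add)
      show "X \<oplus>\<^bsub>Q\<^esub> Y = Y \<oplus>\<^bsub>Q\<^esub> X" using xy by (simp add: M.a_comm flip: add)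
    next
      fix X Y Z assume "X \<in> carrier Q" "Y \<in> carrier Q" "Z \<in> carrier Q"
      then obtain x y z where "x \<in> carrier M" "y \<in> carrier M" "z \<in> carrier M" "X = h x" "Y = h y" "Z = h z"
        using ex by metis
      then show "(X \<oplus>\<^bsub>Q\<^esub> Y) \<oplus>\<^bsub>Q\<^esub> Z = X \<oplus>\<^bsub>Q\<^esub> (Y \<oplus>\<^bsub>Q\<^esub> Z)"
        by (simp add: M.a_assoc flip: add)
    next
      show "\<zero>\<^bsub>Q\<^esub> \<in> carrier Q" unfolding zero[symmetric] by (intro cl) simp
    next
      fix X assume "X \<in> carrier Q"
      then obtain x where x: "x \<in> carrier M" "X = h x" using ex by metis
      have "h \<zero>\<^bsub>M\<^esub> \<oplus>\<^bsub>Q\<^esub> h x = h x" using x by (simp flip: add)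
      then show "\<zero>\<^bsub>Q\<^esub> \<oplus>\<^bsub>Q\<^esub> X = X" using x zero by simp
      have "h (\<ominus>\<^bsub>M\<^esub> x) \<oplus>\<^bsub>Q\<^esub> h x = h \<zero>\<^bsub>M\<^esub>" using x by (simp add: M.l_neg flip: add)
      then show "\<exists>Y\<in>carrier Q. Y \<oplus>\<^bsub>Q\<^esub> X = \<zero>\<^bsub>Q\<^esub>"
        using x zero cl by (intro bexI[of _ "h (\<ominus>\<^bsub>M\<^esub> x)"]) auto
    qed
  next
    fix a X assume a: "a \<in> carrier R" and "X \<in> carrier Q"
    then obtain x where x: "x \<in> carrier M" "X = h x" using ex by metis
    show "a \<odot>\<^bsub>Q\<^esub> X \<in> carrier Q" using x a cl by (simp flip: smult)
  next
    fix a b X assume ab: "a \<in> carrier R" "b \<in> carrier R" and "X \<in> carrier Q"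
    then obtain x where x: "x \<in> carrier M" "X = h x" using ex by metis
    have "h ((a \<oplus>\<^bsub>R\<^esub> b) \<odot>\<^bsub>M\<^esub> x) = h (a \<odot>\<^bsub>M\<^esub> x \<oplus>\<^bsub>M\<^esub> b \<odot>\<^bsub>M\<^esub> x)"
      using ab x by (simp add: M.smult_l_distr)
    then show "(a \<oplus>\<^bsub>R\<^esub> b) \<odot>\<^bsub>Q\<^esub> X = a \<odot>\<^bsub>Q\<^esub> X \<oplus>\<^bsub>Q\<^esub> b \<odot>\<^bsub>Q\<^esub> X"
      using ab x by (simp add: add smult)
    have "h ((a \<otimes>\<^bsub>R\<^esub> b) \<odot>\<^bsub>M\<^esub> x) = h (a \<odot>\<^bsub>M\<^esub> (b \<odot>\<^bsub>M\<^esub> x))"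
      using ab x by (simp add: M.smult_assoc1)
    then show "(a \<otimes>\<^bsub>R\<^esub> b) \<odot>\<^bsub>Q\<^esub> X = a \<odot>\<^bsub>Q\<^esub> (b \<odot>\<^bsub>Q\<^esub> X)"
      using ab x by (simp add: smult)
  next
    fix a X Y assume a: "a \<in> carrier R" and "X \<in> carrier Q" "Y \<in> carrier Q"
    then obtain x y where xy: "x \<in> carrier M" "y \<in> carrier M" "X = h x" "Y = h y" using ex by metis
    have "h (a \<odot>\<^bsub>M\<^esub> (x \<oplus>\<^bsub>M\<^esub> y)) = h (a \<odot>\<^bsub>M\<^esub> x \<oplus>\<^bsub>M\<^esub> a \<odot>\<^bsub>M\<^esub> y)"
      using a xy by (simp add: M.smult_r_distr)
    then show "a \<odot>\<^bsub>Q\<^esub> (X \<oplus>\<^bsub>Q\<^esub> Y) = a \<odot>\<^bsub>Q\<^esub> X \<oplus>\<^bsub>Q\<^esub> a \<odot>\<^bsub>Q\<^esub> Y"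
      using a xy by (simp add: add smult)
  next
    fix X assume "X \<in> carrier Q"
    then obtain x where x: "x \<in> carrier M" "X = h x" using ex by metis
    have "h (\<one>\<^bsub>R\<^esub> \<odot>\<^bsub>M\<^esub> x) = h x" using x by simp
    then show "\<one>\<^bsub>R\<^esub> \<odot>\<^bsub>Q\<^esub> X = X" using x smult[of "\<one>\<^bsub>R\<^esub>" x] by simp
  qed
qed

text \<open>Well-definedness of scalars on cosets: two representatives differ by an element of
  \<open>N\<close>, which \<open>r\<close> keeps in \<open>N\<close>, so the union in the definition
  of \<open>quot_module\<close> runs over equal cosets.\<close>

lemma submodule_quotient:
  assumes "Module.module R M" "submodule N R M"
  shows "abelian_subgroup N M"
    and "r \<in> carrier R \<Longrightarrow> x \<in> carrier M \<Longrightarrow>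
      r \<odot>\<^bsub>quot_module M N\<^esub> (N +>\<^bsub>M\<^esub> x) = N +>\<^bsub>M\<^esub> (r \<odot>\<^bsub>M\<^esub> x)"
    and "x \<in> carrier M \<Longrightarrow> y \<in> carrier M \<Longrightarrow> N +>\<^bsub>M\<^esub> x = N +>\<^bsub>M\<^esub> y \<longleftrightarrow> x \<ominus>\<^bsub>M\<^esub> y \<in> N"
proof -
  interpret M: Module.module R M by fact
  show sub: "abelian_subgroup N M"
    by (intro abelian_subgroupI3 additive_subgroupI submodule.axioms(1)[OF assms(2)])
       (rule M.abelian_group_axioms)
  interpret N: abelian_subgroup N M by fact
  show eq: "N +>\<^bsub>M\<^esub> x = N +>\<^bsub>M\<^esub> y \<longleftrightarrow> x \<ominus>\<^bsub>M\<^esub> y \<in> N" if "x \<in> carrier M" "y \<in> carrier M" for x y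
  proof -
    have "N +>\<^bsub>M\<^esub> x = N +>\<^bsub>M\<^esub> y \<longleftrightarrow> x \<in> N +>\<^bsub>M\<^esub> y"
      using N.a_rcos_self[OF that(1)] N.a_repr_independence'[of x y] that by metis
    then show ?thesis using N.a_rcos_module[OF that(2,1)] by (simp add: a_minus_def)
  qed
  show "r \<odot>\<^bsub>quot_module M N\<^esub> (N +>\<^bsub>M\<^esub> x) = N +>\<^bsub>M\<^esub> (r \<odot>\<^bsub>M\<^esub> x)"
    if r: "r \<in> carrier R" and x: "x \<in> carrier M" for r x
  proof -
    have "N +>\<^bsub>M\<^esub> (r \<odot>\<^bsub>M\<^esub> y) = N +>\<^bsub>M\<^esub> (r \<odot>\<^bsub>M\<^esub> x)" if yN: "y \<in> N +>\<^bsub>M\<^esub> x" for y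
    proof -
      obtain z where z: "z \<in> N" "y = z \<oplus>\<^bsub>M\<^esub> x" using yN by (auto simp: a_r_coset_def')
      have zc: "z \<in> carrier M" using z(1) by (rule N.a_Hcarr)
      have "r \<odot>\<^bsub>M\<^esub> y \<ominus>\<^bsub>M\<^esub> r \<odot>\<^bsub>M\<^esub> x = r \<odot>\<^bsub>M\<^esub> z"
        using z zc x r by (simp add: M.smult_r_distr a_minus_def M.a_assoc M.r_neg)
      moreover have "r \<odot>\<^bsub>M\<^esub> z \<in> N" by (rule submodule.smult_closed[OF assms(2) r z(1)])
      ultimately show ?thesis using eq[of "r \<odot>\<^bsub>M\<^esub> y" "r \<odot>\<^bsub>M\<^esub> x"] r x zc z by simp
    qed
    moreover have "x \<in> N +>\<^bsub>M\<^esub> x" by (rule N.a_rcos_self[OF x])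
    ultimately show ?thesis unfolding quot_module_smult by blast
  qed
qed

lemma quot_module_add:
  assumes "Module.module R M" "submodule N R M" "x \<in> carrier M" "y \<in> carrier M"
  shows "(N +>\<^bsub>M\<^esub> x) \<oplus>\<^bsub>quot_module M N\<^esub> (N +>\<^bsub>M\<^esub> y) = N +>\<^bsub>M\<^esub> (x \<oplus>\<^bsub>M\<^esub> y)"
  using abelian_subgroup.a_rcos_sum[OF submodule_quotient(1)[OF assms(1,2)] assms(3,4)] by simp

lemma module_quot_module:
  assumes M: "Module.module R M" and N: "submodule N R M"
  shows "Module.module R (quot_module M N)"
proof (rule module_of_surjection[OF M, where h = "\<lambda>x. N +>\<^bsub>M\<^esub> x"])
  interpret M: Module.module R M by fact
  interpret N: abelian_subgroup N M by (rule submodule_quotient(1)[OF M N])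
  show "N +>\<^bsub>M\<^esub> \<zero>\<^bsub>M\<^esub> = \<zero>\<^bsub>quot_module M N\<^esub>"
    by (simp add: M.a_coset_add_zero[OF N.a_subset])
qed (simp_all add: quot_module_add[OF M N, simplified] submodule_quotient(2)[OF M N])

context nonarch_local_field
begin

text \<open>An identification of \<open>M\<close> with \<oo>^n / L that leaves the carrier of
  \<open>M\<close> abstract. The kernel is encoded by equality of values, so the notion makes sense
  before \<open>M\<close> is known to be a module.\<close>

definition presents :: "nat \<Rightarrow> ('a vec \<Rightarrow> 'm) \<Rightarrow> ('a, 'm) module \<Rightarrow> 'a vec set \<Rightarrow> bool" where
  "presents n \<phi> M L \<longleftrightarrow> \<phi> ` int_vecs v n = carrier M \<and>
    (\<forall>x\<in>int_vecs v n. \<forall>y\<in>int_vecs v n. \<phi> (x + y) = \<phi> x \<oplus>\<^bsub>M\<^esub> \<phi> y) \<and>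
    (\<forall>r\<in>val_ideal v 0. \<forall>x\<in>int_vecs v n. \<phi> (r \<cdot>\<^sub>v x) = r \<odot>\<^bsub>M\<^esub> \<phi> x) \<and>
    (\<forall>x\<in>int_vecs v n. \<forall>y\<in>int_vecs v n. \<phi> x = \<phi> y \<longleftrightarrow> x - y \<in> L)"

lemma presentsD:
  assumes "presents n \<phi> M L"
  shows "\<phi> ` int_vecs v n = carrier M"
    "x \<in> int_vecs v n \<Longrightarrow> \<phi> x \<in> carrier M"
    "x \<in> int_vecs v n \<Longrightarrow> y \<in> int_vecs v n \<Longrightarrow> \<phi> (x + y) = \<phi> x \<oplus>\<^bsub>M\<^esub> \<phi> y"
    "r \<in> val_ideal v 0 \<Longrightarrow> x \<in> int_vecs v n \<Longrightarrow> \<phi> (r \<cdot>\<^sub>v x) = r \<odot>\<^bsub>M\<^esub> \<phi> x"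
    "x \<in> int_vecs v n \<Longrightarrow> y \<in> int_vecs v n \<Longrightarrow> \<phi> x = \<phi> y \<longleftrightarrow> x - y \<in> L"
  using assms unfolding presents_def by blast+

lemma carrier_val_ring [simp]: "carrier (val_ring v) = val_ideal v 0"
  by (simp add: val_ring_def)

text \<open>Both modules are quotients of \<oo>^n by the same kernel, so lifting to \<oo>^n and
  projecting again does not depend on the lift.\<close>

lemma presents_transfer:
  assumes \<phi>: "presents n \<phi> M L" and \<psi>: "presents n \<psi> M' L"
  obtains f where "f \<in> mod_iso (val_ring v) M M'" "\<And>x. x \<in> int_vecs v n \<Longrightarrow> f (\<phi> x) = \<psi> x"
proof -
  define f where "f m = \<psi> (inv_into (int_vecs v n) \<phi> m)" for m
  have f: "f (\<phi> x) = \<psi> x" if x: "x \<in> int_vecs v n" for x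
  proof -
    define z where "z = inv_into (int_vecs v n) \<phi> (\<phi> x)"
    have z: "z \<in> int_vecs v n" "\<phi> z = \<phi> x"
      unfolding z_def using x by (auto intro: inv_into_into f_inv_into_f)
    then have "z - x \<in> L" using presentsD(5)[OF \<phi>] x by blast
    then show ?thesis using presentsD(5)[OF \<psi> z(1) x] by (simp add: f_def z_def)
  qed
  have ex: "\<exists>x\<in>int_vecs v n. m = \<phi> x" if "m \<in> carrier M" for m
    using that presentsD(1)[OF \<phi>] by blast
  have "bij_betw f (carrier M) (carrier M')"
  proof (rule bij_betw_imageI)
    show "inj_on f (carrier M)"
    proof (rule inj_onI)
      fix a b assume "a \<in> carrier M" "b \<in> carrier M" and eq: "f a = f b"
      then obtain x y where xy: "x \<in> int_vecs v n" "y \<in> int_vecs v n" "a = \<phi> x" "b = \<phi> y" using ex by metis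
      then show "a = b" using eq f presentsD(5)[OF \<phi> xy(1,2)] presentsD(5)[OF \<psi> xy(1,2)] by simp
    qed
    have "f ` carrier M = \<psi> ` int_vecs v n"
      unfolding presentsD(1)[OF \<phi>, symmetric] image_image using f by (intro image_cong) auto
    then show "f ` carrier M = carrier M'" using presentsD(1)[OF \<psi>] by simp
  qed
  moreover have "f \<in> mod_hom (val_ring v) M M'"
    unfolding mod_hom_def
  proof (intro CollectI conjI ballI funcsetI)
    fix a assume "a \<in> carrier M"
    then obtain x where x: "x \<in> int_vecs v n" "a = \<phi> x" using ex by metis
    then show "f a \<in> carrier M'" using f presentsD(2)[OF \<psi>] by simp
    fix r assume "r \<in> carrier (val_ring v)"
    then have r: "r \<in> val_ideal v 0" by simp
    show "f (r \<odot>\<^bsub>M\<^esub> a) = r \<odot>\<^bsub>M'\<^esub> f a"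
      using x r f int_vecs_smult[OF r x(1)] presentsD(4)[OF \<phi> r x(1)] presentsD(4)[OF \<psi> r x(1)] by metis
  next
    fix a b assume "a \<in> carrier M" "b \<in> carrier M"
    then obtain x y where xy: "x \<in> int_vecs v n" "y \<in> int_vecs v n" "a = \<phi> x" "b = \<phi> y" using ex by metis
    then show "f (a \<oplus>\<^bsub>M\<^esub> b) = f a \<oplus>\<^bsub>M'\<^esub> f b"
      using f int_vecs_add[OF xy(1,2)] presentsD(3)[OF \<phi> xy(1,2)] presentsD(3)[OF \<psi> xy(1,2)] by metis
  qed
  ultimately have "f \<in> mod_iso (val_ring v) M M'" by (simp add: mod_iso_def)
  then show thesis using that f by blast
qed

lemma presents_iso:
  assumes f: "f \<in> mod_iso (val_ring v) M M'" and \<psi>: "presents n \<psi> M' L"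
    and M: "Module.module (val_ring v) M"
  shows "presents n (\<lambda>x. inv_into (carrier M) f (\<psi> x)) M L"
    and "x \<in> int_vecs v n \<Longrightarrow> f (inv_into (carrier M) f (\<psi> x)) = \<psi> x"
proof -
  interpret M: Module.module "val_ring v" M by fact
  have bij: "bij_betw f (carrier M) (carrier M')" and hom: "f \<in> mod_hom (val_ring v) M M'"
    using f by (auto simp: mod_iso_def)
  let ?g = "inv_into (carrier M) f"
  have gc: "?g m \<in> carrier M" "f (?g m) = m" if "m \<in> carrier M'" for m
    using that bij bij_betw_inv_into_right[OF bij] inv_into_into[of m f "carrier M"]
    by (auto simp: bij_betw_def)
  have gf: "?g (f a) = a" if "a \<in> carrier M" for a
    using bij_betw_inv_into_left[OF bij that] .
  have bg: "?g ` carrier M' = carrier M"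
    using bij_betw_inv_into[OF bij] by (simp add: bij_betw_def)
  have \<psi>c: "\<psi> x \<in> carrier M'" if "x \<in> int_vecs v n" for x using presentsD(2)[OF \<psi> that] .
  show "f (?g (\<psi> x)) = \<psi> x" if "x \<in> int_vecs v n" for x using gc(2)[OF \<psi>c[OF that]] .
  show "presents n (\<lambda>x. ?g (\<psi> x)) M L"
    unfolding presents_def
  proof (intro conjI ballI)
    show "(\<lambda>x. ?g (\<psi> x)) ` int_vecs v n = carrier M"
      using bg presentsD(1)[OF \<psi>] by (metis image_image)
  next
    fix x y assume xy: "x \<in> int_vecs v n" "y \<in> int_vecs v n"
    have "f (?g (\<psi> x) \<oplus>\<^bsub>M\<^esub> ?g (\<psi> y)) = \<psi> (x + y)"
      using hom gc[OF \<psi>c[OF xy(1)]] gc[OF \<psi>c[OF xy(2)]] presentsD(3)[OF \<psi> xy] by (simp add: mod_hom_def)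
    then show "?g (\<psi> (x + y)) = ?g (\<psi> x) \<oplus>\<^bsub>M\<^esub> ?g (\<psi> y)"
      using gf[of "?g (\<psi> x) \<oplus>\<^bsub>M\<^esub> ?g (\<psi> y)"] gc[OF \<psi>c[OF xy(1)]] gc[OF \<psi>c[OF xy(2)]] by simp
    show "?g (\<psi> x) = ?g (\<psi> y) \<longleftrightarrow> x - y \<in> L"
      using gc(2)[OF \<psi>c[OF xy(1)]] gc(2)[OF \<psi>c[OF xy(2)]] presentsD(5)[OF \<psi> xy] by metis
  next
    fix r x assume r: "r \<in> val_ideal v 0" and x: "x \<in> int_vecs v n"
    have "f (r \<odot>\<^bsub>M\<^esub> ?g (\<psi> x)) = \<psi> (r \<cdot>\<^sub>v x)"
      using hom gc[OF \<psi>c[OF x]] presentsD(4)[OF \<psi> r x] r by (simp add: mod_hom_def)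
    then show "?g (\<psi> (r \<cdot>\<^sub>v x)) = r \<odot>\<^bsub>M\<^esub> ?g (\<psi> x)"
      using gf[of "r \<odot>\<^bsub>M\<^esub> ?g (\<psi> x)"] gc[OF \<psi>c[OF x]] r by simp
  qed
qed

lemma presents_quotient:
  assumes \<phi>: "presents n \<phi> M K" and M: "Module.module (val_ring v) M" and N: "submodule N (val_ring v) M"
  shows "presents n (\<lambda>x. N +>\<^bsub>M\<^esub> \<phi> x) (quot_module M N) {x \<in> int_vecs v n. \<phi> x \<in> N}"
proof -
  interpret M: Module.module "val_ring v" M by fact
  note c = presentsD(2)[OF \<phi>]
  have diff: "\<phi> (x - y) = \<phi> x \<ominus>\<^bsub>M\<^esub> \<phi> y \<and> x - y \<in> int_vecs v n" if xy: "x \<in> int_vecs v n" "y \<in> int_vecs v n" for x y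
  proof -
    have i: "x - y \<in> int_vecs v n" using xy by (auto simp: int_vecs_def intro!: val_ideal_diff)
    have "x - y + y = x" using xy by (intro eq_vecI) (auto simp: int_vecs_def)
    then have "\<phi> x = \<phi> (x - y) \<oplus>\<^bsub>M\<^esub> \<phi> y" using presentsD(3)[OF \<phi> i xy(2)] by simp
    then show ?thesis using c[OF i] c[OF xy(2)] i by (simp add: a_minus_def M.a_assoc M.r_neg)
  qed
  show ?thesis
    unfolding presents_def
  proof (intro conjI ballI)
    show "(\<lambda>x. N +>\<^bsub>M\<^esub> \<phi> x) ` int_vecs v n = carrier (quot_module M N)"
      using presentsD(1)[OF \<phi>] by (metis image_image quot_module_simps(1))
  next
    fix x y assume xy: "x \<in> int_vecs v n" "y \<in> int_vecs v n"
    show "N +>\<^bsub>M\<^esub> \<phi> (x + y) = (N +>\<^bsub>M\<^esub> \<phi> x) \<oplus>\<^bsub>quot_module M N\<^esub> (N +>\<^bsub>M\<^esub> \<phi> y)"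
      using quot_module_add[OF M N c[OF xy(1)] c[OF xy(2)]] presentsD(3)[OF \<phi> xy] by simp
    show "N +>\<^bsub>M\<^esub> \<phi> x = N +>\<^bsub>M\<^esub> \<phi> y \<longleftrightarrow> x - y \<in> {x \<in> int_vecs v n. \<phi> x \<in> N}"
      using submodule_quotient(3)[OF M N c[OF xy(1)] c[OF xy(2)]] diff[OF xy] by simp
  next
    fix r x assume r: "r \<in> val_ideal v 0" and x: "x \<in> int_vecs v n"
    show "N +>\<^bsub>M\<^esub> \<phi> (r \<cdot>\<^sub>v x) = r \<odot>\<^bsub>quot_module M N\<^esub> (N +>\<^bsub>M\<^esub> \<phi> x)"
      using submodule_quotient(2)[OF M N, of r "\<phi> x"] presentsD(4)[OF \<phi> r x] c[OF x] r by simp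
  qed
qed

lemma val_coset_as_rcoset:
  "val_ideal v k +>\<^bsub>int_module v\<^esub> x = val_coset k x"
  "val_ideal v k +>\<^bsub>field_module\<^esub> x = val_coset k x"
  unfolding a_r_coset_def' val_coset_def int_module_def field_module_def
  by (auto simp: algebra_simps intro!: bexI[of _ "_ - x"])

lemma val_coset_set_add:
  "set_add (int_module v) (val_coset k x) (val_coset k y) = val_coset k (x + y)"
  "set_add (field_module) (val_coset k x) (val_coset k y) = val_coset k (x + y)"
proof -
  have "(\<Union>a\<in>val_coset k x. \<Union>b\<in>val_coset k y. {a + b}) = val_coset k (x + y)"
  proof (intro equalityI subsetI)
    fix z assume "z \<in> (\<Union>a\<in>val_coset k x. \<Union>b\<in>val_coset k y. {a + b})"
    then obtain a b where "a - x \<in> val_ideal v k" "b - y \<in> val_ideal v k" "z = a + b"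
      by (auto simp: val_coset_def)
    then show "z \<in> val_coset k (x + y)"
      using val_ideal_add[of "a - x" k "b - y"] by (simp add: val_coset_def algebra_simps)
  next
    fix z assume "z \<in> val_coset k (x + y)"
    then have "z - y \<in> val_coset k x" by (simp add: val_coset_def algebra_simps)
    then show "z \<in> (\<Union>a\<in>val_coset k x. \<Union>b\<in>val_coset k y. {a + b})"
      by (intro UN_I[of "z - y"] UN_I[of y]) auto
  qed
  then show "set_add (int_module v) (val_coset k x) (val_coset k y) = val_coset k (x + y)"
    "set_add (field_module) (val_coset k x) (val_coset k y) = val_coset k (x + y)"
    by (simp_all add: set_add_def' int_module_def field_module_def)
qed

lemma val_coset_smult:
  assumes r: "r \<in> val_ideal v 0"
  shows "(\<Union>a\<in>val_coset k x. val_coset k (r * a)) = val_coset k (r * x)"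
proof -
  have "val_coset k (r * a) = val_coset k (r * x)" if "a \<in> val_coset k x" for a
    unfolding val_coset_eq_iff right_diff_distrib[symmetric]
    using that by (intro val_ideal_mult_left r) (simp add: val_coset_def)
  then show ?thesis using val_coset_self[of x k] by blast
qed

lemma F_mod_o_simps:
  "carrier (F_mod_o v) = range (val_coset 0)"
  "zero (F_mod_o v) = val_coset 0 0"
  "val_coset 0 x \<oplus>\<^bsub>F_mod_o v\<^esub> val_coset 0 y = val_coset 0 (x + y)"
  "r \<in> val_ideal v 0 \<Longrightarrow> r \<odot>\<^bsub>F_mod_o v\<^esub> val_coset 0 x = val_coset 0 (r * x)"
  unfolding F_mod_o_def quot_module_simps quot_module_smult val_coset_set_add val_coset_as_rcoset
  using val_coset_smult[of r 0 x] by (auto simp: field_module_def val_coset_def)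

end

text \<open>Coordinatewise reduction onto the standard module. Values are restricted to indices
  below \<open>n\<close> because the carrier of \<open>direct_sum\<close> is an extensional
  product.\<close>

definition type_proj :: "('a::field_char_0 \<Rightarrow> int) \<Rightarrow> nat \<Rightarrow> (nat \<Rightarrow> nat) \<Rightarrow> 'a vec \<Rightarrow> nat \<Rightarrow> 'a set" where
  "type_proj v n mu x = (\<lambda>i\<in>{..<n}. {y. y - x $ i \<in> val_ideal v (int (mu i))})"

section \<open>Standard modules and uniqueness of the type\<close>

context unramified_involution
begin

lemma type_proj_coset: "type_proj v n mu x = (\<lambda>i\<in>{..<n}. val_coset (int (mu i)) (x $ i))"
  by (simp add: type_proj_def val_coset_def)

lemma mat_diag_mult_vec:
  assumes "x \<in> carrier_vec n" "i < n"
  shows "(mat_diag n f *\<^sub>v x) $ i = f i * (x $ i :: 'a)"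
proof -
  have "(mat_diag n f *\<^sub>v x) $ i = (\<Sum>k<n. if k = i then f i * x $ i else 0)"
    unfolding mat_vec_index[OF mat_diag_dim assms] using assms by (intro sum.cong) (auto simp: mat_diag_def)
  then show ?thesis using assms by simp
qed

lemma mem_lattice_pi_mat:
  assumes x: "x \<in> carrier_vec n"
  shows "x \<in> mat_lattice v n (pi_mat \<pi> n mu) \<longleftrightarrow> (\<forall>i<n. x $ i \<in> val_ideal v (int (mu i)))"
proof -
  have "inverse (\<pi> ^ mu i) * x $ i \<in> val_ideal v 0 \<longleftrightarrow> x $ i \<in> val_ideal v (int (mu i))" for i
    by (cases "x $ i = 0") (auto simp: mem_val_ideal val_mult val_inverse val_power)
  then show ?thesis
    unfolding mem_lattice_iff[OF pi_mat_GL(1) x] pi_mat_GL(2)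
    using mult_mat_vec_carrier[OF mat_diag_dim x] mat_diag_mult_vec[OF x] by (simp add: int_vecs_def del: index_mult_mat_vec)
qed

lemma presents_type_module:
  "presents n (type_proj v n mu) (type_module v n mu) (mat_lattice v n (pi_mat \<pi> n mu))"
  unfolding presents_def
proof (intro conjI ballI)
  have car: "carrier (type_module v n mu) = (\<Pi>\<^sub>E i\<in>{..<n}. val_coset (int (mu i)) ` val_ideal v 0)"
    by (simp add: type_module_def direct_sum_def val_coset_as_rcoset)
       (simp add: int_module_def)
  show "type_proj v n mu ` int_vecs v n = carrier (type_module v n mu)"
    unfolding car
  proof (intro equalityI image_subsetI subsetI)
    fix x assume "x \<in> int_vecs v n"
    then show "type_proj v n mu x \<in> (\<Pi>\<^sub>E i\<in>{..<n}. val_coset (int (mu i)) ` val_ideal v 0)"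
      by (auto simp: type_proj_coset int_vecs_def)
  next
    fix X assume X: "X \<in> (\<Pi>\<^sub>E i\<in>{..<n}. val_coset (int (mu i)) ` val_ideal v 0)"
    then have "\<forall>i\<in>{..<n}. \<exists>a\<in>val_ideal v 0. X i = val_coset (int (mu i)) a" by auto
    then obtain a where a: "\<And>i. i < n \<Longrightarrow> a i \<in> val_ideal v 0 \<and> X i = val_coset (int (mu i)) (a i)"
      by (metis lessThan_iff)
    have "X = type_proj v n mu (vec n a)"
      using a X by (intro PiE_ext[of X "{..<n}" _ _]) (auto simp: type_proj_coset)
    moreover have "vec n a \<in> int_vecs v n" using a by (simp add: int_vecs_def)
    ultimately show "X \<in> type_proj v n mu ` int_vecs v n" by blast
  qed
next
  fix x y assume xy: "x \<in> int_vecs v n" "y \<in> int_vecs v n"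
  then have c: "x \<in> carrier_vec n" "y \<in> carrier_vec n" by (auto dest: int_vecsD)
  show "type_proj v n mu (x + y) = type_proj v n mu x \<oplus>\<^bsub>type_module v n mu\<^esub> type_proj v n mu y"
    using c by (auto simp: type_proj_coset type_module_def direct_sum_def val_coset_set_add intro!: restrict_ext)
  have "type_proj v n mu x = type_proj v n mu y \<longleftrightarrow> (\<forall>i<n. (x - y) $ i \<in> val_ideal v (int (mu i)))"
    using c by (auto simp: type_proj_coset fun_eq_iff restrict_def val_coset_eq_iff[symmetric])
  then show "type_proj v n mu x = type_proj v n mu y \<longleftrightarrow> x - y \<in> mat_lattice v n (pi_mat \<pi> n mu)"
    using mem_lattice_pi_mat[of "x - y" n mu] c by simp
next
  fix r x assume r: "r \<in> val_ideal v 0" and x: "x \<in> int_vecs v n"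
  have "r \<odot>\<^bsub>quot_module (int_module v) (val_ideal v k)\<^esub> val_coset k a = val_coset k (r * a)" for k a
    unfolding quot_module_smult val_coset_as_rcoset using val_coset_smult[OF r] by (simp add: int_module_def)
  then show "type_proj v n mu (r \<cdot>\<^sub>v x) = r \<odot>\<^bsub>type_module v n mu\<^esub> type_proj v n mu x"
    using int_vecsD(1)[OF x] by (auto simp: type_proj_coset type_module_def direct_sum_def intro!: restrict_ext)
qed

text \<open>Ensures that a power of this number determines its exponent.\<close>

lemma card_residues_ge_2: "2 \<le> card (residue ` val_ideal v 0)"
proof -
  have "residue 0 \<noteq> residue 1" by (simp add: val_coset_eq_iff mem_val_ideal)
  then have "card {residue 0, residue 1} = 2" by simp
  then show ?thesis using card_mono[OF finite_residues, of "{residue 0, residue 1}"] by simp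
qed

text \<open>A class of the \<open>a\<close>-th power of the maximal ideal modulo the
  \<open>m\<close>-th is a class of the next power, translated by \<open>\<pi> ^ a\<close> times the
  representative of a residue; the class determines both ingredients. The bijection is
  \<open>F\<close>.\<close>

lemma card_coset_filtration_step:
  fixes a m :: nat
  assumes "a < m"
  shows "card (val_coset (int m) ` val_ideal v (int a)) =
    card (residue ` val_ideal v 0) * card (val_coset (int m) ` val_ideal v (int (Suc a)))"
proof -
  let ?C = "\<lambda>a. val_coset (int m) ` val_ideal v (int a)" and ?R = "residue ` val_ideal v 0"
  define rep where "rep X = (SOME c. c \<in> val_ideal v 0 \<and> residue c = X)" for X
  have rep: "rep X \<in> val_ideal v 0 \<and> residue (rep X) = X" if "X \<in> ?R" for X
    unfolding rep_def by (rule someI_ex) (use that in auto)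
  define F where "F = (\<lambda>(X, Z). (\<lambda>z. z + \<pi> ^ a * rep X) ` Z)"
  have F: "F (X, val_coset (int m) z) = val_coset (int m) (z + \<pi> ^ a * rep X)" for X z
  proof -
    have "(\<lambda>z. z + c) ` val_coset k z = val_coset k (z + c)" for k c
      by (auto simp: val_coset_def algebra_simps intro!: image_eqI[of _ _ "_ - c"])
    then show ?thesis by (simp add: F_def)
  qed
  have cancel: "\<pi> ^ a * x \<in> val_ideal v (int (Suc a)) \<longleftrightarrow> x \<in> val_ideal v 1" for x
    by (cases "x = 0") (auto simp: mem_val_ideal val_mult val_power)
  have "inj_on F (?R \<times> ?C (Suc a))"
  proof (rule inj_onI)
    fix P Q assume "P \<in> ?R \<times> ?C (Suc a)" "Q \<in> ?R \<times> ?C (Suc a)" and eq: "F P = F Q"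
    then obtain X Y z w where P: "P = (X, val_coset (int m) z)" "X \<in> ?R" "z \<in> val_ideal v (int (Suc a))"
      and Q: "Q = (Y, val_coset (int m) w)" "Y \<in> ?R" "w \<in> val_ideal v (int (Suc a))" by blast
    have d: "(z + \<pi> ^ a * rep X) - (w + \<pi> ^ a * rep Y) \<in> val_ideal v (int m)"
      using eq unfolding P Q F val_coset_eq_iff .
    then have "((z + \<pi> ^ a * rep X) - (w + \<pi> ^ a * rep Y)) - (z - w) \<in> val_ideal v (int (Suc a))"
      using assms by (intro val_ideal_diff[OF val_ideal_mono[OF d] val_ideal_diff] P Q) auto
    then have "\<pi> ^ a * (rep X - rep Y) \<in> val_ideal v (int (Suc a))" by (simp add: algebra_simps)
    then have "residue (rep X) = residue (rep Y)" unfolding cancel val_coset_eq_iff .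
    then have "X = Y" using rep P Q by metis
    then show "P = Q" using d P Q by (simp add: val_coset_eq_iff)
  qed
  moreover have "F ` (?R \<times> ?C (Suc a)) = ?C a"
  proof (intro equalityI subsetI)
    fix Z assume "Z \<in> F ` (?R \<times> ?C (Suc a))"
    then obtain X z where "X \<in> ?R" "z \<in> val_ideal v (int (Suc a))" "Z = F (X, val_coset (int m) z)" by blast
    then show "Z \<in> ?C a"
      using rep[of X] pi_power_in_val_ideal[of a] val_ideal_mono[of z "int (Suc a)" "int a"]
      by (auto simp: F intro!: imageI val_ideal_add val_ideal_mult_right)
  next
    fix Z assume "Z \<in> ?C a"
    then obtain z where z: "z \<in> val_ideal v (int a)" "Z = val_coset (int m) z" by blast
    then obtain c where c: "c \<in> val_ideal v 0" "z = \<pi> ^ a * c" using pi_power_dvd by blast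
    have X: "residue c \<in> ?R" using c by simp
    from rep[OF X] have "c - rep (residue c) \<in> val_ideal v 1"
      unfolding val_coset_eq_iff[symmetric] by simp
    then have "\<pi> ^ a * (c - rep (residue c)) \<in> val_ideal v (int (Suc a))" by (simp only: cancel)
    then have mem: "(residue c, val_coset (int m) (\<pi> ^ a * (c - rep (residue c)))) \<in> ?R \<times> ?C (Suc a)"
      using X by simp
    have "Z = F (residue c, val_coset (int m) (\<pi> ^ a * (c - rep (residue c))))"
      by (simp add: F z c algebra_simps)
    then show "Z \<in> F ` (?R \<times> ?C (Suc a))" using mem by (rule image_eqI)
  qed
  ultimately show ?thesis
    using card_image[of F "?R \<times> ?C (Suc a)"] by (simp only: card_cartesian_product)
qed

text \<open>Multiplication by \<open>\<pi> ^ k\<close> kills modulo the \<open>m\<close>-th power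
  exactly the classes from the power \<open>m - min k m\<close>, which lie \<open>min k m\<close>
  filtration steps above zero. The base is the order of the residue field of the large
  field.\<close>

lemma card_torsion_cosets:
  "card (val_coset (int m) ` {a \<in> val_ideal v 0. \<pi> ^ k * a \<in> val_ideal v (int m)}) =
    card (residue ` val_ideal v 0) ^ min k m"
proof -
  let ?q = "card (residue ` val_ideal v 0)"
  have "card (val_coset (int m) ` val_ideal v (int (m - j))) = ?q ^ j" if "j \<le> m" for j
    using that
  proof (induction j)
    case 0
    have "val_coset (int m) ` val_ideal v (int m) = {val_coset (int m) 0}"
    proof (intro equalityI subsetI)
      fix X assume "X \<in> val_coset (int m) ` val_ideal v (int m)"
      then obtain x where x: "x \<in> val_ideal v (int m)" "X = val_coset (int m) x" by blast
      have "val_coset (int m) x = val_coset (int m) 0" unfolding val_coset_eq_iff using x by simp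
      then show "X \<in> {val_coset (int m) 0}" using x by simp
    qed auto
    then show ?case by simp
  next
    case (Suc j)
    then show ?case using card_coset_filtration_step[of "m - Suc j" m] by (simp add: Suc_diff_Suc)
  qed
  from this[of "min k m"]
  have "card (val_coset (int m) ` val_ideal v (int (m - min k m))) = ?q ^ min k m" by simp
  moreover have "{a \<in> val_ideal v 0. \<pi> ^ k * a \<in> val_ideal v (int m)} = val_ideal v (int (m - min k m))"
  proof (rule Set.set_eqI)
    fix a
    show "a \<in> {a \<in> val_ideal v 0. \<pi> ^ k * a \<in> val_ideal v (int m)} \<longleftrightarrow> a \<in> val_ideal v (int (m - min k m))"
      by (cases "a = 0") (auto simp: mem_val_ideal val_mult val_power)
  qed
  ultimately show ?thesis by simp
qed

text \<open>The left side depends on \<open>M\<close> alone, the right side on the type, so it is an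
  invariant that separates types. Zero is written as \<open>0 \<odot> m\<close>, which keeps the
  count within scalar multiplication.\<close>

lemma card_torsion:
  assumes \<phi>: "presents n \<phi> M (mat_lattice v n (pi_mat \<pi> n mu))"
  shows "card {m \<in> carrier M. \<pi> ^ k \<odot>\<^bsub>M\<^esub> m = 0 \<odot>\<^bsub>M\<^esub> m} =
    card (residue ` val_ideal v 0) ^ (\<Sum>i<n. min k (mu i))"
proof -
  let ?C = "\<lambda>i. val_coset (int (mu i)) ` {a \<in> val_ideal v 0. \<pi> ^ k * a \<in> val_ideal v (int (mu i))}"
  let ?T = "{x \<in> int_vecs v n. \<pi> ^ k \<cdot>\<^sub>v x \<in> mat_lattice v n (pi_mat \<pi> n mu)}"
  note tp = presents_type_module[of n mu]
  have po: "\<pi> ^ k \<in> val_ideal v 0" by (rule val_ideal_mono[OF pi_power_in_val_ideal]) simp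
  have tors: "\<pi> ^ k \<odot>\<^bsub>M\<^esub> \<phi> x = 0 \<odot>\<^bsub>M\<^esub> \<phi> x \<longleftrightarrow> \<pi> ^ k \<cdot>\<^sub>v x \<in> mat_lattice v n (pi_mat \<pi> n mu)"
    if x: "x \<in> int_vecs v n" for x
  proof -
    have "\<pi> ^ k \<cdot>\<^sub>v x - 0 \<cdot>\<^sub>v x = \<pi> ^ k \<cdot>\<^sub>v x" using int_vecsD(1)[OF x] by (intro eq_vecI) auto
    then show ?thesis
      using presentsD(4)[OF \<phi> po x] presentsD(4)[OF \<phi> _ x, of 0]
        presentsD(5)[OF \<phi> int_vecs_smult[OF po x] int_vecs_smult[OF _ x, of 0]] by simp
  qed
  have "{m \<in> carrier M. \<pi> ^ k \<odot>\<^bsub>M\<^esub> m = 0 \<odot>\<^bsub>M\<^esub> m} = \<phi> ` ?T"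
  proof (intro equalityI subsetI)
    fix m assume m: "m \<in> {m \<in> carrier M. \<pi> ^ k \<odot>\<^bsub>M\<^esub> m = 0 \<odot>\<^bsub>M\<^esub> m}"
    then have "m \<in> \<phi> ` int_vecs v n" using presentsD(1)[OF \<phi>] by simp
    then show "m \<in> \<phi> ` ?T" using m tors by auto
  qed (use tors presentsD(2)[OF \<phi>] in auto)
  also have "card (\<phi> ` ?T) = card (type_proj v n mu ` ?T)"
  proof -
    obtain f where f: "f \<in> mod_iso (val_ring v) M (type_module v n mu)"
      "\<And>x. x \<in> int_vecs v n \<Longrightarrow> f (\<phi> x) = type_proj v n mu x"
      using presents_transfer[OF \<phi> tp] by blast
    have "inj_on f (carrier M)" using f(1) by (simp add: mod_iso_def bij_betw_def)
    moreover have "\<phi> ` ?T \<subseteq> carrier M" unfolding presentsD(1)[OF \<phi>, symmetric] by (rule image_mono) simp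
    ultimately have inj: "inj_on f (\<phi> ` ?T)" by (rule inj_on_subset)
    have "f ` \<phi> ` ?T = type_proj v n mu ` ?T"
      unfolding image_image using f(2) by (intro image_cong) auto
    then show ?thesis using card_image[OF inj] by simp
  qed
  also have "type_proj v n mu ` ?T = (\<Pi>\<^sub>E i\<in>{..<n}. ?C i)"
  proof (intro equalityI image_subsetI subsetI)
    fix x assume x: "x \<in> ?T"
    then have "x \<in> carrier_vec n" by (auto dest: int_vecsD)
    then show "type_proj v n mu x \<in> (\<Pi>\<^sub>E i\<in>{..<n}. ?C i)"
      using x mem_lattice_pi_mat[of "\<pi> ^ k \<cdot>\<^sub>v x" n mu] by (auto simp: type_proj_coset int_vecs_def)
  next
    fix X assume X: "X \<in> (\<Pi>\<^sub>E i\<in>{..<n}. ?C i)"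
    then have "\<forall>i\<in>{..<n}. \<exists>a. a \<in> val_ideal v 0 \<and> \<pi> ^ k * a \<in> val_ideal v (int (mu i)) \<and> X i = val_coset (int (mu i)) a"
      by (auto dest!: PiE_mem)
    then obtain a where a: "\<And>i. i < n \<Longrightarrow> a i \<in> val_ideal v 0 \<and> \<pi> ^ k * a i \<in> val_ideal v (int (mu i))
        \<and> X i = val_coset (int (mu i)) (a i)"
      by (metis lessThan_iff)
    have "X = type_proj v n mu (vec n a)"
      using a X by (intro PiE_ext[of X "{..<n}" _ _]) (auto simp: type_proj_coset)
    moreover have "vec n a \<in> ?T"
      using a mem_lattice_pi_mat[of "\<pi> ^ k \<cdot>\<^sub>v vec n a" n mu] by (simp add: int_vecs_def)
    ultimately show "X \<in> type_proj v n mu ` ?T" by blast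
  qed
  also have "card (\<Pi>\<^sub>E i\<in>{..<n}. ?C i) = (\<Prod>i<n. card (?C i))" by (simp add: card_PiE)
  also have "\<dots> = card (residue ` val_ideal v 0) ^ (\<Sum>i<n. min k (mu i))"
    unfolding card_torsion_cosets by (simp add: power_sum)
  finally show ?thesis .
qed

text \<open>Torsion counts determine the sums of \<open>min k (mu i)\<close> for all
  \<open>k\<close>. The increments of these sums in \<open>k\<close> are the parts of the conjugate
  partition, and a partition is recovered from its conjugate. This matches the partitions produced
  by normal forms with the prescribed ones.\<close>

lemma type_unique:
  assumes \<phi>: "presents n \<phi> M (mat_lattice v n (pi_mat \<pi> n mu))" and mu: "partition_le n mu"
    and \<psi>: "presents n \<psi> M (mat_lattice v n (pi_mat \<pi> n nu))" and nu: "partition_le n nu"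
  shows "mu = nu"
proof -
  have sums: "(\<Sum>i<n. min k (mu i)) = (\<Sum>i<n. min k (nu i))" for k
  proof -
    let ?q = "card (residue ` val_ideal v 0)"
    have "?q ^ (\<Sum>i<n. min k (mu i)) = ?q ^ (\<Sum>i<n. min k (nu i))"
      unfolding card_torsion[OF \<phi>, symmetric] card_torsion[OF \<psi>, symmetric] ..
    moreover have "1 < ?q" using card_residues_ge_2 by simp
    ultimately show ?thesis by (simp only: power_inject_exp)
  qed
  define count where "count lam k = card {i. i < n \<and> k < lam i}" for lam :: "nat \<Rightarrow> nat" and k
  have count: "(\<Sum>i<n. min (Suc k) (lam i)) = (\<Sum>i<n. min k (lam i)) + count lam k" for lam k
  proof -
    have "(\<Sum>i<n. min (Suc k) (lam i)) = (\<Sum>i<n. min k (lam i) + (if k < lam i then 1 else 0))"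
      by (intro sum.cong) auto
    also have "\<dots> = (\<Sum>i<n. min k (lam i)) + card ({..<n} \<inter> {i. k < lam i})"
      by (simp add: sum.distrib sum.If_cases)
    also have "{..<n} \<inter> {i. k < lam i} = {i. i < n \<and> k < lam i}" by auto
    finally show ?thesis by (simp add: count_def)
  qed
  \<comment> \<open>The parts decrease, so those exceeding \<open>k\<close> occupy an initial
    segment of the indices; its length is the conjugate part \<open>count lam k\<close>.\<close>
  have less_iff: "k < lam i \<longleftrightarrow> i < count lam k" if lam: "partition_le n lam" for lam k i
  proof -
    have anti: "lam j \<le> lam i" if "i \<le> j" for i j using lam that by (auto simp: partition_le_def monotone_def)
    have zero: "lam i = 0" if "n \<le> i" for i using lam that by (auto simp: partition_le_def)
    show ?thesis
    proof
      assume k: "k < lam i"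
      have "{..i} \<subseteq> {i. i < n \<and> k < lam i}"
      proof
        fix j assume "j \<in> {..i}"
        then have "k < lam j" using anti[of j i] k by simp
        moreover from this have "j < n" using zero[of j] by (cases "n \<le> j") auto
        ultimately show "j \<in> {i. i < n \<and> k < lam i}" by simp
      qed
      then have "card {..i} \<le> count lam k" unfolding count_def by (intro card_mono) auto
      then show "i < count lam k" by simp
    next
      assume i: "i < count lam k"
      show "k < lam i"
      proof (rule ccontr)
        assume le: "\<not> k < lam i"
        have "{i. i < n \<and> k < lam i} \<subseteq> {..<i}"
        proof
          fix j assume "j \<in> {i. i < n \<and> k < lam i}"
          then show "j \<in> {..<i}" using anti[of i j] le by (cases "i \<le> j") auto
        qed
        then have "count lam k \<le> card {..<i}" unfolding count_def by (intro card_mono) auto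
        then show False using i by simp
      qed
    qed
  qed
  have "count mu k = count nu k" for k using count[of k mu] count[of k nu] sums by simp
  then have "k < mu i \<longleftrightarrow> k < nu i" for k i using less_iff[OF mu] less_iff[OF nu] by simp
  then show ?thesis by (intro ext) (metis linorder_neqE_nat less_irrefl)
qed

end

section \<open>Hermitian modules\<close>

lemma GL_mult_cancel:
  assumes "y \<in> carrier (GL TYPE('a::field) n)" "X \<in> carrier_mat n m"
  shows "inv\<^bsub>GL TYPE('a) n\<^esub> y * (y * X) = X" "y * (inv\<^bsub>GL TYPE('a) n\<^esub> y * X) = X"
  using assoc_mult_mat[OF GL_inv(2)[OF assms(1)] GL_carrier_mat[OF assms(1)] assms(2)]
    assoc_mult_mat[OF GL_carrier_mat[OF assms(1)] GL_inv(2)[OF assms(1)] assms(2)]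
    GL_inv(3,4)[OF assms(1)] assms(2) by simp_all

section \<open>Submodules as images of lattices\<close>

context nonarch_local_field
begin

lemma mult_vec_mem_lattice:
  assumes y: "y \<in> carrier (GL TYPE('a) n)" and B: "B \<in> carrier (GL TYPE('a) n)" and x: "x \<in> carrier_vec n"
  shows "y *\<^sub>v x \<in> mat_lattice v n B \<longleftrightarrow> x \<in> mat_lattice v n (inv\<^bsub>GL TYPE('a) n\<^esub> y * B)"
proof -
  let ?i = "\<lambda>X. inv\<^bsub>GL TYPE('a) n\<^esub> X"
  have "?i (?i y * B) = ?i B * y"
    using GL_inv_mult[OF GL_inv(1)[OF y] B] GL_inv_inv[OF y] by simp
  then show ?thesis
    using mem_lattice_iff[OF B mult_mat_vec_carrier[OF GL_carrier_mat[OF y] x]]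
      mem_lattice_iff[OF GL_mult_closed[OF GL_inv(1)[OF y] B] x]
      assoc_mult_mat_vec[OF GL_inv(2)[OF B] GL_carrier_mat[OF y] x] by simp
qed

lemma lattice_closed:
  assumes A: "A \<in> carrier_mat n n"
  shows "0\<^sub>v n \<in> mat_lattice v n A"
    "x \<in> mat_lattice v n A \<Longrightarrow> y \<in> mat_lattice v n A \<Longrightarrow> x + y \<in> mat_lattice v n A"
    "r \<in> val_ideal v 0 \<Longrightarrow> x \<in> mat_lattice v n A \<Longrightarrow> r \<cdot>\<^sub>v x \<in> mat_lattice v n A"
proof -
  have "A *\<^sub>v 0\<^sub>v n = 0\<^sub>v n" using A by (intro eq_vecI) auto
  then show "0\<^sub>v n \<in> mat_lattice v n A" unfolding mat_lattice_def by (metis image_eqI int_vecs_zero)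
next
  assume "x \<in> mat_lattice v n A" "y \<in> mat_lattice v n A"
  then obtain a b where ab: "a \<in> int_vecs v n" "b \<in> int_vecs v n" "x = A *\<^sub>v a" "y = A *\<^sub>v b"
    by (auto simp: mat_lattice_def)
  have "x + y = A *\<^sub>v (a + b)"
    using mult_add_distrib_mat_vec[OF A] int_vecsD(1)[OF ab(1)] int_vecsD(1)[OF ab(2)] ab by simp
  then show "x + y \<in> mat_lattice v n A"
    unfolding mat_lattice_def using int_vecs_add[OF ab(1,2)] by (rule image_eqI)
next
  assume r: "r \<in> val_ideal v 0" and "x \<in> mat_lattice v n A"
  then obtain a where a: "a \<in> int_vecs v n" "x = A *\<^sub>v a" by (auto simp: mat_lattice_def)
  have "r \<cdot>\<^sub>v x = A *\<^sub>v (r \<cdot>\<^sub>v a)" using mult_mat_vec[OF A int_vecsD(1)[OF a(1)]] a by simp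
  then show "r \<cdot>\<^sub>v x \<in> mat_lattice v n A"
    unfolding mat_lattice_def using int_vecs_smult[OF r a(1)] by (rule image_eqI)
qed

lemma presents_zero:
  assumes \<phi>: "presents n \<phi> M L" and M: "Module.module (val_ring v) M"
  shows "\<phi> (0\<^sub>v n) = \<zero>\<^bsub>M\<^esub>"
proof -
  interpret M: Module.module "val_ring v" M by fact
  have "0 \<cdot>\<^sub>v 0\<^sub>v n = (0\<^sub>v n :: 'a vec)" by (intro eq_vecI) auto
  then have "\<phi> (0\<^sub>v n) = 0 \<odot>\<^bsub>M\<^esub> \<phi> (0\<^sub>v n)" using presentsD(4)[OF \<phi>, of 0 "0\<^sub>v n"] by simp
  also have "\<dots> = \<zero>\<^bsub>M\<^esub>"
    using M.smult_l_null[of "\<phi> (0\<^sub>v n)"] presentsD(2)[OF \<phi>, of "0\<^sub>v n"] by (simp add: val_ring_def)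
  finally show ?thesis .
qed

text \<open>Submodules of a presented module correspond to the submodules of \<oo>^n above the
  kernel; the condition \<open>K \<subseteq> L\<close> is what lets the image remember
  \<open>L\<close>.\<close>

lemma submodule_image:
  assumes \<phi>: "presents n \<phi> M K" and M: "Module.module (val_ring v) M"
    and L: "L \<subseteq> int_vecs v n" "0\<^sub>v n \<in> L" and add: "\<And>x y. x \<in> L \<Longrightarrow> y \<in> L \<Longrightarrow> x + y \<in> L"
    and smult: "\<And>r x. r \<in> val_ideal v 0 \<Longrightarrow> x \<in> L \<Longrightarrow> r \<cdot>\<^sub>v x \<in> L"
  shows "submodule (\<phi> ` L) (val_ring v) M"
    "K \<subseteq> L \<Longrightarrow> x \<in> int_vecs v n \<Longrightarrow> \<phi> x \<in> \<phi> ` L \<longleftrightarrow> x \<in> L"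
proof -
  interpret M: Module.module "val_ring v" M by fact
  have Li: "x \<in> int_vecs v n" if "x \<in> L" for x using that L by blast
  have mone: "- 1 \<in> val_ideal v 0" by simp
  show "submodule (\<phi> ` L) (val_ring v) M"
  proof (rule M.submoduleI)
    show "\<phi> ` L \<subseteq> carrier M" using presentsD(2)[OF \<phi> Li] by blast
    show "\<zero>\<^bsub>M\<^esub> \<in> \<phi> ` L" using presents_zero[OF \<phi> M] L(2) by (metis image_eqI)
  next
    fix a assume "a \<in> \<phi> ` L"
    then obtain x where x: "x \<in> L" "a = \<phi> x" by blast
    have "x + (- 1) \<cdot>\<^sub>v x = 0\<^sub>v n" using int_vecsD(1)[OF Li[OF x(1)]] by (intro eq_vecI) auto
    then have "\<phi> x \<oplus>\<^bsub>M\<^esub> \<phi> ((- 1) \<cdot>\<^sub>v x) = \<zero>\<^bsub>M\<^esub>"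
      using presentsD(3)[OF \<phi> Li[OF x(1)] Li[OF smult[OF mone x(1)]]] presents_zero[OF \<phi> M] by simp
    then have "\<ominus>\<^bsub>M\<^esub> a = \<phi> ((- 1) \<cdot>\<^sub>v x)"
      using presentsD(2)[OF \<phi> Li[OF x(1)]] presentsD(2)[OF \<phi> Li[OF smult[OF mone x(1)]]]
        M.minus_equality[of "\<phi> ((- 1) \<cdot>\<^sub>v x)" a] x(2) by (simp add: M.a_comm)
    then show "\<ominus>\<^bsub>M\<^esub> a \<in> \<phi> ` L" using smult[OF mone x(1)] by simp
  next
    fix a b assume "a \<in> \<phi> ` L" "b \<in> \<phi> ` L"
    then obtain x y where xy: "x \<in> L" "y \<in> L" "a = \<phi> x" "b = \<phi> y" by blast
    then have "a \<oplus>\<^bsub>M\<^esub> b = \<phi> (x + y)" using presentsD(3)[OF \<phi> Li[OF xy(1)] Li[OF xy(2)]] by simp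
    then show "a \<oplus>\<^bsub>M\<^esub> b \<in> \<phi> ` L" using add[OF xy(1,2)] by simp
  next
    fix r a assume "r \<in> carrier (val_ring v)" "a \<in> \<phi> ` L"
    then obtain x where x: "r \<in> val_ideal v 0" "x \<in> L" "a = \<phi> x" by auto
    then have "r \<odot>\<^bsub>M\<^esub> a = \<phi> (r \<cdot>\<^sub>v x)" using presentsD(4)[OF \<phi> x(1) Li[OF x(2)]] by simp
    then show "r \<odot>\<^bsub>M\<^esub> a \<in> \<phi> ` L" using smult[OF x(1,2)] by simp
  qed
  show "\<phi> x \<in> \<phi> ` L \<longleftrightarrow> x \<in> L" if K: "K \<subseteq> L" and x: "x \<in> int_vecs v n" for x
  proof
    assume "\<phi> x \<in> \<phi> ` L"
    then obtain z where z: "z \<in> L" "\<phi> x = \<phi> z" by blast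
    then have "x - z \<in> L" using presentsD(5)[OF \<phi> x Li[OF z(1)]] K by blast
    from add[OF this z(1)] have "x - z + z \<in> L" .
    moreover have "x - z + z = x"
      using int_vecsD(1)[OF x] int_vecsD(1)[OF Li[OF z(1)]] by (intro eq_vecI) auto
    ultimately show "x \<in> L" by simp
  qed simp
qed

lemma submodule_lattice:
  assumes \<phi>: "presents n \<phi> M K" and M: "Module.module (val_ring v) M" and y: "y \<in> ideal_mat v n n 0"
  shows "submodule (\<phi> ` mat_lattice v n y) (val_ring v) M"
    "K \<subseteq> mat_lattice v n y \<Longrightarrow> x \<in> int_vecs v n \<Longrightarrow>
      \<phi> x \<in> \<phi> ` mat_lattice v n y \<longleftrightarrow> x \<in> mat_lattice v n y"
  using submodule_image[OF \<phi> M lattice_int[OF y] lattice_closed[OF ideal_matD(1)[OF y]]] by blast+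

text \<open>The columns of \<open>y\<close> serve as a new basis: multiplication by \<open>y\<close>
  identifies \<oo>^n with the lattice of \<open>y\<close> and pulls the kernel back
  accordingly.\<close>

lemma presents_sublattice:
  assumes \<phi>: "presents n \<phi> M (mat_lattice v n A)" and A: "A \<in> carrier (GL TYPE('a) n)"
    and y: "y \<in> ideal_mat v n n 0" "y \<in> carrier (GL TYPE('a) n)"
  shows "presents n (\<lambda>x. \<phi> (y *\<^sub>v x)) (M\<lparr>carrier := \<phi> ` mat_lattice v n y\<rparr>)
    (mat_lattice v n (inv\<^bsub>GL TYPE('a) n\<^esub> y * A))"
  unfolding presents_def
proof (intro conjI ballI)
  note yi = ideal_mat_mult_int_vecs[OF y(1)] and yc = ideal_matD(1)[OF y(1)]
  show "(\<lambda>x. \<phi> (y *\<^sub>v x)) ` int_vecs v n = carrier (M\<lparr>carrier := \<phi> ` mat_lattice v n y\<rparr>)"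
    by (simp add: mat_lattice_def image_image)
  fix x assume x: "x \<in> int_vecs v n"
  note xc = int_vecsD(1)[OF x]
  {
    fix z assume z: "z \<in> int_vecs v n"
    note zc = int_vecsD(1)[OF z]
    show "\<phi> (y *\<^sub>v (x + z)) = \<phi> (y *\<^sub>v x) \<oplus>\<^bsub>M\<lparr>carrier := \<phi> ` mat_lattice v n y\<rparr>\<^esub> \<phi> (y *\<^sub>v z)"
      using presentsD(3)[OF \<phi> yi[OF x] yi[OF z]] mult_add_distrib_mat_vec[OF yc xc zc] by simp
    have "y *\<^sub>v x - y *\<^sub>v z = y *\<^sub>v (x - z)" using mult_minus_distrib_mat_vec[OF yc xc zc] by simp
    then show "\<phi> (y *\<^sub>v x) = \<phi> (y *\<^sub>v z) \<longleftrightarrow> x - z \<in> mat_lattice v n (inv\<^bsub>GL TYPE('a) n\<^esub> y * A)"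
      using presentsD(5)[OF \<phi> yi[OF x] yi[OF z]] mult_vec_mem_lattice[OF y(2) A, of "x - z"] xc zc by simp
  }
  fix r assume r: "r \<in> val_ideal v 0"
  show "\<phi> (y *\<^sub>v (r \<cdot>\<^sub>v x)) = r \<odot>\<^bsub>M\<lparr>carrier := \<phi> ` mat_lattice v n y\<rparr>\<^esub> \<phi> (y *\<^sub>v x)"
    using presentsD(4)[OF \<phi> r yi[OF x]] mult_mat_vec[OF yc xc] by simp
qed

lemma lattice_GL_int: "k \<in> GL_int v n \<Longrightarrow> mat_lattice v n k = int_vecs v n"
proof -
  assume k: "k \<in> GL_int v n"
  have "mat_lattice v n (1\<^sub>m n * k) = mat_lattice v n (1\<^sub>m n)" by (rule lattice_mult_GL_int[OF _ k]) simp
  moreover have "mat_lattice v n (1\<^sub>m n) = int_vecs v n"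
    unfolding mat_lattice_def by (intro equalityI subsetI) (auto simp: int_vecsD(1) intro!: image_eqI)
  ultimately show ?thesis using GL_int_carrier[OF k] by simp
qed

lemma presents_change_basis:
  assumes \<phi>: "presents n \<phi> M (mat_lattice v n A)" and A: "A \<in> carrier (GL TYPE('a) n)" and k: "k \<in> GL_int v n"
  shows "presents n (\<lambda>x. \<phi> (k *\<^sub>v x)) M (mat_lattice v n (inv\<^bsub>GL TYPE('a) n\<^esub> k * A))"
proof -
  have "M\<lparr>carrier := \<phi> ` mat_lattice v n k\<rparr> = M"
    using presentsD(1)[OF \<phi>] lattice_GL_int[OF k] by simp
  then show ?thesis using presents_sublattice[OF \<phi> A GL_int_ideal_mat[OF k] GL_int_GL[OF k]] by simp
qed

end

section \<open>Hermitian presentations and perfect pairings\<close>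

context unramified_involution
begin

text \<open>For integral Hermitian \<open>A\<close> this is the discriminant form of the lattice
  with Gram matrix \<open>A\<close>: the dual lattice modulo the lattice, carried to \<oo>^n / A
  \<oo>^n by multiplication with \<open>A\<close>.\<close>

definition herm_presents ::
    "nat \<Rightarrow> ('a vec \<Rightarrow> 'm) \<Rightarrow> ('a, 'm) module \<Rightarrow> ('m \<Rightarrow> 'm \<Rightarrow> 'a set) \<Rightarrow> 'a mat \<Rightarrow> bool" where
  "herm_presents n \<phi> M B A \<longleftrightarrow> presents n \<phi> M (mat_lattice v n A) \<and>
    (\<forall>x\<in>int_vecs v n. \<forall>y\<in>int_vecs v n.
      B (\<phi> x) (\<phi> y) = val_coset 0 (herm_sum star n x (inv\<^bsub>GL TYPE('a) n\<^esub> A *\<^sub>v y)))"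

lemma herm_presentsD:
  assumes "herm_presents n \<phi> M B A"
  shows "presents n \<phi> M (mat_lattice v n A)"
    "x \<in> int_vecs v n \<Longrightarrow> y \<in> int_vecs v n \<Longrightarrow>
      B (\<phi> x) (\<phi> y) = val_coset 0 (herm_sum star n x (inv\<^bsub>GL TYPE('a) n\<^esub> A *\<^sub>v y))"
  using assms by (auto simp: herm_presents_def)

text \<open>The choice made by \<open>SOME\<close> is harmless: two representatives of the
  \<open>i\<close>-th component differ by an element of the \<open>lam i\<close>-th power of the
  maximal ideal, which \<open>inverse (\<pi> ^ lam i)\<close> turns into an integer.\<close>

lemma type_pairing_type_proj:
  assumes x: "x \<in> int_vecs v n" and y: "y \<in> int_vecs v n"
  shows "type_pairing v star \<pi> n lam (type_proj v n lam x) (type_proj v n lam y) =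
    val_coset 0 (herm_sum star n x (inv\<^bsub>GL TYPE('a) n\<^esub> (pi_mat \<pi> n lam) *\<^sub>v y))"
proof -
  define p where "p i = inverse (\<pi> ^ lam i)" for i
  define a where "a i = (SOME a. a \<in> type_proj v n lam x i)" for i
  define b where "b i = (SOME a. a \<in> type_proj v n lam y i)" for i
  have rep: "(SOME a. a \<in> type_proj v n lam z i) - z $ i \<in> val_ideal v (int (lam i))" if "i < n" for z i
  proof -
    have "z $ i \<in> type_proj v n lam z i" using that by (simp add: type_proj_coset)
    then have "(SOME a. a \<in> type_proj v n lam z i) \<in> type_proj v n lam z i" by (rule someI)
    then show ?thesis using that by (simp add: type_proj_def)
  qed
  have h: "herm_sum star n x (inv\<^bsub>GL TYPE('a) n\<^esub> (pi_mat \<pi> n lam) *\<^sub>v y) =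
      (\<Sum>i<n. star (x $ i) * (p i * y $ i))"
    unfolding herm_sum_def pi_mat_GL(2) p_def
    by (intro sum.cong refl) (simp add: mat_diag_mult_vec[OF int_vecsD(1)[OF y]] del: index_mult_mat_vec)
  have pc: "p i * z \<in> val_ideal v 0" if "z \<in> val_ideal v (int (lam i))" for i z
    using that by (cases "z = 0") (auto simp: p_def mem_val_ideal val_mult val_inverse val_power)
  have "star (a i) * p i * b i - star (x $ i) * (p i * y $ i) \<in> val_ideal v 0" if i: "i < n" for i
  proof -
    have da: "star (a i - x $ i) \<in> val_ideal v (int (lam i))" and db: "b i - y $ i \<in> val_ideal v (int (lam i))"
      using rep[OF i] by (simp_all add: a_def b_def)
    have yi: "y $ i \<in> val_ideal v 0" and xi: "x $ i \<in> val_ideal v 0" using x y i int_vecsD(2) by blast+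
    have bi: "b i \<in> val_ideal v 0" using val_ideal_add[OF val_ideal_mono[OF db, of 0] yi] by simp
    \<comment> \<open>The difference of the two products is split so that each summand contains one
      difference of representatives.\<close>
    have "(p i * star (a i - x $ i)) * b i + star (x $ i) * (p i * (b i - y $ i)) \<in> val_ideal v 0"
      by (intro val_ideal_add val_ideal_mult_left pc[OF da] pc[OF db] bi) (use xi in simp)
    then show ?thesis by (simp add: star_diff algebra_simps)
  qed
  then have "(\<Sum>i<n. star (a i) * p i * b i - star (x $ i) * (p i * y $ i)) \<in> val_ideal v 0"
    by (intro val_ideal_sum) simp
  then show ?thesis
    unfolding type_pairing_def val_coset_as_rcoset val_coset_eq_iff h
    by (simp add: sum_subtractf a_def b_def p_def)
qed

lemma has_hermitian_type_presents:
  assumes "has_hermitian_type v star \<pi> n lam M B"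
  obtains \<phi> where "herm_presents n \<phi> M B (pi_mat \<pi> n lam)"
proof -
  obtain f where f: "f \<in> mod_iso (val_ring v) M (type_module v n lam)"
    and B: "\<And>x y. x \<in> carrier M \<Longrightarrow> y \<in> carrier M \<Longrightarrow> B x y = type_pairing v star \<pi> n lam (f x) (f y)"
    and M: "Module.module (val_ring v) M"
    using assms unfolding has_hermitian_type_def hermitian_module_def by blast
  note tp = presents_type_module[of n lam]
  let ?\<phi> = "\<lambda>x. inv_into (carrier M) f (type_proj v n lam x)"
  note p = presents_iso(1)[OF f tp M] and pf = presents_iso(2)[OF f tp M]
  have "herm_presents n ?\<phi> M B (pi_mat \<pi> n lam)"
    unfolding herm_presents_def
  proof (intro conjI ballI p)
    fix x y assume xy: "x \<in> int_vecs v n" "y \<in> int_vecs v n"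
    show "B (?\<phi> x) (?\<phi> y) = val_coset 0 (herm_sum star n x (inv\<^bsub>GL TYPE('a) n\<^esub> (pi_mat \<pi> n lam) *\<^sub>v y))"
      using B[OF presentsD(2)[OF p xy(1)] presentsD(2)[OF p xy(2)]] pf[OF xy(1)] pf[OF xy(2)]
        type_pairing_type_proj[OF xy] by simp
  qed
  then show thesis by (rule that)
qed

lemma adj_inv_hermitian:
  assumes "A \<in> carrier (GL TYPE('a) n)" "adj star A = A"
  shows "adj star (inv\<^bsub>GL TYPE('a) n\<^esub> A) = inv\<^bsub>GL TYPE('a) n\<^esub> A"
  using adj_GL(2)[OF assms(1)] assms(2) by simp

lemma herm_sum_inv_swap:
  assumes A: "A \<in> carrier (GL TYPE('a) n)" "adj star A = A" and x: "x \<in> carrier_vec n" and y: "y \<in> carrier_vec n"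
  shows "herm_sum star n (inv\<^bsub>GL TYPE('a) n\<^esub> A *\<^sub>v x) y = herm_sum star n x (inv\<^bsub>GL TYPE('a) n\<^esub> A *\<^sub>v y)"
  using herm_sum_adj[OF GL_inv(2)[OF A(1)] x y] adj_inv_hermitian[OF A] by simp

text \<open>\<oo>^n is free, so a functional is fixed by its values on the unit vectors, and these
  cosets lift to the field. The entries of \<open>s\<close> are conjugated because
  \<open>herm_sum\<close> is conjugate-linear on the left.\<close>

lemma linear_functional_F_mod_o:
  assumes add: "\<And>x y. x \<in> int_vecs v n \<Longrightarrow> y \<in> int_vecs v n \<Longrightarrow> \<gamma> (x + y) = \<gamma> x \<oplus>\<^bsub>F_mod_o v\<^esub> \<gamma> y"
    and smult: "\<And>r x. r \<in> val_ideal v 0 \<Longrightarrow> x \<in> int_vecs v n \<Longrightarrow> \<gamma> (r \<cdot>\<^sub>v x) = r \<odot>\<^bsub>F_mod_o v\<^esub> \<gamma> x"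
    and range: "\<And>x. x \<in> int_vecs v n \<Longrightarrow> \<gamma> x \<in> range (val_coset 0)"
  obtains s where "s \<in> carrier_vec n" "\<And>y. y \<in> int_vecs v n \<Longrightarrow> \<gamma> y = val_coset 0 (herm_sum star n s y)"
proof -
  have "\<forall>i. \<exists>c. \<gamma> (unit_vec n i) = val_coset 0 c" using range[OF unit_vec_int] by blast
  then obtain c where c: "\<And>i. \<gamma> (unit_vec n i) = val_coset 0 (c i)" by metis
  define s where "s = vec n (\<lambda>i. star (c i))"
  have "\<gamma> y = val_coset 0 (herm_sum star n s y)" if y: "y \<in> int_vecs v n" for y
  proof -
    define S where "S k = vec n (\<lambda>i. if i < k then y $ i else 0)" for k
    have Si: "S k \<in> int_vecs v n" for k using y by (auto simp: S_def int_vecs_def)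
    have "\<gamma> (S k) = val_coset 0 (\<Sum>i<k. c i * y $ i)" if "k \<le> n" for k
      using that
    proof (induction k)
      case 0
      have "S 0 = 0 \<cdot>\<^sub>v 0\<^sub>v n" by (auto simp: S_def)
      moreover obtain d where "\<gamma> (0\<^sub>v n) = val_coset 0 d" using range[OF int_vecs_zero] by blast
      ultimately show ?case using smult[of 0 "0\<^sub>v n"] by (simp add: F_mod_o_simps)
    next
      case (Suc k)
      have yk: "y $ k \<in> val_ideal v 0" using int_vecsD(2)[OF y] Suc.prems by simp
      have "S (Suc k) = S k + y $ k \<cdot>\<^sub>v unit_vec n k"
        using Suc.prems by (intro eq_vecI) (auto simp: S_def unit_vec_def less_Suc_eq)
      then have "\<gamma> (S (Suc k)) = \<gamma> (S k) \<oplus>\<^bsub>F_mod_o v\<^esub> (y $ k \<odot>\<^bsub>F_mod_o v\<^esub> \<gamma> (unit_vec n k))"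
        using add[OF Si int_vecs_smult[OF yk unit_vec_int]] smult[OF yk unit_vec_int] by simp
      then show ?case using Suc yk by (simp add: c F_mod_o_simps mult.commute)
    qed
    from this[of n] have "\<gamma> (S n) = val_coset 0 (\<Sum>i<n. c i * y $ i)" by simp
    moreover have "S n = y" using int_vecsD(1)[OF y] by (intro eq_vecI) (auto simp: S_def)
    ultimately show ?thesis by (simp add: herm_sum_def s_def star_star)
  qed
  moreover have "s \<in> carrier_vec n" by (simp add: s_def)
  ultimately show thesis using that by blast
qed

text \<open>Perfectness comes from the self-duality of \<oo>^n. If \<open>x - y\<close> pairs
  integrally with everything, the inverse of \<open>A\<close> sends it to an integral vector, so it
  lies in the kernel. A functional lifts to a vector \<open>s\<close> over the field; since it
  vanishes on the kernel lattice, \<open>A *\<^sub>v s\<close> is integral, and its class represents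
  the functional.\<close>

lemma hermitian_module_presented:
  assumes hp: "herm_presents n \<phi> M B A" and M: "Module.module (val_ring v) M" and fin: "finite (carrier M)"
    and A: "A \<in> carrier (GL TYPE('a) n)" "adj star A = A" and Ai: "A \<in> ideal_mat v n n 0"
  shows "hermitian_module v star M B"
proof -
  interpret M: Module.module "val_ring v" M by fact
  note p = herm_presentsD(1)[OF hp] and B = herm_presentsD(2)[OF hp]
  let ?i = "inv\<^bsub>GL TYPE('a) n\<^esub> A"
  note ic = GL_inv(2)[OF A(1)] and Ac = GL_carrier_mat[OF A(1)]
  have iv: "?i *\<^sub>v x \<in> carrier_vec n" if "x \<in> int_vecs v n" for x
    using mult_mat_vec_carrier[OF ic int_vecsD(1)[OF that]] .
  have ex: "\<exists>x\<in>int_vecs v n. m = \<phi> x" if "m \<in> carrier M" for m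
    using that presentsD(1)[OF p] by blast
  have hom: "B a \<in> mod_hom (val_ring v) M (F_mod_o v)" if "a \<in> carrier M" for a
  proof -
    obtain x where x: "x \<in> int_vecs v n" "a = \<phi> x" using ex \<open>a \<in> carrier M\<close> by blast
    show ?thesis
      unfolding mod_hom_def
    proof (intro CollectI conjI ballI funcsetI)
      fix b assume "b \<in> carrier M"
      then obtain y where y: "y \<in> int_vecs v n" "b = \<phi> y" using ex by blast
      then show "B a b \<in> carrier (F_mod_o v)" using B x by (simp add: F_mod_o_simps)
      {
        fix d assume "d \<in> carrier M"
        then obtain z where z: "z \<in> int_vecs v n" "d = \<phi> z" using ex by blast
        show "B a (b \<oplus>\<^bsub>M\<^esub> d) = B a b \<oplus>\<^bsub>F_mod_o v\<^esub> B a d"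
          using x y z B[OF x(1) int_vecs_add[OF y(1) z(1)]] B[OF x(1) y(1)] B[OF x(1) z(1)]
            presentsD(3)[OF p y(1) z(1)] mult_add_distrib_mat_vec[OF ic int_vecsD(1)[OF y(1)] int_vecsD(1)[OF z(1)]]
            herm_sum_add_right[OF iv[OF y(1)] iv[OF z(1)]]
          by (simp add: F_mod_o_simps)
      }
      fix r assume "r \<in> carrier (val_ring v)"
      then have r: "r \<in> val_ideal v 0" by simp
      show "B a (r \<odot>\<^bsub>M\<^esub> b) = r \<odot>\<^bsub>F_mod_o v\<^esub> B a b"
        using x y B[OF x(1) int_vecs_smult[OF r y(1)]] B[OF x(1) y(1)] presentsD(4)[OF p r y(1)]
          mult_mat_vec[OF ic int_vecsD(1)[OF y(1)]] herm_sum_smult_right[OF iv[OF y(1)]] r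
        by (simp add: F_mod_o_simps)
    qed
  qed
  have star_coset: "star ` val_coset 0 s = val_coset 0 (star s)" for s
  proof (intro equalityI subsetI)
    fix z assume "z \<in> star ` val_coset 0 s"
    then obtain w where w: "w - s \<in> val_ideal v 0" "z = star w" by (auto simp: val_coset_def)
    have "star (w - s) \<in> val_ideal v 0" using w by simp
    then show "z \<in> val_coset 0 (star s)" using w by (simp add: val_coset_def star_diff)
  next
    fix z assume "z \<in> val_coset 0 (star s)"
    then have "star (z - star s) \<in> val_ideal v 0" by (simp add: val_coset_def)
    then have "star z \<in> val_coset 0 s" by (simp add: val_coset_def star_diff star_star)
    then show "z \<in> star ` val_coset 0 s" by (metis image_eqI star_star)
  qed
  have sym: "B a b = star ` B b a" if ab: "a \<in> carrier M" "b \<in> carrier M" for a b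
  proof -
    obtain x y where xy: "x \<in> int_vecs v n" "a = \<phi> x" "y \<in> int_vecs v n" "b = \<phi> y" using ex ab by metis
    show ?thesis
      using B[OF xy(1,3)] B[OF xy(3,1)] herm_sum_inv_swap[OF A int_vecsD(1)[OF xy(1)] int_vecsD(1)[OF xy(3)]]
      by (simp add: star_coset star_herm_sum xy)
  qed
  let ?h = "\<lambda>x. restrict (B x) (carrier M)"
  let ?H = "mod_hom (val_ring v) M (F_mod_o v) \<inter> extensional (carrier M)"
  have "bij_betw ?h (carrier M) ?H"
  proof (rule bij_betw_imageI)
    show "inj_on ?h (carrier M)"
    proof (rule inj_onI)
      fix a b assume ab: "a \<in> carrier M" "b \<in> carrier M" and eq: "?h a = ?h b"
      obtain x y where xy: "x \<in> int_vecs v n" "a = \<phi> x" "y \<in> int_vecs v n" "b = \<phi> y" using ex ab by metis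
      note xc = int_vecsD(1)[OF xy(1)] and yc = int_vecsD(1)[OF xy(3)]
      have "herm_sum star n z (?i *\<^sub>v (x - y)) \<in> val_ideal v 0" if z: "z \<in> int_vecs v n" for z
      proof -
        have "B a (\<phi> z) = B b (\<phi> z)" using fun_cong[OF eq, of "\<phi> z"] presentsD(2)[OF p z] by simp
        then have "herm_sum star n x (?i *\<^sub>v z) - herm_sum star n y (?i *\<^sub>v z) \<in> val_ideal v 0"
          using B[OF xy(1) z] B[OF xy(3) z] xy by (simp add: val_coset_eq_iff)
        moreover have "herm_sum star n x (?i *\<^sub>v z) - herm_sum star n y (?i *\<^sub>v z) = herm_sum star n (x - y) (?i *\<^sub>v z)"
          using xc yc by (simp add: herm_sum_def star_diff algebra_simps sum_subtractf)
        ultimately have "star (herm_sum star n (x - y) (?i *\<^sub>v z)) \<in> val_ideal v 0" by simp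
        then show ?thesis
          using herm_sum_inv_swap[OF A int_vecsD(1)[OF z], of "x - y"] xc yc by (simp add: star_herm_sum)
      qed
      moreover have "?i *\<^sub>v (x - y) \<in> carrier_vec n" using mult_mat_vec_carrier[OF ic, of "x - y"] xc yc by simp
      ultimately have "?i *\<^sub>v (x - y) \<in> int_vecs v n" using int_vecs_dual by blast
      then have "x - y \<in> mat_lattice v n A" using mem_lattice_iff[OF A(1), of "x - y"] xc yc by simp
      then show "a = b" using presentsD(5)[OF p xy(1,3)] xy by simp
    qed
    show "?h ` carrier M = ?H"
    proof (intro equalityI image_subsetI subsetI)
      fix a assume "a \<in> carrier M"
      from hom[OF this] show "?h a \<in> ?H"
        by (auto simp: mod_hom_def Pi_iff)
    next
      fix g assume g: "g \<in> ?H"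
      have gadd: "g (\<phi> (x + y)) = g (\<phi> x) \<oplus>\<^bsub>F_mod_o v\<^esub> g (\<phi> y)"
        if xy: "x \<in> int_vecs v n" "y \<in> int_vecs v n" for x y
        using g presentsD(3)[OF p xy] presentsD(2)[OF p xy(1)] presentsD(2)[OF p xy(2)] by (simp add: mod_hom_def)
      have gsmult: "g (\<phi> (r \<cdot>\<^sub>v x)) = r \<odot>\<^bsub>F_mod_o v\<^esub> g (\<phi> x)"
        if r: "r \<in> val_ideal v 0" and x: "x \<in> int_vecs v n" for r x
        using g presentsD(4)[OF p r x] presentsD(2)[OF p x] r by (simp add: mod_hom_def)
      have grange: "g (\<phi> x) \<in> range (val_coset 0)" if x: "x \<in> int_vecs v n" for x
        using g presentsD(2)[OF p x] by (auto simp: mod_hom_def F_mod_o_simps)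
      obtain s where s: "s \<in> carrier_vec n"
        and gs: "\<And>y. y \<in> int_vecs v n \<Longrightarrow> g (\<phi> y) = val_coset 0 (herm_sum star n s y)"
        using linear_functional_F_mod_o[of n "\<lambda>x. g (\<phi> x)", OF gadd gsmult grange] by metis
      have As: "A *\<^sub>v s \<in> int_vecs v n"
      proof -
        have Asc: "A *\<^sub>v s \<in> carrier_vec n" using mult_mat_vec_carrier[OF Ac s] .
        have "herm_sum star n z (A *\<^sub>v s) \<in> val_ideal v 0" if z: "z \<in> int_vecs v n" for z
        proof -
          have Az: "A *\<^sub>v z \<in> int_vecs v n" by (rule ideal_mat_mult_int_vecs[OF Ai z])
          have "A *\<^sub>v z - 0\<^sub>v n = A *\<^sub>v z" using int_vecsD(1)[OF Az] by simp
          then have "\<phi> (A *\<^sub>v z) = \<phi> (0\<^sub>v n)"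
            using presentsD(5)[OF p Az int_vecs_zero] z by (simp add: mat_lattice_def)
          then have "val_coset 0 (herm_sum star n s (A *\<^sub>v z)) = val_coset 0 (herm_sum star n s (0\<^sub>v n))"
            using gs[OF Az] gs[OF int_vecs_zero] by simp
          then have "herm_sum star n s (A *\<^sub>v z) \<in> val_ideal v 0"
            by (simp add: val_coset_eq_iff) (simp add: herm_sum_def)
          then have "star (herm_sum star n s (A *\<^sub>v z)) \<in> val_ideal v 0" by simp
          then show ?thesis
            using herm_sum_adj[OF Ac int_vecsD(1)[OF z] s] A(2) by (simp add: star_herm_sum)
        qed
        then show ?thesis using int_vecs_dual[OF Asc] by blast
      qed
      have "g = ?h (\<phi> (A *\<^sub>v s))"
      proof (rule extensionalityI[of _ "carrier M"])
        fix b assume "b \<in> carrier M"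
        then obtain y where y: "y \<in> int_vecs v n" "b = \<phi> y" using ex by blast
        have "herm_sum star n (A *\<^sub>v s) (?i *\<^sub>v y) = herm_sum star n s y"
          using herm_sum_adj[OF Ac s iv[OF y(1)]] A(2) GL_mult_vec_cancel(1)[OF A(1) int_vecsD(1)[OF y(1)]] by simp
        then show "g b = ?h (\<phi> (A *\<^sub>v s)) b"
          using gs[OF y(1)] B[OF As y(1)] y presentsD(2)[OF p y(1)] by simp
      qed (use g in auto)
      then show "g \<in> ?h ` carrier M" using presentsD(2)[OF p As] by blast
    qed
  qed
  then show ?thesis
    unfolding hermitian_module_def by (intro conjI ballI M fin hom sym)
qed

lemma has_hermitian_type_if_presents:
  assumes hp: "herm_presents n \<phi> M B (pi_mat \<pi> n nu)" and M: "Module.module (val_ring v) M" "finite (carrier M)"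
  shows "has_hermitian_type v star \<pi> n nu M B"
proof -
  note p = herm_presentsD(1)[OF hp]
  obtain f where f: "f \<in> mod_iso (val_ring v) M (type_module v n nu)"
    "\<And>x. x \<in> int_vecs v n \<Longrightarrow> f (\<phi> x) = type_proj v n nu x"
    using presents_transfer[OF p presents_type_module] by blast
  have "B a b = type_pairing v star \<pi> n nu (f a) (f b)" if ab: "a \<in> carrier M" "b \<in> carrier M" for a b
  proof -
    obtain x y where xy: "x \<in> int_vecs v n" "a = \<phi> x" "y \<in> int_vecs v n" "b = \<phi> y"
      using ab presentsD(1)[OF p] by blast
    then show ?thesis using f(2) herm_presentsD(2)[OF hp] type_pairing_type_proj by simp
  qed
  then show ?thesis
    unfolding has_hermitian_type_def
    by (intro conjI bexI[OF _ f(1)] ballI hermitian_module_presented[OF hp M pi_mat_GL(1) adj_pi_mat pi_mat_ideal_mat])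
qed

text \<open>Congruent matrices describe the same Hermitian module: in the new coordinates the
  pairing has matrix \<open>h * inv A * adj star h\<close>, which is the inverse of
  \<open>D\<close>.\<close>

lemma herm_presents_change_basis:
  assumes hp: "herm_presents n \<phi> M B A" and A: "A = adj star h * D * h"
    and h: "h \<in> GL_int v n" and D: "D \<in> carrier (GL TYPE('a) n)"
  shows "herm_presents n (\<lambda>x. \<phi> (adj star h *\<^sub>v x)) M B D"
proof -
  let ?i = "\<lambda>X. inv\<^bsub>GL TYPE('a) n\<^esub> X"
  have k: "adj star h \<in> GL_int v n" by (rule adj_GL_int[OF h])
  note kG = GL_int_GL[OF k] and hG = GL_int_GL[OF h]
  note Dc = GL_carrier_mat[OF D] and hc = GL_int_carrier[OF h] and kc = GL_int_carrier[OF k]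
  have Dh: "D * h \<in> carrier (GL TYPE('a) n)" by (rule GL_mult_closed[OF D hG])
  have A': "A = adj star h * (D * h)" unfolding A by (rule assoc_mult_mat[OF kc Dc hc])
  have AG: "A \<in> carrier (GL TYPE('a) n)" unfolding A' by (rule GL_mult_closed[OF kG Dh])
  have "?i (adj star h) * A = D * h"
    unfolding A' by (rule GL_mult_cancel(1)[OF kG GL_carrier_mat[OF Dh]])
  then have "presents n (\<lambda>x. \<phi> (adj star h *\<^sub>v x)) M (mat_lattice v n D)"
    using presents_change_basis[OF herm_presentsD(1)[OF hp] AG k] lattice_mult_GL_int[OF Dc h] by simp
  moreover have "B (\<phi> (adj star h *\<^sub>v x)) (\<phi> (adj star h *\<^sub>v y)) = val_coset 0 (herm_sum star n x (?i D *\<^sub>v y))"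
    if x: "x \<in> int_vecs v n" and y: "y \<in> int_vecs v n" for x y
  proof -
    note xc = int_vecsD(1)[OF x] and yc = int_vecsD(1)[OF y]
    have ky: "adj star h *\<^sub>v y \<in> carrier_vec n" by (rule mult_mat_vec_carrier[OF kc yc])
    have iA: "?i A = ?i h * ?i D * ?i (adj star h)"
      unfolding A' using GL_inv_mult[OF kG Dh] GL_inv_mult[OF D hG] by simp
    have "?i A *\<^sub>v (adj star h *\<^sub>v y) = ?i h *\<^sub>v (?i D *\<^sub>v y)"
      unfolding iA using GL_inv(2)[OF D] GL_inv(2)[OF hG] GL_inv(2)[OF kG] ky yc
        GL_mult_vec_cancel(2)[OF kG yc]
      by (simp add: assoc_mult_mat_vec[of _ n n _ n] mult_carrier_mat[of _ n n _ n])
    then have "herm_sum star n (adj star h *\<^sub>v x) (?i A *\<^sub>v (adj star h *\<^sub>v y)) = herm_sum star n x (?i D *\<^sub>v y)"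
      using herm_sum_adj[OF kc xc, of "?i h *\<^sub>v (?i D *\<^sub>v y)"] GL_inv(2)[OF hG] mult_mat_vec_carrier[OF GL_inv(2)[OF D] yc]
        GL_mult_vec_cancel(1)[OF hG, of "?i D *\<^sub>v y"] by simp
    then show ?thesis
      using herm_presentsD(2)[OF hp ideal_mat_mult_int_vecs[OF GL_int_ideal_mat[OF k] x]
          ideal_mat_mult_int_vecs[OF GL_int_ideal_mat[OF k] y]] by simp
  qed
  ultimately show ?thesis by (simp add: herm_presents_def)
qed

end

section \<open>The form on a subquotient\<close>

lemma (in nonarch_local_field) quotient_presentation:
  assumes p: "presents n \<phi> M (mat_lattice v n A)" and M: "Module.module (val_ring v) M"
    and A: "A \<in> carrier (GL TYPE('a) n)"
    and y: "y \<in> ideal_mat v n n 0" "y \<in> carrier (GL TYPE('a) n)"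
    and sub: "mat_lattice v n A \<subseteq> mat_lattice v n y"
  shows "presents n (\<lambda>x. \<phi> ` mat_lattice v n y +>\<^bsub>M\<^esub> \<phi> x) (quot_module M (\<phi> ` mat_lattice v n y))
    (mat_lattice v n y)"
proof -
  have "{x \<in> int_vecs v n. \<phi> x \<in> \<phi> ` mat_lattice v n y} = mat_lattice v n y"
    using submodule_lattice(2)[OF p M y(1) sub] lattice_int[OF y(1)] by blast
  then show ?thesis using presents_quotient[OF p M submodule_lattice(1)[OF p M y(1)]] by simp
qed

context unramified_involution
begin

section \<open>Orthogonal complements in coordinates\<close>

context
  fixes n :: nat and \<phi> :: "'a vec \<Rightarrow> 'm" and M :: "('a, 'm) module" and B :: "'m \<Rightarrow> 'm \<Rightarrow> 'a set"
    and A :: "'a mat"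
  assumes hp: "herm_presents n \<phi> M B A" and M: "Module.module (val_ring v) M"
    and A: "A \<in> carrier (GL TYPE('a) n)" and hA: "adj star A = A"
begin

abbreviation (input) GL_inverse where "GL_inverse X \<equiv> inv\<^bsub>GL TYPE('a) n\<^esub> X"

lemma presentation: "presents n \<phi> M (mat_lattice v n A)"
  by (rule herm_presentsD(1)[OF hp])

text \<open>The lattice that presents the orthogonal complement of the image of \<open>y \<oo>\<^sup>n\<close>.\<close>

definition dual_mat :: "'a mat \<Rightarrow> 'a mat" where
  "dual_mat y = A * adj star (GL_inverse y)"

text \<open>The last claim is the matrix form of the fact that the double complement is the original
  submodule.\<close>

lemma dual_mat_GL:
  assumes y: "y \<in> carrier (GL TYPE('a) n)"
  shows "dual_mat y \<in> carrier (GL TYPE('a) n)" "GL_inverse (dual_mat y) = adj star y * GL_inverse A"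
    "dual_mat (dual_mat y) = y"
proof -
  have a: "adj star (GL_inverse y) \<in> carrier (GL TYPE('a) n)" "GL_inverse (adj star (GL_inverse y)) = adj star y"
    using adj_GL[OF GL_inv(1)[OF y]] GL_inv_inv[OF y] by simp_all
  show "dual_mat y \<in> carrier (GL TYPE('a) n)" unfolding dual_mat_def by (rule GL_mult_closed[OF A a(1)])
  show i: "GL_inverse (dual_mat y) = adj star y * GL_inverse A"
    unfolding dual_mat_def using GL_inv_mult[OF A a(1)] a(2) by simp
  have "adj star (adj star y * GL_inverse A) = GL_inverse A * y"
    using adj_mult[OF adj_carrier[OF GL_carrier_mat[OF y]] GL_inv(2)[OF A]] adj_inv_hermitian[OF A hA]
    by simp
  then show "dual_mat (dual_mat y) = y"
    using GL_mult_cancel(2)[OF A GL_carrier_mat[OF y]] by (simp add: dual_mat_def[of "dual_mat y"] i)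
qed

text \<open>Being perpendicular to \<open>y *\<^sub>v c\<close> for every integral \<open>c\<close>
  means that \<open>adj star y * inv A\<close> sends \<open>x\<close> to a vector pairing integrally
  with all of \<oo>^n; self-duality makes that vector integral.\<close>

lemma perp_image:
  assumes y: "y \<in> ideal_mat v n n 0" "y \<in> carrier (GL TYPE('a) n)" and x: "x \<in> int_vecs v n"
  shows "\<phi> x \<in> perp v M B (\<phi> ` mat_lattice v n y) \<longleftrightarrow> x \<in> mat_lattice v n (dual_mat y)"
proof -
  note yc = GL_carrier_mat[OF y(2)] and ic = GL_inv(2)[OF A] and xc = int_vecsD(1)[OF x]
  have swap: "star (herm_sum star n x (GL_inverse A *\<^sub>v (y *\<^sub>v c))) = herm_sum star n c (adj star y *\<^sub>v (GL_inverse A *\<^sub>v x))"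
    if c: "c \<in> int_vecs v n" for c
  proof -
    have cc: "c \<in> carrier_vec n" "y *\<^sub>v c \<in> carrier_vec n" "GL_inverse A *\<^sub>v x \<in> carrier_vec n"
      using int_vecsD(1)[OF c] mult_mat_vec_carrier[OF yc] mult_mat_vec_carrier[OF ic xc] by simp_all
    then show ?thesis
      using herm_sum_inv_swap[OF A hA cc(2) xc] herm_sum_adj[OF yc cc(1,3)] by (simp add: star_herm_sum)
  qed
  have z: "adj star y *\<^sub>v (GL_inverse A *\<^sub>v x) \<in> carrier_vec n"
    by (intro mult_mat_vec_carrier[OF adj_carrier[OF yc]] mult_mat_vec_carrier[OF ic xc])
  have "\<phi> x \<in> perp v M B (\<phi> ` mat_lattice v n y) \<longleftrightarrow>
      (\<forall>c\<in>int_vecs v n. B (\<phi> x) (\<phi> (y *\<^sub>v c)) = val_coset 0 0)"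
    unfolding perp_def F_mod_o_simps(2) mat_lattice_def using presentsD(2)[OF presentation x] by simp
  also have "\<dots> \<longleftrightarrow> (\<forall>c\<in>int_vecs v n. star (herm_sum star n x (GL_inverse A *\<^sub>v (y *\<^sub>v c))) \<in> val_ideal v 0)"
    using herm_presentsD(2)[OF hp x ideal_mat_mult_int_vecs[OF y(1)]] by (simp add: val_coset_eq_iff)
  also have "\<dots> \<longleftrightarrow> adj star y *\<^sub>v (GL_inverse A *\<^sub>v x) \<in> int_vecs v n"
    using swap int_vecs_dual[OF z] by simp
  also have "\<dots> \<longleftrightarrow> x \<in> mat_lattice v n (dual_mat y)"
    using mem_lattice_iff[OF dual_mat_GL(1)[OF y(2)] xc] dual_mat_GL(2)[OF y(2)]
      assoc_mult_mat_vec[OF adj_carrier[OF yc] ic xc, of star] by simp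
  finally show ?thesis .
qed

context
  fixes y :: "'a mat"
  assumes y: "y \<in> ideal_mat v n n 0" "y \<in> carrier (GL TYPE('a) n)"
    and sub: "mat_lattice v n A \<subseteq> mat_lattice v n y"
begin

text \<open>Pulling the form of \<open>inv A\<close> back along \<open>y\<close> gives
  \<open>adj star y * inv A * y\<close>. The matrix defined here is its inverse, which is the one
  that \<open>herm_presents\<close> expects.\<close>

definition pulled_back_form :: "'a mat" where
  "pulled_back_form = GL_inverse y * A * adj star (GL_inverse y)"

lemma pulled_back_form_eq: "pulled_back_form = GL_inverse y * dual_mat y"
  unfolding pulled_back_form_def dual_mat_def
  by (rule assoc_mult_mat[OF GL_inv(2)[OF y(2)] GL_carrier_mat[OF A] adj_carrier[OF GL_inv(2)[OF y(2)]]])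

lemma pulled_back_form_GL:
  "pulled_back_form \<in> carrier (GL TYPE('a) n)" "adj star pulled_back_form = pulled_back_form"
  "GL_inverse pulled_back_form = adj star y * GL_inverse A * y"
proof -
  note d = dual_mat_GL[OF y(2)]
  show "pulled_back_form \<in> carrier (GL TYPE('a) n)"
    unfolding pulled_back_form_eq by (rule GL_mult_closed[OF GL_inv(1)[OF y(2)] d(1)])
  show "GL_inverse pulled_back_form = adj star y * GL_inverse A * y"
    unfolding pulled_back_form_eq using GL_inv_mult[OF GL_inv(1)[OF y(2)] d(1)] GL_inv_inv[OF y(2)] d(2) by simp
  note ic = GL_inv(2)[OF y(2)]
  have "adj star (GL_inverse y * (A * adj star (GL_inverse y))) = adj star (A * adj star (GL_inverse y)) * adj star (GL_inverse y)"
    by (rule adj_mult[OF ic mult_carrier_mat[OF GL_carrier_mat[OF A] adj_carrier[OF ic]]])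
  also have "adj star (A * adj star (GL_inverse y)) = GL_inverse y * A"
    using adj_mult[OF GL_carrier_mat[OF A] adj_carrier[OF ic]] hA by simp
  finally show "adj star pulled_back_form = pulled_back_form"
    unfolding pulled_back_form_eq dual_mat_def
    using assoc_mult_mat[OF ic GL_carrier_mat[OF A] adj_carrier[OF ic], of star] by simp
qed

text \<open>The matrix is the adjoint of \<open>inv y * A\<close>, and the latter is integral
  because the lattice of \<open>A\<close> lies in that of \<open>y\<close>.\<close>

lemma dual_mat_int: "dual_mat y \<in> ideal_mat v n n 0"
proof -
  have "adj star (GL_inverse y * A) \<in> ideal_mat v n n 0"
    using sub lattice_subset_iff[OF y(2) GL_carrier_mat[OF A]] by (intro adj_ideal_mat) simp
  then show ?thesis
    using adj_mult[OF GL_inv(2)[OF y(2)] GL_carrier_mat[OF A]] hA by (simp add: dual_mat_def)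
qed

lemma perp_image_eq: "perp v M B (\<phi> ` mat_lattice v n y) = \<phi> ` mat_lattice v n (dual_mat y)"
proof (intro equalityI subsetI)
  fix m assume m: "m \<in> perp v M B (\<phi> ` mat_lattice v n y)"
  then have "m \<in> \<phi> ` int_vecs v n" using presentsD(1)[OF presentation] by (simp add: perp_def)
  then obtain x where x: "x \<in> int_vecs v n" "m = \<phi> x" by blast
  then have "x \<in> mat_lattice v n (dual_mat y)" using perp_image[OF y x(1)] m by simp
  then show "m \<in> \<phi> ` mat_lattice v n (dual_mat y)" using x by simp
next
  fix m assume "m \<in> \<phi> ` mat_lattice v n (dual_mat y)"
  then obtain x where x: "x \<in> mat_lattice v n (dual_mat y)" "m = \<phi> x" by blast
  then show "m \<in> perp v M B (\<phi> ` mat_lattice v n y)" using perp_image[OF y, of x] lattice_int[OF dual_mat_int] by auto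
qed

lemma dual_lattice_subset_iff:
  "mat_lattice v n (dual_mat y) \<subseteq> mat_lattice v n y \<longleftrightarrow> pulled_back_form \<in> ideal_mat v n n 0"
  using lattice_subset_iff[OF y(2) GL_carrier_mat[OF dual_mat_GL(1)[OF y(2)]]] by (simp add: pulled_back_form_eq)

text \<open>Isotropy puts the complement inside its own complement, which is the original submodule;
  on lattices, the dual lattice lies in that of \<open>y\<close>.\<close>

lemma isotropic_perp_iff: "isotropic v M B (perp v M B (\<phi> ` mat_lattice v n y)) \<longleftrightarrow> pulled_back_form \<in> ideal_mat v n n 0"
proof -
  note d = dual_mat_int dual_mat_GL(1)[OF y(2)]
  have "isotropic v M B (perp v M B (\<phi> ` mat_lattice v n y)) \<longleftrightarrow>
      (\<forall>x\<in>mat_lattice v n (dual_mat y). \<phi> x \<in> perp v M B (\<phi> ` mat_lattice v n (dual_mat y)))"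
    unfolding isotropic_def perp_image_eq by blast
  also have "\<dots> \<longleftrightarrow> mat_lattice v n (dual_mat y) \<subseteq> mat_lattice v n y"
    using perp_image[OF d] lattice_int[OF dual_mat_int] unfolding dual_mat_GL(3)[OF y(2)] by blast
  finally show ?thesis by (simp only: dual_lattice_subset_iff)
qed

text \<open>Multiplication by \<open>y\<close> reaches the submodule, and then cosets of the
  complement are taken. A vector dies when \<open>y\<close> moves it into the dual lattice, that is,
  when it lies in the lattice of \<open>inv y * dual_mat y\<close>.\<close>

lemma presents_perp_quotient:
  assumes int: "pulled_back_form \<in> ideal_mat v n n 0"
  defines "P \<equiv> perp v M B (\<phi> ` mat_lattice v n y)"
  defines "Q \<equiv> quot_module (M\<lparr>carrier := (\<phi> ` mat_lattice v n y)\<rparr>) P"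
  shows "Module.module (val_ring v) Q" "finite (carrier M) \<Longrightarrow> finite (carrier Q)"
    "herm_presents n (\<lambda>x. P +>\<^bsub>M\<lparr>carrier := (\<phi> ` mat_lattice v n y)\<rparr>\<^esub> \<phi> (y *\<^sub>v x)) Q (quot_pairing B) pulled_back_form"
proof -
  let ?N = "M\<lparr>carrier := (\<phi> ` mat_lattice v n y)\<rparr>"
  let ?d = "dual_mat y" and ?F = "pulled_back_form"
  interpret M: Module.module "val_ring v" M by (rule M)
  note d = dual_mat_GL[OF y(2)]
  note yc = GL_carrier_mat[OF y(2)] and dc = GL_carrier_mat[OF d(1)] and ic = GL_inv(2)[OF A]
  have P: "P = \<phi> ` mat_lattice v n ?d" unfolding P_def by (rule perp_image_eq)
  have dsub: "mat_lattice v n ?d \<subseteq> mat_lattice v n y" using int dual_lattice_subset_iff by simp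
  have Nsub: "submodule (\<phi> ` mat_lattice v n y) (val_ring v) M" by (rule submodule_lattice(1)[OF presentation M y(1)])
  have Psub: "submodule P (val_ring v) M" unfolding P by (rule submodule_lattice(1)[OF presentation M dual_mat_int])
  have PN: "P \<subseteq> (\<phi> ` mat_lattice v n y)" unfolding P using dsub by blast
  have Nmod: "Module.module (val_ring v) ?N" by (rule submodule.submodule_is_module[OF Nsub M])
  interpret N: Module.module "val_ring v" ?N by (rule Nmod)
  have PsubN: "submodule P (val_ring v) ?N"
  proof (rule N.submoduleI)
    fix a assume a: "a \<in> P"
    then have ac: "a \<in> carrier M" "a \<in> (\<phi> ` mat_lattice v n y)" using PN M.submoduleE(1)[OF Psub] by auto
    have "\<ominus>\<^bsub>M\<^esub> a \<in> (\<phi> ` mat_lattice v n y)" using M.submoduleE(3)[OF Nsub ac(2)] .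
    then have "\<ominus>\<^bsub>?N\<^esub> a = \<ominus>\<^bsub>M\<^esub> a"
      using N.minus_equality[of "\<ominus>\<^bsub>M\<^esub> a" a] ac M.l_neg[OF ac(1)] by simp
    then show "\<ominus>\<^bsub>?N\<^esub> a \<in> P" using M.submoduleE(3)[OF Psub a] by simp
  next
    have "\<zero>\<^bsub>M\<^esub> \<in> P"
      unfolding P using presents_zero[OF presentation M] lattice_closed(1)[OF dc] by (metis image_eqI)
    then show "\<zero>\<^bsub>?N\<^esub> \<in> P" by simp
  qed (use PN M.submoduleE(4,5)[OF Psub] in auto)
  show Qmod: "Module.module (val_ring v) Q"
    unfolding Q_def by (rule module_quot_module[OF Nmod PsubN])
  show "finite (carrier Q)" if "finite (carrier M)"
  proof -
    have "finite (\<phi> ` mat_lattice v n y)" using that M.submoduleE(1)[OF Nsub] by (rule rev_finite_subset)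
    then show ?thesis by (simp add: Q_def)
  qed
  have pN: "presents n (\<lambda>x. \<phi> (y *\<^sub>v x)) ?N (mat_lattice v n (GL_inverse y * A))"
    by (rule presents_sublattice[OF presentation A y])
  \<comment> \<open>The inverse of \<open>?d\<close> times \<open>A\<close> is the adjoint of
    \<open>y\<close>, hence integral. So the dual lattice contains the kernel, as the correspondence
    with submodules requires.\<close>
  have Asub: "mat_lattice v n A \<subseteq> mat_lattice v n ?d"
  proof -
    have "GL_inverse ?d * A = adj star y"
      unfolding d(2) using assoc_mult_mat[OF adj_carrier[OF yc] ic GL_carrier_mat[OF A], of star] GL_inv(4)[OF A] yc
      by simp
    then show ?thesis using lattice_subset_iff[OF d(1) GL_carrier_mat[OF A]] adj_ideal_mat[OF y(1)] by simp
  qed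
  have ker: "{x \<in> int_vecs v n. \<phi> (y *\<^sub>v x) \<in> P} = mat_lattice v n ?F"
  proof -
    have "\<phi> (y *\<^sub>v x) \<in> P \<longleftrightarrow> x \<in> mat_lattice v n ?F" if x: "x \<in> int_vecs v n" for x
      unfolding P pulled_back_form_eq
      using submodule_lattice(2)[OF presentation M dual_mat_int Asub ideal_mat_mult_int_vecs[OF y(1) x]]
        mult_vec_mem_lattice[OF y(2) d(1) int_vecsD(1)[OF x]] by simp
    then show ?thesis using lattice_int[OF int] by blast
  qed
  have pQ: "presents n (\<lambda>x. P +>\<^bsub>?N\<^esub> \<phi> (y *\<^sub>v x)) Q (mat_lattice v n ?F)"
    using presents_quotient[OF pN Nmod PsubN] unfolding Q_def ker .
  \<comment> \<open>\<open>quot_pairing\<close> is a union over all representatives, so each pair of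
    them must give the same coset. Every representative comes from
    \<open>?d *\<^sub>v c + y *\<^sub>v x\<close>. Of the four resulting terms, the three that
    involve \<open>?d\<close> are integral, as all vectors and \<open>?F\<close> are; only the
    pairing of the \<open>y\<close> parts remains.\<close>
  have val: "B a b = val_coset 0 (herm_sum star n x (GL_inverse ?F *\<^sub>v z))"
    if x: "x \<in> int_vecs v n" and z: "z \<in> int_vecs v n"
      and a: "a \<in> P +>\<^bsub>?N\<^esub> \<phi> (y *\<^sub>v x)" and b: "b \<in> P +>\<^bsub>?N\<^esub> \<phi> (y *\<^sub>v z)" for a b x z
  proof -
    have rep: "\<exists>c\<in>int_vecs v n. e = \<phi> (?d *\<^sub>v c + y *\<^sub>v w)"
      if w: "w \<in> int_vecs v n" and e: "e \<in> P +>\<^bsub>?N\<^esub> \<phi> (y *\<^sub>v w)" for e w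
    proof -
      obtain h where h: "h \<in> P" "e = h \<oplus>\<^bsub>M\<^esub> \<phi> (y *\<^sub>v w)" using e by (auto simp: a_r_coset_def')
      then obtain c where c: "c \<in> int_vecs v n" "h = \<phi> (?d *\<^sub>v c)" unfolding P mat_lattice_def by blast
      have "e = \<phi> (?d *\<^sub>v c + y *\<^sub>v w)"
        using presentsD(3)[OF presentation ideal_mat_mult_int_vecs[OF dual_mat_int c(1)] ideal_mat_mult_int_vecs[OF y(1) w]] h c
        by simp
      then show ?thesis using c(1) by blast
    qed
    obtain c where c: "c \<in> int_vecs v n" "a = \<phi> (?d *\<^sub>v c + y *\<^sub>v x)" using rep[OF x a] by blast
    obtain e where e: "e \<in> int_vecs v n" "b = \<phi> (?d *\<^sub>v e + y *\<^sub>v z)" using rep[OF z b] by blast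
    note xc = int_vecsD(1)[OF x] and zc = int_vecsD(1)[OF z] and cc = int_vecsD(1)[OF c(1)] and ec = int_vecsD(1)[OF e(1)]
    have mv: "?d *\<^sub>v c \<in> carrier_vec n" "?d *\<^sub>v e \<in> carrier_vec n" "y *\<^sub>v x \<in> carrier_vec n" "y *\<^sub>v z \<in> carrier_vec n"
      using mult_mat_vec_carrier[OF dc cc] mult_mat_vec_carrier[OF dc ec] mult_mat_vec_carrier[OF yc xc]
        mult_mat_vec_carrier[OF yc zc] .
    have Bab: "B a b = val_coset 0 (herm_sum star n (?d *\<^sub>v c + y *\<^sub>v x) (GL_inverse A *\<^sub>v (?d *\<^sub>v e + y *\<^sub>v z)))"
      unfolding c(2) e(2)
      by (intro herm_presentsD(2)[OF hp] int_vecs_add ideal_mat_mult_int_vecs[OF dual_mat_int]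
          ideal_mat_mult_int_vecs[OF y(1)] c e x z)
    have iyc: "adj star (GL_inverse y) \<in> carrier_mat n n" by (rule adj_carrier[OF GL_inv(2)[OF y(2)]])
    have "GL_inverse A * ?d = adj star (GL_inverse y)"
      unfolding dual_mat_def by (rule GL_mult_cancel(1)[OF A iyc])
    then have Ad: "GL_inverse A *\<^sub>v (?d *\<^sub>v e) = adj star (GL_inverse y) *\<^sub>v e"
      using assoc_mult_mat_vec[OF ic dc ec] by simp
    have t1: "herm_sum star n (?d *\<^sub>v c) (adj star (GL_inverse y) *\<^sub>v e) = herm_sum star n (?F *\<^sub>v c) e"
      using herm_sum_adj[OF GL_inv(2)[OF y(2)] mv(1) ec] assoc_mult_mat_vec[OF GL_inv(2)[OF y(2)] dc cc]
      by (simp add: pulled_back_form_eq)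
    have "adj star ?d = GL_inverse y * A"
      unfolding dual_mat_def using adj_mult[OF GL_carrier_mat[OF A] iyc] hA by simp
    then have "herm_sum star n (?d *\<^sub>v c) (GL_inverse A *\<^sub>v (y *\<^sub>v z)) = herm_sum star n c (GL_inverse y * A *\<^sub>v (GL_inverse A *\<^sub>v (y *\<^sub>v z)))"
      using herm_sum_adj[OF dc cc mult_mat_vec_carrier[OF ic mv(4)]] by simp
    also have "GL_inverse y * A *\<^sub>v (GL_inverse A *\<^sub>v (y *\<^sub>v z)) = z"
      using assoc_mult_mat_vec[OF GL_inv(2)[OF y(2)] GL_carrier_mat[OF A] mult_mat_vec_carrier[OF ic mv(4)]]
        GL_mult_vec_cancel(1)[OF A mv(4)] GL_mult_vec_cancel(2)[OF y(2) zc] by simp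
    finally have t2: "herm_sum star n (?d *\<^sub>v c) (GL_inverse A *\<^sub>v (y *\<^sub>v z)) = herm_sum star n c z" .
    have t3: "herm_sum star n (y *\<^sub>v x) (adj star (GL_inverse y) *\<^sub>v e) = herm_sum star n x e"
      using herm_sum_adj[OF GL_inv(2)[OF y(2)] mv(3) ec] GL_mult_vec_cancel(2)[OF y(2) xc] by simp
    have t4: "herm_sum star n (y *\<^sub>v x) (GL_inverse A *\<^sub>v (y *\<^sub>v z)) = herm_sum star n x (GL_inverse ?F *\<^sub>v z)"
      using herm_sum_adj[OF yc xc mult_mat_vec_carrier[OF ic mv(4)]]
        assoc_mult_mat_vec[OF mult_carrier_mat[OF adj_carrier[OF yc] ic] yc zc, of star]
        assoc_mult_mat_vec[OF adj_carrier[OF yc] ic mv(4), of star]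
      by (simp add: pulled_back_form_GL(3))
    have "herm_sum star n (?d *\<^sub>v c + y *\<^sub>v x) (GL_inverse A *\<^sub>v (?d *\<^sub>v e + y *\<^sub>v z)) =
        herm_sum star n (?F *\<^sub>v c) e + herm_sum star n c z + herm_sum star n x e + herm_sum star n x (GL_inverse ?F *\<^sub>v z)"
      unfolding mult_add_distrib_mat_vec[OF ic mv(2,4)] Ad herm_sum_add_left[OF mv(1,3)]
        herm_sum_add_right[OF mult_mat_vec_carrier[OF iyc ec] mult_mat_vec_carrier[OF ic mv(4)]] t1 t2 t3 t4
      by simp
    moreover have "herm_sum star n (?F *\<^sub>v c) e + herm_sum star n c z + herm_sum star n x e \<in> val_ideal v 0"
      by (intro val_ideal_add herm_sum_int ideal_mat_mult_int_vecs[OF int] c e x z)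
    ultimately show ?thesis unfolding Bab val_coset_eq_iff by simp
  qed
  show "herm_presents n (\<lambda>x. P +>\<^bsub>?N\<^esub> \<phi> (y *\<^sub>v x)) Q (quot_pairing B) ?F"
    unfolding herm_presents_def
  proof (intro conjI ballI pQ)
    fix x z assume x: "x \<in> int_vecs v n" and z: "z \<in> int_vecs v n"
    have ne: "\<phi> (y *\<^sub>v w) \<in> P +>\<^bsub>?N\<^esub> \<phi> (y *\<^sub>v w)" if w: "w \<in> int_vecs v n" for w
      using abelian_subgroup.a_rcos_self[OF submodule_quotient(1)[OF Nmod PsubN], of "\<phi> (y *\<^sub>v w)"]
        presentsD(2)[OF pN w] by simp
    show "quot_pairing B (P +>\<^bsub>?N\<^esub> \<phi> (y *\<^sub>v x)) (P +>\<^bsub>?N\<^esub> \<phi> (y *\<^sub>v z)) =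
        val_coset 0 (herm_sum star n x (GL_inverse ?F *\<^sub>v z))"
      unfolding quot_pairing_def using val[OF x z] ne[OF x] ne[OF z] by blast
  qed
qed

end
end
end

section \<open>Hall submodules and cosets\<close>

context unramified_involution
begin

text \<open>The support of the integrand of the convolution at \<open>x\<close>, written without
  indicator functions.\<close>

definition hecke_set :: "nat \<Rightarrow> (nat \<Rightarrow> nat) \<Rightarrow> (nat \<Rightarrow> nat) \<Rightarrow> 'a mat \<Rightarrow> 'a mat set" where
  "hecke_set n mu nu x = {y \<in> carrier (GL TYPE('a) n).
     (\<exists>k\<in>GL_int v n. \<exists>l\<in>GL_int v n. y = k * pi_mat \<pi> n mu * l) \<and>
     (\<exists>h\<in>GL_int v n. inv\<^bsub>GL TYPE('a) n\<^esub> y * x * adj star (inv\<^bsub>GL TYPE('a) n\<^esub> y) =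
        adj star h * pi_mat \<pi> n nu * h)}"

lemma has_type_presents:
  assumes "has_type v n mu M"
  obtains \<phi> where "presents n \<phi> M (mat_lattice v n (pi_mat \<pi> n mu))"
proof -
  obtain f where "f \<in> mod_iso (val_ring v) M (type_module v n mu)" and M: "Module.module (val_ring v) M"
    using assms unfolding has_type_def by blast
  from that[OF presents_iso(1)[OF this(1) presents_type_module M]] show thesis .
qed

text \<open>\<open>k\<close> changes the basis of the ambient \<oo>^n and \<open>l\<close> that of
  the lattice; only the former alters the presenting map.\<close>

lemma presents_elementary_divisors:
  assumes p: "presents n \<phi> M (mat_lattice v n y)" and k: "k \<in> GL_int v n" and l: "l \<in> GL_int v n"
    and y: "y = k * pi_mat \<pi> n mu * l"
  shows "presents n (\<lambda>x. \<phi> (k *\<^sub>v x)) M (mat_lattice v n (pi_mat \<pi> n mu))"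
proof -
  note kG = GL_int_GL[OF k] and lG = GL_int_GL[OF l]
  have pl: "pi_mat \<pi> n mu * l \<in> carrier (GL TYPE('a) n)" by (rule GL_mult_closed[OF pi_mat_GL(1) lG])
  have y': "y = k * (pi_mat \<pi> n mu * l)"
    unfolding y by (rule assoc_mult_mat[OF GL_int_carrier[OF k] pi_mat_carrier GL_int_carrier[OF l]])
  have "inv\<^bsub>GL TYPE('a) n\<^esub> k * y = pi_mat \<pi> n mu * l"
    unfolding y' by (rule GL_mult_cancel(1)[OF kG GL_carrier_mat[OF pl]])
  then show ?thesis
    using presents_change_basis[OF p _ k] GL_mult_closed[OF kG pl] lattice_mult_GL_int[OF pi_mat_carrier l]
    by (simp add: y')
qed

lemma elementary_divisors_ideal_mat:
  assumes "k \<in> GL_int v n" "l \<in> GL_int v n"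
  shows "k * pi_mat \<pi> n mu * l \<in> ideal_mat v n n 0"
  by (rule ideal_mat_mult_int[OF ideal_mat_int_mult[OF GL_int_ideal_mat[OF assms(1)] pi_mat_ideal_mat]
        GL_int_ideal_mat[OF assms(2)]])

lemma form_decomposition:
  assumes y: "y \<in> carrier (GL TYPE('a) n)" and x: "x \<in> carrier_mat n n"
    and F: "F = inv\<^bsub>GL TYPE('a) n\<^esub> y * x * adj star (inv\<^bsub>GL TYPE('a) n\<^esub> y)"
  shows "F * adj star y = inv\<^bsub>GL TYPE('a) n\<^esub> y * x" "x = y * F * adj star y"
proof -
  let ?i = "inv\<^bsub>GL TYPE('a) n\<^esub> y"
  note ic = GL_inv(2)[OF y] and yc = GL_carrier_mat[OF y]
  have aa: "adj star ?i * adj star y = 1\<^sub>m n"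
    using adj_mult[OF yc ic] GL_inv(3)[OF y] by simp
  have ix: "?i * x \<in> carrier_mat n n" by (rule mult_carrier_mat[OF ic x])
  show eq: "F * adj star y = ?i * x"
    unfolding F using assoc_mult_mat[OF ix adj_carrier[OF ic] adj_carrier[OF yc], of star star] right_mult_one_mat[OF ix]
    by (simp add: aa)
  have Fc: "F \<in> carrier_mat n n" unfolding F by (rule mult_carrier_mat[OF ix adj_carrier[OF ic]])
  show "x = y * F * adj star y"
    using assoc_mult_mat[OF yc Fc adj_carrier[OF yc], of star] GL_mult_cancel(2)[OF y x] by (simp add: eq)
qed

text \<open>Membership of \<open>y\<close> in the double coset makes \<open>y\<close> integral, and
  the inclusion of lattices holds because \<open>inv y * pi_mat \<pi> n lam\<close> is the product
  of an integral form with \<open>adj star y\<close>. Conversely, a Hall submodule comes from a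
  lattice with some elementary divisors and some Hermitian normal form; uniqueness of types
  identifies these as \<open>mu\<close> and \<open>nu\<close>.\<close>

lemma hall_submodules_eq_image:
  assumes hp: "herm_presents n \<phi> M B (pi_mat \<pi> n lam)" and M: "Module.module (val_ring v) M"
    and fin: "finite (carrier M)" and mu: "partition_le n mu" and nu: "partition_le n nu"
  shows "hermitian_hall_submodules v star \<pi> n M B mu nu =
    (\<lambda>y. \<phi> ` mat_lattice v n y) ` hecke_set n mu nu (pi_mat \<pi> n lam)"
    and "y \<in> hecke_set n mu nu (pi_mat \<pi> n lam) \<Longrightarrow>
      y \<in> ideal_mat v n n 0 \<and> mat_lattice v n (pi_mat \<pi> n lam) \<subseteq> mat_lattice v n y"
proof -
  interpret M: Module.module "val_ring v" M by (rule M)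
  let ?D = "pi_mat \<pi> n lam"
  let ?i = "\<lambda>X. inv\<^bsub>GL TYPE('a) n\<^esub> X"
  note p = herm_presentsD(1)[OF hp]
  note ctx = hp M pi_mat_GL(1) adj_pi_mat
  have fin_quot: "finite (carrier (quot_module M N))" for N using fin by simp
  have S: "y \<in> ideal_mat v n n 0 \<and> mat_lattice v n ?D \<subseteq> mat_lattice v n y"
    if y: "y \<in> hecke_set n mu nu ?D" for y
  proof -
    obtain k l h where kl: "k \<in> GL_int v n" "l \<in> GL_int v n" "y = k * pi_mat \<pi> n mu * l"
      and h: "h \<in> GL_int v n" "?i y * ?D * adj star (?i y) = adj star h * pi_mat \<pi> n nu * h"
      and yG: "y \<in> carrier (GL TYPE('a) n)"
      using y unfolding hecke_set_def by blast
    have yi: "y \<in> ideal_mat v n n 0" unfolding kl(3) by (rule elementary_divisors_ideal_mat[OF kl(1,2)])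
    have "?i y * ?D = (adj star h * pi_mat \<pi> n nu * h) * adj star y"
      using form_decomposition(1)[OF yG pi_mat_carrier h(2)[symmetric]] by simp
    also have "\<dots> \<in> ideal_mat v n n 0"
      by (rule ideal_mat_mult_int[OF elementary_divisors_ideal_mat[OF adj_GL_int[OF h(1)] h(1)] adj_ideal_mat[OF yi]])
    finally show ?thesis using lattice_subset_iff[OF yG pi_mat_carrier] yi by simp
  qed
  then show "y \<in> hecke_set n mu nu ?D \<Longrightarrow> y \<in> ideal_mat v n n 0 \<and> mat_lattice v n ?D \<subseteq> mat_lattice v n y" .
  show "hermitian_hall_submodules v star \<pi> n M B mu nu = (\<lambda>y. \<phi> ` mat_lattice v n y) ` hecke_set n mu nu ?D"
  proof (intro equalityI subsetI)
    fix N assume "N \<in> (\<lambda>y. \<phi> ` mat_lattice v n y) ` hecke_set n mu nu ?D"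
    then obtain y where y: "y \<in> hecke_set n mu nu ?D" and N: "N = \<phi> ` mat_lattice v n y" by blast
    obtain k l h where kl: "k \<in> GL_int v n" "l \<in> GL_int v n" "y = k * pi_mat \<pi> n mu * l"
      and h: "h \<in> GL_int v n" "?i y * ?D * adj star (?i y) = adj star h * pi_mat \<pi> n nu * h"
      and yG: "y \<in> carrier (GL TYPE('a) n)"
      using y unfolding hecke_set_def by blast
    from S[OF y] have yi: "y \<in> ideal_mat v n n 0" and sub: "mat_lattice v n ?D \<subseteq> mat_lattice v n y" by simp_all
    have Nsub: "submodule N (val_ring v) M" unfolding N by (rule submodule_lattice(1)[OF p M yi])
    have "has_type v n mu (quot_module M N)"
    proof -
      from presents_elementary_divisors[OF quotient_presentation[OF p M pi_mat_GL(1) yi yG sub] kl]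
      obtain f where "f \<in> mod_iso (val_ring v) (quot_module M N) (type_module v n mu)"
        using presents_transfer[OF _ presents_type_module] unfolding N by blast
      then show ?thesis unfolding has_type_def using module_quot_module[OF M Nsub] fin_quot by blast
    qed
    moreover have F: "pulled_back_form n ?D y = adj star h * pi_mat \<pi> n nu * h"
      unfolding pulled_back_form_def[OF ctx yi yG sub] by (rule h(2))
    have Fi: "pulled_back_form n ?D y \<in> ideal_mat v n n 0"
      unfolding F by (rule elementary_divisors_ideal_mat[OF adj_GL_int[OF h(1)] h(1)])
    have "isotropic v M B (perp v M B N)"
      unfolding N using isotropic_perp_iff[OF ctx yi yG sub] Fi by simp
    moreover have "has_hermitian_type v star \<pi> n nu (quot_module (M\<lparr>carrier := N\<rparr>) (perp v M B N)) (quot_pairing B)"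
      unfolding N
      by (rule has_hermitian_type_if_presents[OF herm_presents_change_basis[OF
              presents_perp_quotient(3)[OF ctx yi yG sub Fi] F h(1) pi_mat_GL(1)]
            presents_perp_quotient(1)[OF ctx yi yG sub Fi] presents_perp_quotient(2)[OF ctx yi yG sub Fi fin]])
    ultimately show "N \<in> hermitian_hall_submodules v star \<pi> n M B mu nu"
      using Nsub by (simp add: hermitian_hall_submodules_def)
  next
    fix N assume "N \<in> hermitian_hall_submodules v star \<pi> n M B mu nu"
    then have Nsub: "submodule N (val_ring v) M" and tmu: "has_type v n mu (quot_module M N)"
      and iso: "isotropic v M B (perp v M B N)"
      and tnu: "has_hermitian_type v star \<pi> n nu (quot_module (M\<lparr>carrier := N\<rparr>) (perp v M B N)) (quot_pairing B)"
      by (simp_all add: hermitian_hall_submodules_def)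
    define L where "L = {x \<in> int_vecs v n. \<phi> x \<in> N}"
    have NL: "N = \<phi> ` L"
    proof (intro equalityI subsetI)
      fix m assume m: "m \<in> N"
      then have "m \<in> \<phi> ` int_vecs v n" using M.submoduleE(1)[OF Nsub] presentsD(1)[OF p] by blast
      then show "m \<in> \<phi> ` L" using m by (auto simp: L_def)
    qed (auto simp: L_def)
    have zeroN: "\<zero>\<^bsub>M\<^esub> \<in> N"
      by (rule additive_subgroup.zero_closed[OF abelian_subgroup.axioms(1)[OF submodule_quotient(1)[OF M Nsub]]])
    \<comment> \<open>A crude exponent that kills \<open>M\<close>: no part of \<open>lam\<close>
      exceeds the sum of all parts. It supplies the fullness required by
      \<open>lattice_basis\<close>.\<close>
    define s where "s = (\<Sum>i<n. lam i)"
    have lam_le: "lam i \<le> s" if "i < n" for i unfolding s_def using that by (intro member_le_sum) auto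
    obtain y where yG: "y \<in> carrier (GL TYPE('a) n)" and yL: "mat_lattice v n y = L"
    proof (rule lattice_basis[of L n s])
      show "L \<subseteq> int_vecs v n" by (auto simp: L_def)
      show "x + z \<in> L" if "x \<in> L" "z \<in> L" for x z
        using that presentsD(3)[OF p, of x z] M.submoduleE(5)[OF Nsub] int_vecs_add[of x n z] by (simp add: L_def)
      show "r \<cdot>\<^sub>v x \<in> L" if "r \<in> val_ideal v 0" "x \<in> L" for r x
        using that presentsD(4)[OF p, of r x] M.submoduleE(4)[OF Nsub] int_vecs_smult[of r x n] by (simp add: L_def)
      show "\<pi> ^ s \<cdot>\<^sub>v x \<in> L" if x: "x \<in> int_vecs v n" for x
      proof -
        have xi: "\<pi> ^ s \<cdot>\<^sub>v x \<in> int_vecs v n"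
          by (intro int_vecs_smult x val_ideal_mono[OF pi_power_in_val_ideal]) simp
        have "\<pi> ^ s * x $ i \<in> val_ideal v (int (lam i))" if i: "i < n" for i
          using lam_le[OF i]
          by (intro val_ideal_mult_right val_ideal_mono[OF pi_power_in_val_ideal] int_vecsD(2)[OF x i]) simp
        then have "\<pi> ^ s \<cdot>\<^sub>v x \<in> mat_lattice v n ?D"
          using mem_lattice_pi_mat[of "\<pi> ^ s \<cdot>\<^sub>v x" n lam] int_vecsD(1)[OF x] by simp
        then have "\<phi> (\<pi> ^ s \<cdot>\<^sub>v x) = \<phi> (0\<^sub>v n)"
          using presentsD(5)[OF p xi int_vecs_zero] int_vecsD(1)[OF xi] by simp
        then show ?thesis using xi presents_zero[OF p M] zeroN by (simp add: L_def)
      qed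
    qed
    have N: "N = \<phi> ` mat_lattice v n y" using NL yL by simp
    have yi: "y \<in> ideal_mat v n n 0"
    proof (rule ideal_matI_int_vecs[OF GL_carrier_mat[OF yG]])
      fix x assume "x \<in> int_vecs v n"
      then have "y *\<^sub>v x \<in> L" unfolding yL[symmetric] mat_lattice_def by blast
      then show "y *\<^sub>v x \<in> int_vecs v n" by (simp add: L_def)
    qed
    have sub: "mat_lattice v n ?D \<subseteq> mat_lattice v n y"
    proof
      fix x assume x: "x \<in> mat_lattice v n ?D"
      then have xi: "x \<in> int_vecs v n" using lattice_int[OF pi_mat_ideal_mat] by blast
      then have "\<phi> x = \<phi> (0\<^sub>v n)" using presentsD(5)[OF p xi int_vecs_zero] x int_vecsD(1)[OF xi] by simp
      then show "x \<in> mat_lattice v n y" using xi presents_zero[OF p M] zeroN by (simp add: yL L_def)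
    qed
    obtain k l kap where kl: "k \<in> GL_int v n" "l \<in> GL_int v n" and kap: "partition_le n kap"
      and yk: "y = k * pi_mat \<pi> n kap * l"
      using smith_form[OF yi yG] by metis
    have p1: "presents n (\<lambda>x. N +>\<^bsub>M\<^esub> \<phi> x) (quot_module M N) (mat_lattice v n y)"
      unfolding N by (rule quotient_presentation[OF p M pi_mat_GL(1) yi yG sub])
    obtain \<psi> where p2: "presents n \<psi> (quot_module M N) (mat_lattice v n (pi_mat \<pi> n mu))"
      using has_type_presents[OF tmu] by metis
    have "kap = mu" by (rule type_unique[OF presents_elementary_divisors[OF p1 kl yk] kap p2 mu])
    let ?F = "pulled_back_form n ?D y"
    have Fi: "?F \<in> ideal_mat v n n 0"
      using iso isotropic_perp_iff[OF ctx yi yG sub] unfolding N by simp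
    note FG = pulled_back_form_GL[OF ctx yi yG sub]
    obtain h kap' where h: "h \<in> GL_int v n" and kap': "partition_le n kap'"
      and Fh: "?F = adj star h * pi_mat \<pi> n kap' * h"
      using hermitian_form[OF Fi FG(1,2)] by metis
    let ?Q = "quot_module (M\<lparr>carrier := N\<rparr>) (perp v M B N)"
    have q1: "herm_presents n (\<lambda>x. perp v M B N +>\<^bsub>M\<lparr>carrier := N\<rparr>\<^esub> \<phi> (y *\<^sub>v x)) ?Q (quot_pairing B) ?F"
      unfolding N by (rule presents_perp_quotient(3)[OF ctx yi yG sub Fi])
    obtain \<chi> where q2: "herm_presents n \<chi> ?Q (quot_pairing B) (pi_mat \<pi> n nu)"
      using has_hermitian_type_presents[OF tnu] by metis
    have "kap' = nu"
      by (rule type_unique[OF herm_presentsD(1)[OF herm_presents_change_basis[OF q1 Fh h pi_mat_GL(1)]] kap'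
            herm_presentsD(1)[OF q2] nu])
    have "?i y * ?D * adj star (?i y) = adj star h * pi_mat \<pi> n nu * h"
      using Fh \<open>kap' = nu\<close> unfolding pulled_back_form_def[OF ctx yi yG sub] by simp
    then have "y \<in> hecke_set n mu nu ?D"
      using yG kl yk h \<open>kap = mu\<close> unfolding hecke_set_def by blast
    then show "N \<in> (\<lambda>y. \<phi> ` mat_lattice v n y) ` hecke_set n mu nu ?D" using N by blast
  qed
qed

section \<open>Open cosets, the convolution as a volume, and its invariance\<close>

lemma ideal_mat_exists:
  assumes X: "X \<in> carrier_mat n m"
  obtains N where "X \<in> ideal_mat v n m (- int N)"
proof -
  \<comment> \<open>A sum stands in for the maximal pole order; it dominates each term since all
    terms are nonnegative.\<close>
  define N where "N = (\<Sum>i<n. \<Sum>j<m. nat (- v (X $$ (i, j))))"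
  have "X $$ (i, j) \<in> val_ideal v (- int N)" if ij: "i < n" "j < m" for i j
  proof -
    have "nat (- v (X $$ (i, j))) \<le> (\<Sum>j<m. nat (- v (X $$ (i, j))))"
      using ij by (intro member_le_sum[of j _ "\<lambda>j. nat (- v (X $$ (i, j)))"]) auto
    also have "\<dots> \<le> N"
      unfolding N_def using ij by (intro member_le_sum[of i _ "\<lambda>i. \<Sum>j<m. nat (- v (X $$ (i, j)))"]) auto
    finally have "- int N \<le> v (X $$ (i, j))" by linarith
    then show ?thesis by (simp add: mem_val_ideal)
  qed
  then show thesis using that[of N] X by (simp add: ideal_mat_def)
qed

text \<open>If the entries of \<open>inv y\<close> have poles of order at most \<open>N\<close> and
  \<open>h\<close> agrees with \<open>y * k\<close> to precision \<open>N + 1\<close>, then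
  \<open>inv y * h\<close> is congruent to \<open>k\<close> modulo the maximal ideal and stays in
  \<open>GL_int\<close>.\<close>

lemma open_coset:
  assumes y: "y \<in> carrier (GL TYPE('a) n)"
  shows "openin (GL_topology v n) ((\<lambda>k. y * k) ` GL_int v n)"
  unfolding openin_subopen[of _ "(\<lambda>k. y * k) ` GL_int v n"]
proof (intro ballI)
  note yc = GL_carrier_mat[OF y] and ic = GL_inv(2)[OF y]
  fix z assume "z \<in> (\<lambda>k. y * k) ` GL_int v n"
  then obtain k where k: "k \<in> GL_int v n" "z = y * k" by blast
  have zG: "z \<in> carrier (GL TYPE('a) n)" unfolding k(2) by (rule GL_mult_closed[OF y GL_int_GL[OF k(1)]])
  note zc = GL_carrier_mat[OF zG] and kc = GL_int_carrier[OF k(1)]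
  obtain N where N: "inv\<^bsub>GL TYPE('a) n\<^esub> y \<in> ideal_mat v n n (- int N)" using ideal_mat_exists[OF ic] .
  define U where "U = {h \<in> carrier (GL TYPE('a) n). elements_mat (h - z) \<subseteq> val_ideal v (int N + 1)}"
  have "openin (GL_topology v n) U"
    unfolding GL_topology_def U_def by (rule topology_generated_by_Basis) (use zG in blast)
  moreover have "z \<in> U"
    using zG elements_subset_iff[of "z - z" n n v "int N + 1"] zc by (auto simp: U_def ideal_mat_def)
  moreover have "U \<subseteq> (\<lambda>k. y * k) ` GL_int v n"
  proof
    fix h assume "h \<in> U"
    then have hG: "h \<in> carrier (GL TYPE('a) n)" and he: "elements_mat (h - z) \<subseteq> val_ideal v (int N + 1)"
      by (simp_all add: U_def)
    note hc = GL_carrier_mat[OF hG]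
    have "h - z \<in> carrier_mat n n" using zc by (rule minus_carrier_mat)
    then have "h - z \<in> ideal_mat v n n (int N + 1)" using he elements_subset_iff by blast
    from ideal_mat_mult[OF N this] have E: "inv\<^bsub>GL TYPE('a) n\<^esub> y * (h - z) \<in> ideal_mat v n n 1" by simp
    have "inv\<^bsub>GL TYPE('a) n\<^esub> y * (h - z) = inv\<^bsub>GL TYPE('a) n\<^esub> y * h - k"
      using mult_minus_distrib_mat[OF ic hc zc] GL_mult_cancel(1)[OF y kc] by (simp add: k(2))
    moreover have ihc: "inv\<^bsub>GL TYPE('a) n\<^esub> y * h \<in> carrier_mat n n" by (rule mult_carrier_mat[OF ic hc])
    moreover have "k + (W - k) = W" if "W \<in> carrier_mat n n" for W
      using kc that by (intro eq_matI) auto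
    ultimately have "inv\<^bsub>GL TYPE('a) n\<^esub> y * h \<in> GL_int v n" using GL_int_open[OF k(1) E] by simp
    then show "h \<in> (\<lambda>k. y * k) ` GL_int v n"
      using GL_mult_cancel(2)[OF y hc] by (intro image_eqI[of h _ "inv\<^bsub>GL TYPE('a) n\<^esub> y * h"]) simp_all
  qed
  ultimately show "\<exists>T. openin (GL_topology v n) T \<and> z \<in> T \<and> T \<subseteq> (\<lambda>k. y * k) ` GL_int v n" by blast
qed

text \<open>\<open>g\<close> is absorbed by \<open>l\<close> in the double coset and acts on the
  form by a congruence. The set is therefore a union of cosets of \<open>GL_int\<close>, so it is
  open and its volume can be counted by lattices.\<close>

lemma hecke_set_right_invariant:
  assumes y: "y \<in> hecke_set n mu nu x" and x: "x \<in> carrier_mat n n" and g: "g \<in> GL_int v n"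
  shows "y * g \<in> hecke_set n mu nu x"
proof -
  let ?i = "\<lambda>X. inv\<^bsub>GL TYPE('a) n\<^esub> X"
  obtain k l h where kl: "k \<in> GL_int v n" "l \<in> GL_int v n" "y = k * pi_mat \<pi> n mu * l"
    and h: "h \<in> GL_int v n" "?i y * x * adj star (?i y) = adj star h * pi_mat \<pi> n nu * h"
    and yG: "y \<in> carrier (GL TYPE('a) n)"
    using y unfolding hecke_set_def by blast
  note gG = GL_int_GL[OF g] and gi = GL_int_inv[OF g]
  note gic = GL_int_carrier[OF gi] and iyc = GL_inv(2)[OF yG] and hc = GL_int_carrier[OF h(1)]
  have kp: "k * pi_mat \<pi> n mu \<in> carrier_mat n n" by (rule mult_carrier_mat[OF GL_int_carrier[OF kl(1)] pi_mat_carrier])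
  have yg: "y * g = k * pi_mat \<pi> n mu * (l * g)"
    unfolding kl(3) by (rule assoc_mult_mat[OF kp GL_int_carrier[OF kl(2)] GL_int_carrier[OF g]])
  define h' where "h' = h * adj star (?i g)"
  have h': "h' \<in> GL_int v n" unfolding h'_def by (rule GL_int_mult[OF h(1) adj_GL_int[OF gi]])
  define gs ys hs where "gs = adj star (?i g)" and "ys = adj star (?i y)" and "hs = adj star h"
  have c: "gs \<in> carrier_mat n n" "ys \<in> carrier_mat n n" "hs \<in> carrier_mat n n"
    using gic iyc hc by (simp_all add: gs_def ys_def hs_def)
  have adjh': "adj star h' = ?i g * hs"
    unfolding h'_def hs_def using adj_mult[OF hc adj_carrier[OF gic]] by simp
  have "?i (y * g) = ?i g * ?i y" by (rule GL_inv_mult[OF yG gG])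
  moreover have "adj star (?i g * ?i y) = ys * gs" unfolding gs_def ys_def by (rule adj_mult[OF gic iyc])
  ultimately have "?i (y * g) * x * adj star (?i (y * g)) = ?i g * (?i y * x * ys) * gs"
    using gic iyc x c by (simp add: assoc_mult_mat[of _ n n _ n _ n])
  also have "\<dots> = ?i g * (hs * pi_mat \<pi> n nu * h) * gs" using h(2) by (simp add: ys_def hs_def)
  also have "\<dots> = adj star h' * pi_mat \<pi> n nu * h'"
    unfolding adjh' using gic hc c by (simp add: h'_def gs_def[symmetric] assoc_mult_mat[of _ n n _ n _ n] mult_carrier_mat[of _ n n _ n])
  finally have "?i (y * g) * x * adj star (?i (y * g)) = adj star h' * pi_mat \<pi> n nu * h'" .
  then show ?thesis
    unfolding hecke_set_def using GL_mult_closed[OF yG gG] kl(1) GL_int_mult[OF kl(2) g] h' yg by blast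
qed

text \<open>The factors \<open>g\<close> cancel in the condition on the form and are absorbed by
  \<open>k\<close> in the double coset. With a left invariant measure this yields invariance of the
  convolution on orbits.\<close>

lemma hecke_set_left_translate:
  assumes g: "g \<in> GL_int v n" and x: "x \<in> carrier_mat n n" and y: "y \<in> hecke_set n mu nu x"
  shows "g * y \<in> hecke_set n mu nu (g * x * adj star g)"
proof -
  let ?i = "\<lambda>X. inv\<^bsub>GL TYPE('a) n\<^esub> X"
  obtain k l h where kl: "k \<in> GL_int v n" "l \<in> GL_int v n" "y = k * pi_mat \<pi> n mu * l"
    and h: "h \<in> GL_int v n" "?i y * x * adj star (?i y) = adj star h * pi_mat \<pi> n nu * h"
    and yG: "y \<in> carrier (GL TYPE('a) n)"
    using y unfolding hecke_set_def by blast
  note gG = GL_int_GL[OF g] and gc = GL_int_carrier[OF g] and iyc = GL_inv(2)[OF yG]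
  note gic = GL_inv(2)[OF gG] and kc = GL_int_carrier[OF kl(1)] and lc = GL_int_carrier[OF kl(2)]
  have gy: "g * y = g * k * pi_mat \<pi> n mu * l"
    unfolding kl(3) using gc kc lc by (simp add: assoc_mult_mat[of _ n n _ n _ n])
  define gs gis ys where "gs = adj star g" and "gis = adj star (?i g)" and "ys = adj star (?i y)"
  have c: "gs \<in> carrier_mat n n" "gis \<in> carrier_mat n n" "ys \<in> carrier_mat n n"
    using gc gic iyc by (simp_all add: gs_def gis_def ys_def)
  have gg: "gs * gis = 1\<^sub>m n" unfolding gs_def gis_def using adj_mult[OF gic gc] GL_inv(4)[OF gG] by simp
  have "?i (g * y) = ?i y * ?i g" by (rule GL_inv_mult[OF gG yG])
  moreover have "adj star (?i y * ?i g) = gis * ys" unfolding gis_def ys_def by (rule adj_mult[OF iyc gic])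
  ultimately have "?i (g * y) * (g * x * gs) * adj star (?i (g * y)) = ?i y * (?i g * g) * x * (gs * gis) * ys"
    using gc gic iyc x c by (simp add: assoc_mult_mat[of _ n n _ n _ n])
  also have "\<dots> = ?i y * x * ys" unfolding gg GL_inv(4)[OF gG] using iyc x by simp
  finally have "?i (g * y) * (g * x * gs) * adj star (?i (g * y)) = adj star h * pi_mat \<pi> n nu * h"
    using h(2) by (simp add: ys_def)
  then show ?thesis
    unfolding hecke_set_def using GL_mult_closed[OF gG yG] GL_int_mult[OF g kl(1)] kl(2) h(1) gy
    unfolding gs_def by blast
qed

lemma hecke_set_translate_eq:
  assumes g: "g \<in> GL_int v n" and x: "x \<in> carrier_mat n n"
  shows "hecke_set n mu nu (g * x * adj star g) = (\<lambda>y. g * y) ` hecke_set n mu nu x"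
proof (intro equalityI subsetI)
  fix y assume y: "y \<in> hecke_set n mu nu (g * x * adj star g)"
  let ?j = "inv\<^bsub>GL TYPE('a) n\<^esub> g"
  note gG = GL_int_GL[OF g] and gc = GL_int_carrier[OF g] and gic = GL_inv(2)[OF GL_int_GL[OF g]]
  define gs gis where "gs = adj star g" and "gis = adj star ?j"
  have c: "gs \<in> carrier_mat n n" "gis \<in> carrier_mat n n" using gc gic by (simp_all add: gs_def gis_def)
  have gg: "gs * gis = 1\<^sub>m n" unfolding gs_def gis_def using adj_mult[OF gic gc] GL_inv(4)[OF gG] by simp
  have X: "g * x * gs \<in> carrier_mat n n" by (rule mult_carrier_mat[OF mult_carrier_mat[OF gc x] c(1)])
  have "?j * (g * x * gs) * gis = (?j * g) * x * (gs * gis)"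
    using gc gic x c by (simp add: assoc_mult_mat[of _ n n _ n _ n])
  also have "\<dots> = x" unfolding gg GL_inv(4)[OF gG] using x by simp
  finally have "?j * y \<in> hecke_set n mu nu x"
    using hecke_set_left_translate[OF GL_int_inv[OF g] X y[folded gs_def]] by (simp add: gis_def)
  moreover have "y \<in> carrier_mat n n" using y GL_carrier_mat by (auto simp: hecke_set_def)
  ultimately show "y \<in> (\<lambda>y. g * y) ` hecke_set n mu nu x"
    using GL_mult_cancel(2)[OF gG] by (metis image_eqI)
qed (use hecke_set_left_translate[OF g x] in auto)

lemma open_hecke_set:
  assumes x: "x \<in> carrier_mat n n"
  shows "openin (GL_topology v n) (hecke_set n mu nu x)"
  unfolding openin_subopen[of _ "hecke_set n mu nu x"]
proof (intro ballI)
  fix y assume y: "y \<in> hecke_set n mu nu x"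
  then have yG: "y \<in> carrier (GL TYPE('a) n)" by (simp add: hecke_set_def)
  have "y \<in> (\<lambda>k. y * k) ` GL_int v n"
    using GL_int_one[of n] GL_carrier_mat[OF yG] by (intro image_eqI[of _ _ "1\<^sub>m n"]) simp_all
  then show "\<exists>T. openin (GL_topology v n) T \<and> y \<in> T \<and> T \<subseteq> hecke_set n mu nu x"
    using open_coset[OF yG] hecke_set_right_invariant[OF y x] by blast
qed

lemma hecke_conv_eq_measure:
  assumes haar: "normalized_haar v n dy" and x: "x \<in> carrier_mat n n"
  shows "hecke_conv star n dy (hecke_c v \<pi> n mu) (her_c v star \<pi> n nu) x =
    of_real (measure dy (hecke_set n mu nu x))"
proof -
  have sp: "space dy = carrier (GL TYPE('a) n)" using haar by (simp add: normalized_haar_def)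
  have "hecke_conv star n dy (hecke_c v \<pi> n mu) (her_c v star \<pi> n nu) x =
      (\<integral>y. complex_of_real (indicator (hecke_set n mu nu x) y) \<partial>dy)"
    unfolding hecke_conv_def
  proof (rule Bochner_Integration.integral_cong[OF refl])
    fix y assume "y \<in> space dy"
    then show "hecke_c v \<pi> n mu y *
        her_c v star \<pi> n nu (inv\<^bsub>GL TYPE('a) n\<^esub> y * x * adj star (inv\<^bsub>GL TYPE('a) n\<^esub> y)) =
        complex_of_real (indicator (hecke_set n mu nu x) y)"
      by (auto simp: sp hecke_c_def her_c_def hecke_set_def indicator_def)
  qed
  also have "\<dots> = of_real (measure dy (hecke_set n mu nu x \<inter> space dy))"
    by (simp only: integral_complex_of_real integral_indicator)
  also have "hecke_set n mu nu x \<inter> space dy = hecke_set n mu nu x" by (auto simp: sp hecke_set_def)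
  finally show ?thesis .
qed

text \<open>Left invariance of the measure makes the convolution constant on orbits of
  \<open>GL_int\<close>, a precondition for an expansion in the functions
  \<open>her_c\<close>.\<close>

lemma hecke_conv_translate:
  assumes haar: "normalized_haar v n dy" and g: "g \<in> GL_int v n" and x: "x \<in> carrier_mat n n"
  shows "hecke_conv star n dy (hecke_c v \<pi> n mu) (her_c v star \<pi> n nu) (g * x * adj star g) =
    hecke_conv star n dy (hecke_c v \<pi> n mu) (her_c v star \<pi> n nu) x"
proof -
  have "hecke_set n mu nu x \<in> sets dy"
    using haar open_hecke_set[OF x] by (auto simp: normalized_haar_def intro: sigma_sets.Basic)
  then have "emeasure dy ((\<lambda>y. g * y) ` hecke_set n mu nu x) = emeasure dy (hecke_set n mu nu x)"
    using haar GL_int_GL[OF g] by (simp add: normalized_haar_def)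
  moreover have "g * x * adj star g \<in> carrier_mat n n"
    by (rule mult_carrier_mat[OF mult_carrier_mat[OF GL_int_carrier[OF g] x] adj_carrier[OF GL_int_carrier[OF g]]])
  ultimately show ?thesis
    using hecke_conv_eq_measure[OF haar] x hecke_set_translate_eq[OF g x] by (simp add: measure_def)
qed

text \<open>Each submodule contributes the coset of one chosen representative, a left translate of
  \<open>GL_int\<close>. Cosets of different submodules are disjoint because a coset determines its
  lattice. Finiteness of \<open>M\<close> leaves finitely many submodules, so the volumes add
  up.\<close>

lemma measure_hecke_set:
  assumes haar: "normalized_haar v n dy" and hp: "herm_presents n \<phi> M B (pi_mat \<pi> n lam)"
    and M: "Module.module (val_ring v) M" and fin: "finite (carrier M)"
    and mu: "partition_le n mu" and nu: "partition_le n nu"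
  shows "measure dy (hecke_set n mu nu (pi_mat \<pi> n lam)) = card (hermitian_hall_submodules v star \<pi> n M B mu nu)"
proof -
  let ?S = "hecke_set n mu nu (pi_mat \<pi> n lam)" and ?H = "hermitian_hall_submodules v star \<pi> n M B mu nu"
  note H = hall_submodules_eq_image[OF hp M fin mu nu]
  have finH: "finite ?H"
  proof (rule finite_subset)
    show "?H \<subseteq> Pow (carrier M)"
      using module.submoduleE(1)[OF M] by (auto simp: hermitian_hall_submodules_def)
  qed (use fin in simp)
  define rep where "rep N = (SOME y. y \<in> ?S \<and> \<phi> ` mat_lattice v n y = N)" for N
  have rep: "rep N \<in> ?S \<and> \<phi> ` mat_lattice v n (rep N) = N" if "N \<in> ?H" for N
    unfolding rep_def by (rule someI_ex) (use that H(1) in auto)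
  define coset where "coset N = (\<lambda>k. rep N * k) ` GL_int v n" for N
  have SG: "y \<in> carrier (GL TYPE('a) n)" if "y \<in> ?S" for y using that by (simp add: hecke_set_def)
  have coset_lattice: "mat_lattice v n y = mat_lattice v n (rep N)" if "N \<in> ?H" "y \<in> coset N" for N y
    using that lattice_mult_GL_int[OF GL_carrier_mat[OF SG]] rep by (auto simp: coset_def)
  have coset_meas: "coset N \<in> sets dy" "emeasure dy (coset N) = 1" if N: "N \<in> ?H" for N
  proof -
    have G: "rep N \<in> carrier (GL TYPE('a) n)" using rep[OF N] SG by blast
    then show "coset N \<in> sets dy"
      using haar open_coset[OF G] by (auto simp: normalized_haar_def coset_def intro: sigma_sets.Basic)
    have "(\<lambda>k. 1\<^sub>m n * k) ` GL_int v n = GL_int v n"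
      using left_mult_one_mat[OF GL_int_carrier] by (simp cong: image_cong)
    moreover have "1\<^sub>m n \<in> carrier (GL TYPE('a) n)" by (rule GL_int_GL[OF GL_int_one])
    ultimately have "GL_int v n \<in> sets dy"
      using haar open_coset[of "1\<^sub>m n" n] by (auto simp: normalized_haar_def intro: sigma_sets.Basic)
    then show "emeasure dy (coset N) = 1"
      using haar G unfolding coset_def normalized_haar_def by metis
  qed
  have "?S = (\<Union>N\<in>?H. coset N)"
  proof (intro equalityI subsetI)
    fix y assume y: "y \<in> ?S"
    define N where "N = \<phi> ` mat_lattice v n y"
    have N: "N \<in> ?H" using y H(1) N_def by blast
    note yi = H(2)[OF y] and ri = H(2)[OF conjunct1[OF rep[OF N]]]
    have "mat_lattice v n y = mat_lattice v n (rep N)"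
    proof -
      \<comment> \<open>A lattice containing the kernel is recovered from its image in
        \<open>M\<close>, so equal submodules come from equal lattices.\<close>
      have iff: "x \<in> mat_lattice v n z \<longleftrightarrow> x \<in> int_vecs v n \<and> \<phi> x \<in> \<phi> ` mat_lattice v n z"
        if "z \<in> ideal_mat v n n 0 \<and> mat_lattice v n (pi_mat \<pi> n lam) \<subseteq> mat_lattice v n z" for x z
        using submodule_lattice(2)[OF herm_presentsD(1)[OF hp] M, of z x] lattice_int[of z n] that by blast
      show ?thesis using iff[OF yi] iff[OF ri] rep[OF N] N_def by blast
    qed
    then have "inv\<^bsub>GL TYPE('a) n\<^esub> (rep N) * y \<in> GL_int v n"
      using lattice_eq_iff[OF SG[OF conjunct1[OF rep[OF N]]] SG[OF y]] by simp
    then have "y \<in> coset N"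
      unfolding coset_def
      using GL_mult_cancel(2)[OF SG[OF conjunct1[OF rep[OF N]]] GL_carrier_mat[OF SG[OF y]]] by (metis image_eqI)
    then show "y \<in> (\<Union>N\<in>?H. coset N)" using N by blast
  next
    fix y assume "y \<in> (\<Union>N\<in>?H. coset N)"
    then obtain N k where "N \<in> ?H" "k \<in> GL_int v n" "y = rep N * k" by (auto simp: coset_def)
    then show "y \<in> ?S" using hecke_set_right_invariant[OF _ pi_mat_carrier] rep by blast
  qed
  moreover have "disjoint_family_on coset ?H"
    unfolding disjoint_family_on_def
  proof (intro ballI impI)
    fix N N' assume NN: "N \<in> ?H" "N' \<in> ?H" "N \<noteq> N'"
    show "coset N \<inter> coset N' = {}"
      using coset_lattice[OF NN(1)] coset_lattice[OF NN(2)] rep[OF NN(1)] rep[OF NN(2)] NN(3) by fastforce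
  qed
  moreover have "coset ` ?H \<subseteq> sets dy" using coset_meas(1) by blast
  ultimately have "emeasure dy ?S = (\<Sum>N\<in>?H. emeasure dy (coset N))"
    using sum_emeasure[of coset ?H dy] finH by simp
  also have "\<dots> = of_nat (card ?H)" using coset_meas(2) by simp
  finally show ?thesis by (simp add: measure_def)
qed

section \<open>Expansion in indicators of orbits\<close>

lemma congruent_pi_mats_eq:
  assumes h: "h \<in> GL_int v n" and eq: "pi_mat \<pi> n lam = adj star h * pi_mat \<pi> n kap * h"
    and lam: "partition_le n lam" and kap: "partition_le n kap"
  shows "lam = kap"
proof -
  \<comment> \<open>Once the pairing is forgotten, a congruence is a special equivalence, and the
    same module acquires both types.\<close>
  have "presents n (type_proj v n lam) (type_module v n lam) (mat_lattice v n (adj star h * pi_mat \<pi> n kap * h))"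
    unfolding eq[symmetric] by (rule presents_type_module)
  from presents_elementary_divisors[OF this adj_GL_int[OF h] h refl]
  show ?thesis by (rule type_unique[OF presents_type_module lam _ kap])
qed

text \<open>Multiplying by the inverse of \<open>h\<close> turns a common point of two orbits into a
  congruence between two diagonal matrices. Disjointness of the orbits gives linear independence of
  the functions \<open>her_c\<close>.\<close>

lemma her_c_orbit:
  assumes h: "h \<in> GL_int v n" and lam: "partition_le n lam" and kap: "partition_le n kap"
  shows "her_c v star \<pi> n kap (adj star h * pi_mat \<pi> n lam * h) = (if kap = lam then 1 else 0)"
proof -
  have "kap = lam" if "k \<in> GL_int v n" "adj star h * pi_mat \<pi> n lam * h = adj star k * pi_mat \<pi> n kap * k" for k
  proof -
    let ?i = "inv\<^bsub>GL TYPE('a) n\<^esub> h"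
    note hc = GL_int_carrier[OF h] and kc = GL_int_carrier[OF that(1)] and inv = GL_inv[OF GL_int_GL[OF h]]
    define hs his ks where "hs = adj star h" and "his = adj star ?i" and "ks = adj star k"
    have c: "hs \<in> carrier_mat n n" "his \<in> carrier_mat n n" "ks \<in> carrier_mat n n"
      using hc inv(2) kc by (simp_all add: hs_def his_def ks_def)
    have hh: "his * hs = 1\<^sub>m n" unfolding his_def hs_def using adj_mult[OF hc inv(2)] inv(3) by simp
    have "pi_mat \<pi> n lam = (his * hs) * pi_mat \<pi> n lam * (h * ?i)" unfolding hh inv(3) by simp
    also have "\<dots> = his * (hs * pi_mat \<pi> n lam * h) * ?i"
      using hc inv(2) c by (simp add: assoc_mult_mat[of _ n n _ n _ n] mult_carrier_mat[of _ n n _ n])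
    also have "\<dots> = his * (ks * pi_mat \<pi> n kap * k) * ?i" using that(2) by (simp add: hs_def ks_def)
    also have "\<dots> = (his * ks) * pi_mat \<pi> n kap * (k * ?i)"
      using hc inv(2) c kc by (simp add: assoc_mult_mat[of _ n n _ n _ n] mult_carrier_mat[of _ n n _ n])
    also have "his * ks = adj star (k * ?i)"
      unfolding his_def ks_def by (rule adj_mult[OF kc inv(2), symmetric])
    finally have "pi_mat \<pi> n lam = adj star (k * ?i) * pi_mat \<pi> n kap * (k * ?i)" .
    then show ?thesis
      using congruent_pi_mats_eq[OF GL_int_mult[OF that(1) GL_int_inv[OF h]] _ lam kap] by simp
  qed
  then show ?thesis using h by (auto simp: her_c_def indicator_def)
qed

lemma her_c_nonzero: "her_c v star \<pi> n kap x \<noteq> 0 \<Longrightarrow> \<exists>h\<in>GL_int v n. x = adj star h * pi_mat \<pi> n kap * h"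
  by (auto simp: her_c_def indicator_def split: if_splits)

text \<open>On the support, \<open>x = y * F * adj star y\<close> with \<open>y\<close> and
  \<open>F\<close> integral, so \<open>x\<close> is integral and its normal form has nonnegative
  exponents. No other orbits can enter the expansion.\<close>

lemma hecke_set_nonempty_form:
  assumes y: "y \<in> hecke_set n mu nu x" and x: "x \<in> herm_GL star n"
  obtains h kap where "h \<in> GL_int v n" "partition_le n kap" "x = adj star h * pi_mat \<pi> n kap * h"
proof -
  obtain k l h where kl: "k \<in> GL_int v n" "l \<in> GL_int v n" "y = k * pi_mat \<pi> n mu * l"
    and h: "h \<in> GL_int v n" "inv\<^bsub>GL TYPE('a) n\<^esub> y * x * adj star (inv\<^bsub>GL TYPE('a) n\<^esub> y) = adj star h * pi_mat \<pi> n nu * h"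
    and yG: "y \<in> carrier (GL TYPE('a) n)"
    using y unfolding hecke_set_def by blast
  have xG: "x \<in> carrier (GL TYPE('a) n)" "adj star x = x" using x by (simp_all add: herm_GL_def)
  have yi: "y \<in> ideal_mat v n n 0" unfolding kl(3) by (rule elementary_divisors_ideal_mat[OF kl(1,2)])
  have "x = y * (adj star h * pi_mat \<pi> n nu * h) * adj star y"
    by (rule form_decomposition(2)[OF yG GL_carrier_mat[OF xG(1)] h(2)[symmetric]])
  also have "\<dots> \<in> ideal_mat v n n 0"
    by (rule ideal_mat_mult_int[OF ideal_mat_int_mult[OF yi elementary_divisors_ideal_mat[OF adj_GL_int[OF h(1)] h(1)]]
          adj_ideal_mat[OF yi]])
  finally show thesis using hermitian_form[OF _ xG] that by metis
qed

lemma val_det_pi_mat: "det (pi_mat \<pi> n kap) \<noteq> 0" "v (det (pi_mat \<pi> n kap)) = int (\<Sum>i<n. kap i)"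
proof -
  have "upper_triangular (pi_mat \<pi> n kap)" by (auto simp: pi_mat_index)
  from det_upper_triangular[OF this pi_mat_carrier]
  have "det (pi_mat \<pi> n kap) = (\<Prod>i<n. \<pi> ^ kap i)"
    by (simp add: prod_list_diag_prod pi_mat_index lessThan_atLeast0)
  then have "det (pi_mat \<pi> n kap) = \<pi> ^ (\<Sum>i<n. kap i)" by (simp add: power_sum)
  then show "det (pi_mat \<pi> n kap) \<noteq> 0" "v (det (pi_mat \<pi> n kap)) = int (\<Sum>i<n. kap i)"
    by (simp_all add: val_power del: of_nat_sum)
qed

lemma val_det_elementary:
  assumes "k \<in> GL_int v n" "l \<in> GL_int v n"
  shows "det (k * pi_mat \<pi> n mu * l) \<noteq> 0" "v (det (k * pi_mat \<pi> n mu * l)) = int (\<Sum>i<n. mu i)"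
proof -
  note c = GL_int_carrier[OF assms(1)] GL_int_carrier[OF assms(2)]
  have "det (k * pi_mat \<pi> n mu * l) = det k * det (pi_mat \<pi> n mu) * det l"
    by (simp only: det_mult[of _ n] mult_carrier_mat[of _ n n _ n] c pi_mat_carrier)
  then show "det (k * pi_mat \<pi> n mu * l) \<noteq> 0" "v (det (k * pi_mat \<pi> n mu * l)) = int (\<Sum>i<n. mu i)"
    using det_GL_int[OF assms(1)] det_GL_int[OF assms(2)] val_det_pi_mat
    by (simp_all add: val_mult del: of_nat_sum)
qed

text \<open>Valuations of determinants: \<open>y\<close> and its adjoint each contribute the size of
  \<open>mu\<close>, the form contributes that of \<open>nu\<close>. Only finitely many partitions
  have a given size, so the expansion is finite.\<close>

lemma hecke_set_nonempty_sum:
  assumes y: "y \<in> hecke_set n mu nu (pi_mat \<pi> n kap)"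
  shows "(\<Sum>i<n. kap i) = 2 * (\<Sum>i<n. mu i) + (\<Sum>i<n. nu i)"
proof -
  obtain k l h where kl: "k \<in> GL_int v n" "l \<in> GL_int v n" "y = k * pi_mat \<pi> n mu * l"
    and h: "h \<in> GL_int v n" "inv\<^bsub>GL TYPE('a) n\<^esub> y * pi_mat \<pi> n kap * adj star (inv\<^bsub>GL TYPE('a) n\<^esub> y) = adj star h * pi_mat \<pi> n nu * h"
    and yG: "y \<in> carrier (GL TYPE('a) n)"
    using y unfolding hecke_set_def by blast
  define F ys where "F = adj star h * pi_mat \<pi> n nu * h" and "ys = adj star y"
  note yc = GL_carrier_mat[OF yG] and hc = GL_int_carrier[OF h(1)]
  have c: "F \<in> carrier_mat n n" "ys \<in> carrier_mat n n"
    unfolding F_def ys_def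
    by (rule mult_carrier_mat[OF mult_carrier_mat[OF adj_carrier[OF hc] pi_mat_carrier] hc], rule adj_carrier[OF yc])
  have "pi_mat \<pi> n kap = y * F * ys"
    unfolding F_def ys_def by (rule form_decomposition(2)[OF yG pi_mat_carrier h(2)[symmetric]])
  then have "det (pi_mat \<pi> n kap) = det y * det F * det ys"
    by (simp only: det_mult[of _ n] mult_carrier_mat[of _ n n _ n] c yc)
  moreover have "det y \<noteq> 0" "v (det y) = int (\<Sum>i<n. mu i)"
    unfolding kl(3) by (rule val_det_elementary[OF kl(1,2)])+
  moreover have "det F \<noteq> 0" "v (det F) = int (\<Sum>i<n. nu i)"
    unfolding F_def by (rule val_det_elementary[OF adj_GL_int[OF h(1)] h(1)])+
  moreover have "det ys \<noteq> 0" "v (det ys) = int (\<Sum>i<n. mu i)"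
  proof -
    define ls ks where "ls = adj star l" and "ks = adj star k"
    have lk: "ls \<in> GL_int v n" "ks \<in> GL_int v n" using kl adj_GL_int by (simp_all add: ls_def ks_def)
    note kc = GL_int_carrier[OF kl(1)] and lc = GL_int_carrier[OF kl(2)]
    have "ys = ls * (pi_mat \<pi> n mu * ks)"
      unfolding ys_def kl(3) adj_mult[OF mult_carrier_mat[OF kc pi_mat_carrier] lc] adj_mult[OF kc pi_mat_carrier]
      by (simp add: ls_def ks_def)
    then have "ys = ls * pi_mat \<pi> n mu * ks"
      using assoc_mult_mat[OF GL_int_carrier[OF lk(1)] pi_mat_carrier GL_int_carrier[OF lk(2)]] by simp
    then show "det ys \<noteq> 0" "v (det ys) = int (\<Sum>i<n. mu i)" using val_det_elementary[OF lk] by simp_all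
  qed
  ultimately have "int (\<Sum>i<n. kap i) = int (2 * (\<Sum>i<n. mu i) + (\<Sum>i<n. nu i))"
    using val_det_pi_mat(2)[of n kap] by (simp add: val_mult del: of_nat_sum)
  then show ?thesis by (simp only: of_nat_eq_iff)
qed

lemma finite_partitions_bounded: "finite {kap. partition_le n kap \<and> (\<Sum>i<n. kap i) = C}"
proof (rule finite_subset)
  show "{kap. partition_le n kap \<and> (\<Sum>i<n. kap i) = C} \<subseteq>
      {kap. \<forall>i. (i \<in> {..<n} \<longrightarrow> kap i \<in> {..C}) \<and> (i \<notin> {..<n} \<longrightarrow> kap i = 0)}"
  proof (intro subsetI CollectI allI conjI impI)
    fix kap i assume k: "kap \<in> {kap. partition_le n kap \<and> (\<Sum>i<n. kap i) = C}" and i: "i \<in> {..<n}"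
    show "kap i \<in> {..C}" using member_le_sum[of i "{..<n}" kap] k i by auto
  qed (auto simp: partition_le_def)
qed (rule finite_set_of_finite_funs; simp)

text \<open>The coefficient at \<open>kap\<close> has to be the value at the diagonal
  representative. On the orbit of a partition the sum collapses to that term; on all other Hermitian
  matrices both sides vanish.\<close>

lemma her_expansion_exists:
  assumes haar: "normalized_haar v n dy"
  shows "\<exists>a. her_expansion v star \<pi> n (hecke_conv star n dy (hecke_c v \<pi> n mu) (her_c v star \<pi> n nu)) a"
proof -
  let ?f = "hecke_conv star n dy (hecke_c v \<pi> n mu) (her_c v star \<pi> n nu)"
  define a where "a kap = (if partition_le n kap then ?f (pi_mat \<pi> n kap) else 0)" for kap
  have ne: "\<exists>y. y \<in> hecke_set n mu nu x" if "?f x \<noteq> 0" "x \<in> carrier_mat n n" for x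
  proof (rule ccontr)
    assume "\<nexists>y. y \<in> hecke_set n mu nu x"
    then have "hecke_set n mu nu x = {}" by blast
    then show False using that hecke_conv_eq_measure[OF haar that(2), of mu nu] by simp
  qed
  have part: "partition_le n kap" if "a kap \<noteq> 0" for kap using that by (auto simp: a_def split: if_splits)
  have fin: "finite {kap. a kap \<noteq> 0}"
  proof (rule finite_subset[OF _ finite_partitions_bounded])
    show "{kap. a kap \<noteq> 0} \<subseteq> {kap. partition_le n kap \<and> (\<Sum>i<n. kap i) = 2 * (\<Sum>i<n. mu i) + (\<Sum>i<n. nu i)}"
    proof
      fix kap assume kap: "kap \<in> {kap. a kap \<noteq> 0}"
      then have "?f (pi_mat \<pi> n kap) \<noteq> 0" by (simp add: a_def split: if_splits)
      from ne[OF this pi_mat_carrier] obtain y where "y \<in> hecke_set n mu nu (pi_mat \<pi> n kap)" ..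
      from hecke_set_nonempty_sum[OF this] part kap
      show "kap \<in> {kap. partition_le n kap \<and> (\<Sum>i<n. kap i) = 2 * (\<Sum>i<n. mu i) + (\<Sum>i<n. nu i)}"
        by simp
    qed
  qed
  have "?f x = (\<Sum>kap | a kap \<noteq> 0. a kap * her_c v star \<pi> n kap x)" if x: "x \<in> herm_GL star n" for x
  proof (cases "\<exists>h\<in>GL_int v n. \<exists>kap. partition_le n kap \<and> x = adj star h * pi_mat \<pi> n kap * h")
    case True
    then obtain h kap0 where h: "h \<in> GL_int v n" "partition_le n kap0" "x = adj star h * pi_mat \<pi> n kap0 * h"
      by blast
    have "(\<Sum>kap | a kap \<noteq> 0. a kap * her_c v star \<pi> n kap x) = (\<Sum>kap | a kap \<noteq> 0. if kap = kap0 then a kap0 else 0)"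
      using part h by (intro sum.cong) (auto simp: her_c_orbit)
    also have "\<dots> = a kap0" using fin by simp
    also have "\<dots> = ?f x"
      using hecke_conv_translate[where x = "pi_mat \<pi> n kap0" and mu = mu and nu = nu,
          OF haar adj_GL_int[OF h(1)] pi_mat_carrier] h(2,3) by (simp add: a_def)
    finally show ?thesis by simp
  next
    case False
    have xc: "x \<in> carrier_mat n n" using x GL_carrier_mat by (auto simp: herm_GL_def)
    have "?f x = 0"
      using ne[OF _ xc] hecke_set_nonempty_form[OF _ x] False by metis
    moreover have "her_c v star \<pi> n kap x = 0" if "a kap \<noteq> 0" for kap
      using her_c_nonzero[of n kap x] False part[OF that] by blast
    ultimately show ?thesis by simp
  qed
  then have "her_expansion v star \<pi> n ?f a"
    unfolding her_expansion_def using fin part by blast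
  then show ?thesis by blast
qed

text \<open>Evaluation at the diagonal representative isolates one coefficient, as the indicators of
  the other orbits vanish there.\<close>

lemma her_expansion_coeff:
  assumes "her_expansion v star \<pi> n f a" and lam: "partition_le n lam"
  shows "a lam = f (pi_mat \<pi> n lam)"
proof -
  have fin: "finite {kap. a kap \<noteq> 0}" and part: "\<And>kap. a kap \<noteq> 0 \<Longrightarrow> partition_le n kap"
    and f: "\<And>x. x \<in> herm_GL star n \<Longrightarrow> f x = (\<Sum>kap | a kap \<noteq> 0. a kap * her_c v star \<pi> n kap x)"
    using assms(1) unfolding her_expansion_def by blast+
  have one: "her_c v star \<pi> n kap (pi_mat \<pi> n lam) = (if kap = lam then 1 else 0)" if "partition_le n kap" for kap
    using her_c_orbit[OF GL_int_one lam that] by simp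
  have "f (pi_mat \<pi> n lam) = (\<Sum>kap | a kap \<noteq> 0. a kap * her_c v star \<pi> n kap (pi_mat \<pi> n lam))"
    by (rule f) (simp add: herm_GL_def pi_mat_GL(1))
  also have "\<dots> = (\<Sum>kap | a kap \<noteq> 0. if kap = lam then a lam else 0)"
    using part by (intro sum.cong) (auto simp: one)
  also have "\<dots> = a lam" using fin by simp
  finally show ?thesis by simp
qed

end

theorem theorem4p7:
  fixes v :: "'a::field_char_0 \<Rightarrow> int" and star :: "'a \<Rightarrow> 'a" and \<pi> :: 'a
    and n :: nat and lam mu nu :: "nat \<Rightarrow> nat"
    and dy :: "'a mat measure"
    and M :: "('a, 'm) module" and B :: "'m \<Rightarrow> 'm \<Rightarrow> 'a set"
  assumes "unramified_involution v star \<pi>"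
    and "n \<ge> 1"
    and "partition_le n lam" and "partition_le n mu" and "partition_le n nu"
    and "normalized_haar v n dy"
    and "has_hermitian_type v star \<pi> n lam M B"
  shows "hecke_conv star n dy (hecke_c v \<pi> n mu) (her_c v star \<pi> n nu) (pi_mat \<pi> n lam)
           = of_nat (card (hermitian_hall_submodules v star \<pi> n M B mu nu))
       \<and> (\<exists>a. her_expansion v star \<pi> n
                (hecke_conv star n dy (hecke_c v \<pi> n mu) (her_c v star \<pi> n nu)) a)
       \<and> (\<forall>a. her_expansion v star \<pi> n
                (hecke_conv star n dy (hecke_c v \<pi> n mu) (her_c v star \<pi> n nu)) a \<longrightarrow>
              a lam = of_nat (card (hermitian_hall_submodules v star \<pi> n M B mu nu)))"
proof -
  interpret unramified_involution v star \<pi> by fact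
  have M: "Module.module (val_ring v) M" "finite (carrier M)"
    using assms(7) unfolding has_hermitian_type_def hermitian_module_def by blast+
  \<comment> \<open>The type hypothesis yields a presentation of \<open>M\<close> with the diagonal
    form, so submodules are counted in \<open>M\<close> itself and not in a standard model.\<close>
  obtain \<phi> where hp: "herm_presents n \<phi> M B (pi_mat \<pi> n lam)"
    using has_hermitian_type_presents[OF assms(7)] .
  have "hecke_conv star n dy (hecke_c v \<pi> n mu) (her_c v star \<pi> n nu) (pi_mat \<pi> n lam)
      = of_nat (card (hermitian_hall_submodules v star \<pi> n M B mu nu))"
    unfolding hecke_conv_eq_measure[OF assms(6) pi_mat_carrier] measure_hecke_set[OF assms(6) hp M assms(4,5)]
    by simp
  then show ?thesis
    by (intro conjI allI impI her_expansion_exists[OF assms(6)])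
       (simp_all add: her_expansion_coeff[OF _ assms(3)])
qed

end
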